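(* Let $X$ be the limit curve (almost sure uniform limit of $X_n(t)=\mathrm{LI}(u_1T_nu_2)(\bar\alpha^nt)$ for a consistent sequence $(T_n)$ of uniform spanning trees), $\bar\alpha=\frac43+\frac1{15}\sqrt{205}$, $\gamma_\ell=\log2/\log\bar\alpha$, $\gamma_r=\log3/\log\bar\alpha$. Then: (a) for every $p>0$ there are constants $C_9(p),C_{10}(p)>0$ such that for all $s\in[0,\infty)$ and $t\in[0,1]$, \[C_9(p)\,t^{p\gamma_\ell}\le\mathbb E\|X(t)\|_2^p\qquad\text{and}\qquad\mathbb E\|X(s+t)-X(s)\|_2^p\le C_{10}(p)\,t^{p\gamma_\ell};\] (b) there are constants $C_{11},C_{12}>0$ such that for every $s\in[0,\infty)$, almost surely \[\limsup_{t\searrow0}\frac{\|X(s+t)-X(s)\|_2}{t^{\gamma_\ell}(\log\log(1/t))^{1-\gamma_\ell}}\le C_{11},\qquad \liminf_{t\searrow0}\frac{\|X(t)\|_2}{t^{\gamma_\ell}(\log\log(1/t))^{-\gamma_\ell(1-1/\gamma_r)}}\ge C_{12}.\]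
   Context: Let $u_1=(0,0)$, $u_2=(1,0)$, $u_3=(\tfrac12,\tfrac{\sqrt3}2)$ in $\mathbb R^2$ and $\psi_i(x)=\tfrac12(x-u_i)+u_i$ for $i\in\{1,2,3\}$. The Sierpiński gasket $K$ is the unique nonempty compact set with $K=\psi_1(K)\cup\psi_2(K)\cup\psi_3(K)$. The Sierpiński graphs $G_n$ (embedded in the plane, all edges as straight segments lie in $K$) are defined recursively: $G_0$ has vertex set $VG_0=\{u_1,u_2,u_3\}$ and edge set $\{\{u_1,u_2\},\{u_2,u_3\},\{u_3,u_1\}\}$; $G_{n+1}$ has vertex set $\psi_1(VG_n)\cup\psi_2(VG_n)\cup\psi_3(VG_n)$ and edge set $\psi_1(EG_n)\cup\psi_2(EG_n)\cup\psi_3(EG_n)$ (edges mapped vertexwise). For a word $w=w_1\cdots w_k\in\{1,2,3\}^k$ put $\psi_w=\psi_{w_1}\circ\cdots\circ\psi_{w_k}$; then $G_n=\bigcup_{w\in\{1,2,3\}^k}\psi_w(G_{n-k})$. For a spanning subgraph $H\subseteq G_n$ and $w\in\{1,2,3\}^k$, $\pi_w(H)=\psi_w^{-1}(H\cap\psi_w(G_{n-k}))$. $\mathcal T_n$ denotes the set of spanning trees of $G_n$; $\mathcal S_n^i$ the set of spanning forests of $G_n$ with two components, one containing $u_i$ and the other containing $\{u_1,u_2,u_3\}\setminus\{u_i\}$; $\mathcal R_n$ the set of spanning forests with three components each containing exactly one of $u_1,u_2,u_3$; $\mathcal Q_n=\mathcal T_n\cup\mathcal S_n^1\cup\mathcal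 S_n^2\cup\mathcal S_n^3\cup\mathcal R_n$. For $g\in\mathcal Q_1$, $\mathrm{Tr}\,g$ is the spanning subgraph of $G_0$ equal to: the two edges at $u_i$ if $g$ is a spanning tree of $G_1$ in which for both $j\neq i$ the path from $u_i$ to $u_j$ lies in $\psi_i(G_0)\cup\psi_j(G_0)$ (every spanning tree of $G_1$ satisfies this for exactly one $i$); the single edge not containing $u_i$ if $g\in\mathcal S_1^i$; the edgeless graph if $g\in\mathcal R_1$. For $f\in\mathcal Q_{n+1}$, $\mathrm{Tr}\,f=\bigcup_{w\in\{1,2,3\}^n}\psi_w(\mathrm{Tr}\,\pi_w(f))$; Tr maps spanning trees of $G_{n+1}$ to spanning trees of $G_n$. A consistent sequence of uniform spanning trees is a sequence $(T_n)_{n\ge0}$ of random spanning trees defined on a common probability space such that $T_n$ is uniformly distributed on $\mathcal T_n$ and $\mathrm{Tr}\,T_{n+1}=T_n$ for all $n$. For a tree $t$ and vertices $x,y$, $xty$ denotes the unique self-avoiding walk in $t$ from $x$ to $y$. For a walk $x=(x_0,\dots,x_r)$, $\mathrm{LI}(x):[0,\infty]\to K$ is the linear interpolation $\mathrm{LI}(x)(t)=(k+1-t)x_k+(t-k)x_{k+1}$ for $k\le t<k+1$, $k<r$, and $\mathrm{LI}(x)(t)=x_r$ for $t\ge r$. It is known that $X_n$ converges almost surely uniformly to a continuous curve $X$ with $X(0)=u_1$. $\|\cdot\|_2$ is the Euclidean norm (note $u_1$ is the origin). *)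

theory Defs
  imports "HOL-Probability.Probability"
begin

section \<open>Sierpinski gasket graphs (points of R^2 encoded as complex numbers)\<close>

definition sg_u :: "nat \<Rightarrow> complex" where
  "sg_u i = (if i = 2 then 1 else if i = 3 then Complex (1/2) (sqrt 3 / 2) else 0)"

definition sg_psi :: "nat \<Rightarrow> complex \<Rightarrow> complex" where
  "sg_psi i x = (x - sg_u i) / 2 + sg_u i"

definition sg_idx :: "nat set" where "sg_idx = {1,2,3}"

fun sg_V :: "nat \<Rightarrow> complex set" where
  "sg_V 0 = {sg_u 1, sg_u 2, sg_u 3}"
| "sg_V (Suc n) = (\<Union>i\<in>sg_idx. sg_psi i ` sg_V n)"

fun sg_E :: "nat \<Rightarrow> complex set set" where
  "sg_E 0 = {{sg_u 1, sg_u 2}, {sg_u 2, sg_u 3}, {sg_u 3, sg_u 1}}"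
| "sg_E (Suc n) = (\<Union>i\<in>sg_idx. (\<lambda>e. sg_psi i ` e) ` sg_E n)"

definition sg_words :: "nat \<Rightarrow> nat list set" where
  "sg_words k = {w. length w = k \<and> set w \<subseteq> sg_idx}"

definition sg_psiw :: "nat list \<Rightarrow> complex \<Rightarrow> complex" where
  "sg_psiw w = foldr (\<lambda>i f. sg_psi i \<circ> f) w id"

definition adj :: "complex set set \<Rightarrow> (complex \<times> complex) set" where
  "adj F = {(a, b). {a, b} \<in> F}"

definition conn :: "complex set set \<Rightarrow> complex \<Rightarrow> complex \<Rightarrow> bool" where
  "conn F x y \<longleftrightarrow> (x, y) \<in> (adj F)\<^sup>*"

definition is_cycle :: "complex set set \<Rightarrow> complex list \<Rightarrow> bool" where
  "is_cycle F cs \<longleftrightarrow> length cs \<ge> 3 \<and> distinct cs \<and>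
     (\<forall>i < length cs. {cs ! i, cs ! ((i + 1) mod length cs)} \<in> F)"

definition acyclic_g :: "complex set set \<Rightarrow> bool" where
  "acyclic_g F \<longleftrightarrow> \<not> (\<exists>cs. is_cycle F cs)"

definition saw :: "complex set set \<Rightarrow> complex \<Rightarrow> complex \<Rightarrow> complex list \<Rightarrow> bool" where
  "saw F x y xs \<longleftrightarrow> xs \<noteq> [] \<and> hd xs = x \<and> last xs = y \<and> distinct xs \<and>
     (\<forall>k. Suc k < length xs \<longrightarrow> {xs ! k, xs ! Suc k} \<in> F)"

definition tpath :: "complex set set \<Rightarrow> complex \<Rightarrow> complex \<Rightarrow> complex list" where
  "tpath F x y = (THE xs. saw F x y xs)"

definition walk_edges :: "complex list \<Rightarrow> complex set set" where
  "walk_edges xs = {{xs ! k, xs ! Suc k} | k. Suc k < length xs}"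

definition STrees :: "nat \<Rightarrow> complex set set set" where
  "STrees n = {F. F \<subseteq> sg_E n \<and> acyclic_g F \<and> (\<forall>x\<in>sg_V n. \<forall>y\<in>sg_V n. conn F x y)}"

definition SForests :: "nat \<Rightarrow> nat \<Rightarrow> complex set set set" where
  "SForests n i = {F. F \<subseteq> sg_E n \<and> acyclic_g F \<and>
     (\<forall>x\<in>sg_V n. \<exists>j\<in>sg_idx. conn F x (sg_u j)) \<and>
     (\<forall>j\<in>sg_idx - {i}. \<not> conn F (sg_u i) (sg_u j)) \<and>
     (\<forall>j\<in>sg_idx - {i}. \<forall>k\<in>sg_idx - {i}. conn F (sg_u j) (sg_u k))}"

definition RForests :: "nat \<Rightarrow> complex set set set" where
  "RForests n = {F. F \<subseteq> sg_E n \<and> acyclic_g F \<and>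
     (\<forall>x\<in>sg_V n. \<exists>j\<in>sg_idx. conn F x (sg_u j)) \<and>
     (\<forall>j\<in>sg_idx. \<forall>k\<in>sg_idx. j \<noteq> k \<longrightarrow> \<not> conn F (sg_u j) (sg_u k))}"

definition tree_cond :: "complex set set \<Rightarrow> nat \<Rightarrow> bool" where
  "tree_cond g i \<longleftrightarrow> (\<forall>j\<in>sg_idx - {i}.
     walk_edges (tpath g (sg_u i) (sg_u j)) \<subseteq>
       (\<lambda>e. sg_psi i ` e) ` sg_E 0 \<union> (\<lambda>e. sg_psi j ` e) ` sg_E 0)"

definition Tr1 :: "complex set set \<Rightarrow> complex set set" where
  "Tr1 g = (if g \<in> STrees 1 then {e \<in> sg_E 0. \<exists>i\<in>sg_idx. tree_cond g i \<and> sg_u i \<in> e}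
            else if (\<exists>i\<in>sg_idx. g \<in> SForests 1 i)
              then {e \<in> sg_E 0. \<exists>i\<in>sg_idx. g \<in> SForests 1 i \<and> sg_u i \<notin> e}
            else {})"

definition sg_pi :: "nat list \<Rightarrow> complex set set \<Rightarrow> complex set set" where
  "sg_pi w H = {e \<in> sg_E 1. sg_psiw w ` e \<in> H}"

definition Tr :: "nat \<Rightarrow> complex set set \<Rightarrow> complex set set" where
  "Tr n f = (\<Union>w\<in>sg_words n. (\<lambda>e. sg_psiw w ` e) ` Tr1 (sg_pi w f))"

definition consistent_UST :: "'a measure \<Rightarrow> (nat \<Rightarrow> 'a \<Rightarrow> complex set set) \<Rightarrow> bool" where
  "consistent_UST M T \<longleftrightarrow> (\<forall>n.
     (\<forall>\<omega>\<in>space M. T n \<omega> \<in> STrees n) \<and>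
     (\<forall>t\<in>STrees n. {\<omega>\<in>space M. T n \<omega> = t} \<in> sets M \<and>
                    measure M {\<omega>\<in>space M. T n \<omega> = t} = 1 / real (card (STrees n))) \<and>
     (\<forall>\<omega>\<in>space M. Tr n (T (Suc n) \<omega>) = T n \<omega>))"

definition LI :: "complex list \<Rightarrow> real \<Rightarrow> complex" where
  "LI xs t = (if t \<ge> real (length xs - 1) then last xs
              else (let k = nat \<lfloor>t\<rfloor> in
                    of_real (real k + 1 - t) * xs ! k + of_real (t - real k) * xs ! Suc k))"

definition abar :: real where "abar = 4/3 + sqrt 205 / 15"
definition gamma_l :: real where "gamma_l = ln 2 / ln abar"
definition gamma_r :: real where "gamma_r = ln 3 / ln abar"

definition Xn :: "(nat \<Rightarrow> 'a \<Rightarrow> complex set set) \<Rightarrow> nat \<Rightarrow> 'a \<Rightarrow> real \<Rightarrow> complex" where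
  "Xn T n \<omega> t = LI (tpath (T n \<omega>) (sg_u 1) (sg_u 2)) (abar ^ n * t)"

end

theory Submission
  imports Defs "HOL-Real_Asymp.Real_Asymp"
begin

text \<open>Only the uniform law of each single tree \<open>T n\<close> matters. Cutting \<open>G\<^sub>n\<^sub>+\<^sub>1\<close> into its three cells
  decomposes spanning forests into triples of spanning forests of \<open>G\<^sub>n\<close>, and because
  \<open>TR = 3 S\<^sup>2\<close> for the numbers of trees, two- and three-component forests, the conditional law of
  the triple of types does not depend on \<open>n\<close>. Hence the tree walk from \<open>u\<^sub>1\<close> to \<open>u\<^sub>2\<close> is a
  two-type branching process, in which a crossing of a cell splits into two or three crossings of smaller
  cells and whose mean matrix has largest eigenvalue \<open>abar\<close>. Moment generating functions
  satisfy \<open>\<phi>(abar y) \<le> \<phi>(y)\<^sup>2\<close> for \<open>y \<le> 0\<close> and \<open>\<phi>(abar y) \<le> \<phi>(y)\<^sup>3\<close> for \<open>y \<ge> 0\<close>, so that the rescaled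
  crossing times have tails \<open>exp (- c 2\<^sup>m)\<close> below \<open>(2 / abar)\<^sup>m\<close> and \<open>exp (- c 3\<^sup>m)\<close> above
  \<open>C (3 / abar)\<^sup>m\<close>. A displacement of order \<open>2\<^sup>-\<^sup>k\<close> within a short time after \<open>s\<close> forces the level-\<open>k\<close>
  crossing that follows the one in progress at time \<open>s\<close>, independent of the past, to be fast;
  being within distance \<open>2\<^sup>-\<^sup>k\<close> of \<open>u\<^sub>1\<close> at time \<open>t\<close> forces the first crossing to be slow. Bounds
  for the walks pass to the limit by dominated convergence and Borel--Cantelli.\<close>

section \<open>Connectivity, bridges and self-avoiding walks\<close>

text \<open>Two cells of the gasket share exactly one point. Hence connections in a glued graph
  depend on the three pieces only through the partitions they induce on the corners, and the
  question which triples of pieces form a forest of a given type concerns only 125 triples and is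
  settled by evaluation. Conditional expectations never occur: nested finite averages over walks
  replace them. The obstacle in the upper bounds is that \<open>s\<close> is arbitrary: the crossing
  in progress at time \<open>s\<close> has a biased law, and a union bound over all cells would be
  too lossy, so the next crossing has to be used. For returns to the starting corner,
  \<open>1 - bary 1\<close> replaces the norm, because the first map halves it exactly and its
  superlevel sets are convex. The log-log exponents come from times of order abar^(-j) with 2^m or
  3^m of order log j: the time factor (abar/2)^m is the space factor 2^(m (1 - gamma_l)), and
  (3/abar)^m is 3^(m gamma_l (1 - 1/gamma_r)).\<close>

lemma saw_iff:
  "saw F x y xs \<longleftrightarrow> xs \<noteq> [] \<and> hd xs = x \<and> last xs = y \<and> distinct xs \<and>
     successively (\<lambda>a b. {a, b} \<in> F) xs"
  by (auto simp: saw_def successively_conv_nth)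

lemma conn_refl [simp, intro]: "conn F x x"
  by (simp add: conn_def)

lemma conn_trans [trans]: "conn F x y \<Longrightarrow> conn F y z \<Longrightarrow> conn F x z"
  by (auto simp: conn_def)

lemma conn_edge: "{x, y} \<in> F \<Longrightarrow> conn F x y"
  by (auto simp: conn_def adj_def)

lemma conn_sym: "conn F x y \<Longrightarrow> conn F y x"
proof -
  have "sym (adj F)"
    by (auto simp: sym_def adj_def insert_commute)
  then show "conn F x y \<Longrightarrow> conn F y x"
    unfolding conn_def by (metis sym_rtrancl symE)
qed

lemma conn_mono: "conn F x y \<Longrightarrow> F \<subseteq> G \<Longrightarrow> conn G x y"
  unfolding conn_def using rtrancl_mono[of "adj F" "adj G"] by (auto simp: adj_def)

lemma conn_induct [consumes 1, case_names base step]: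
  assumes "conn F x y" "P x"
    and "\<And>y z. conn F x y \<Longrightarrow> P y \<Longrightarrow> {y, z} \<in> F \<Longrightarrow> P z"
  shows "P y"
  using assms(1) unfolding conn_def
proof (induction rule: rtrancl_induct)
  case base
  then show ?case using assms(2) by simp
next
  case (step y z)
  then show ?case using assms(3)[of y z] by (auto simp: conn_def adj_def)
qed

lemma saw_prefix:
  assumes "saw F x y (as @ z # bs)"
  shows "saw F x z (as @ [z])"
proof -
  have "successively (\<lambda>a b. {a, b} \<in> F) ((as @ [z]) @ bs)" using assms by (simp add: saw_iff)
  then have "successively (\<lambda>a b. {a, b} \<in> F) (as @ [z])" by (simp only: successively_append_iff)
  then show ?thesis using assms by (cases as) (auto simp: saw_iff)
qed

text \<open>Loop erasure: when the next vertex already lies on the walk, the walk is cut back to its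
  visit there.\<close>

lemma conn_imp_saw:
  assumes "conn F x y"
  obtains xs where "saw F x y xs"
proof -
  have "\<exists>xs. saw F x y xs"
    using assms
  proof (induction rule: conn_induct)
    case base
    have "saw F x x [x]" by (simp add: saw_iff)
    then show ?case by blast
  next
    case (step y z)
    then obtain xs where xs: "saw F x y xs" by blast
    show ?case
    proof (cases "z \<in> set xs")
      case True
      then obtain as bs where eq: "xs = as @ z # bs" by (meson split_list)
      show ?thesis using saw_prefix xs unfolding eq by blast
    next
      case False
      have "saw F x z (xs @ [z])"
        using xs False step.hyps(2) unfolding saw_iff
        by (auto simp: successively_append_iff hd_append)
      then show ?thesis by blast
    qed
  qed
  then show ?thesis using that by blast
qed

lemma successively_conn:
  "successively (\<lambda>a b. {a, b} \<in> F) xs \<Longrightarrow> xs \<noteq> [] \<Longrightarrow> conn F (hd xs) (last xs)"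
proof (induction xs)
  case (Cons a xs)
  show ?case
  proof (cases xs)
    case (Cons b ys)
    then show ?thesis
      using Cons.prems Cons.IH conn_trans[OF conn_edge[of a b F]] by auto
  qed simp
qed simp

lemma saw_conn: "saw F x y xs \<Longrightarrow> conn F x y"
  using successively_conn by (fastforce simp: saw_iff)

text \<open>A walk that misses \<open>z\<close> uses no edge at \<open>z\<close>, so it survives the
  removal of one. This keeps a detour clear of the edge tested in
  \<open>acyclic_g_iff\<close>.\<close>

lemma saw_avoid_conn:
  assumes "saw F x y xs" "z \<notin> set xs"
  shows "conn (F - {{z, w}}) x y"
proof -
  have "successively (\<lambda>a b. {a, b} \<in> F - {{z, w}}) xs"
    unfolding successively_conv_nth
  proof (intro allI impI)
    fix i assume i: "Suc i < length xs"
    then have "xs ! i \<noteq> z" "xs ! Suc i \<noteq> z" using assms(2) nth_mem[of i xs] nth_mem[of "Suc i" xs] by auto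
    then show "{xs ! i, xs ! Suc i} \<in> F - {{z, w}}"
      using assms(1) i by (auto simp: saw_def doubleton_eq_iff)
  qed
  then show ?thesis
    using assms successively_conn by (fastforce simp: saw_iff)
qed

text \<open>Every edge is a bridge. Cyclic lists behave badly under gluing, whereas this form speaks
  only of \<open>conn\<close> after the removal of one edge. The condition
  \<open>a \<noteq> b\<close> is there because a cycle of length at least 3 contains no
  loop.\<close>

lemma acyclic_g_iff:
  "acyclic_g F \<longleftrightarrow> (\<forall>a b. a \<noteq> b \<longrightarrow> {a, b} \<in> F \<longrightarrow> \<not> conn (F - {{a, b}}) a b)"
proof (intro iffI allI impI notI)
  fix a b assume ac: "acyclic_g F" and ab: "a \<noteq> b" "{a, b} \<in> F" and c: "conn (F - {{a, b}}) a b"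
  obtain xs where xs: "saw (F - {{a, b}}) a b xs" using conn_imp_saw[OF c] .
  have len: "length xs \<ge> 3"
  proof (rule ccontr)
    assume "\<not> length xs \<ge> 3"
    then have "length xs = 0 \<or> length xs = 1 \<or> length xs = 2" by linarith
    then have "xs = [] \<or> (\<exists>u. xs = [u]) \<or> (\<exists>u v. xs = [u, v])"
      by (auto simp: length_Suc_conv numeral_2_eq_2)
    then show False
      using xs ab by (auto simp: saw_iff)
  qed
  have "is_cycle F xs"
    unfolding is_cycle_def
  proof (intro conjI allI impI)
    fix i assume i: "i < length xs"
    show "{xs ! i, xs ! ((i + 1) mod length xs)} \<in> F"
    proof (cases "Suc i < length xs")
      case True
      then show ?thesis using xs by (auto simp: saw_def)
    next
      case False
      then have "i = length xs - 1" using i by simp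
      moreover have "xs ! (length xs - 1) = b" "xs ! 0 = a"
        using xs by (auto simp: saw_iff hd_conv_nth last_conv_nth)
      moreover have "length xs - 1 + 1 = length xs" using len by simp
      ultimately show ?thesis using ab by (simp add: insert_commute)
    qed
  qed (use len xs in \<open>auto simp: saw_iff\<close>)
  then show False using ac by (auto simp: acyclic_g_def)
next
  assume br: "\<forall>a b. a \<noteq> b \<longrightarrow> {a, b} \<in> F \<longrightarrow> \<not> conn (F - {{a, b}}) a b"
  show "acyclic_g F"
    unfolding acyclic_g_def
  proof (rule notI, elim exE)
    fix cs assume cs: "is_cycle F cs"
    define l where "l = length cs"
    have l: "l \<ge> 3" and d: "distinct cs"
      and e: "\<And>i. i < l \<Longrightarrow> {cs ! i, cs ! ((i + 1) mod l)} \<in> F"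
      using cs by (auto simp: is_cycle_def l_def)
    define a b where "a = cs ! 0" and "b = cs ! (l - 1)"
    have ab: "a \<noteq> b"
    proof -
      have "0 < length cs" "l - 1 < length cs" "0 \<noteq> l - 1" using l by (auto simp: l_def)
      then show ?thesis unfolding a_def b_def using nth_eq_iff_index_eq[OF d] by blast
    qed
    have ne: "cs \<noteq> []" using l by (auto simp: l_def)
    have abF: "{a, b} \<in> F"
      using e[of "l - 1"] l by (simp add: a_def b_def insert_commute)
    have "successively (\<lambda>a' b'. {a', b'} \<in> F - {{a, b}}) cs"
      unfolding successively_conv_nth
    proof (intro allI impI)
      fix i assume i: "Suc i < length cs"
      have "{cs ! i, cs ! Suc i} \<in> F" using e[of i] i by (simp add: l_def)
      moreover have "{cs ! i, cs ! Suc i} \<noteq> {a, b}"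
      proof
        assume "{cs ! i, cs ! Suc i} = {a, b}"
        then have "(cs ! i = a \<and> cs ! Suc i = b) \<or> (cs ! i = b \<and> cs ! Suc i = a)"
          by (simp add: doubleton_eq_iff)
        moreover have "cs ! i = a \<longleftrightarrow> i = 0" "cs ! Suc i = b \<longleftrightarrow> Suc i = l - 1" "cs ! Suc i \<noteq> a"
          using nth_eq_iff_index_eq[OF d, of i 0] nth_eq_iff_index_eq[OF d, of "Suc i" 0]
            nth_eq_iff_index_eq[OF d, of "Suc i" "l - 1"] i l ne unfolding a_def b_def l_def by auto
        ultimately show False using l by auto
      qed
      ultimately show "{cs ! i, cs ! Suc i} \<in> F - {{a, b}}" by simp
    qed
    with ne have "conn (F - {{a, b}}) a b"
      using successively_conn by (fastforce simp: a_def b_def l_def hd_conv_nth last_conv_nth)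
    then show False using br ab abF by blast
  qed
qed

text \<open>If the second vertices \<open>b\<close> and \<open>c\<close> differed, then without the
  edge \<open>{x, b}\<close> one could still go from \<open>x\<close> to \<open>c\<close>, on to
  \<open>y\<close> along the second walk and back to \<open>b\<close> along the first, although this
  edge is a bridge.\<close>

lemma saw_unique:
  assumes ac: "acyclic_g F"
  shows "saw F x y xs \<Longrightarrow> saw F x y ys \<Longrightarrow> xs = ys"
proof (induction xs arbitrary: x ys)
  case Nil
  then show ?case by (simp add: saw_iff)
next
  case (Cons a xs)
  then have [simp]: "a = x" by (simp add: saw_iff)
  obtain ys' where ys: "ys = x # ys'"
    using Cons.prems(2) by (cases ys) (auto simp: saw_iff)
  show ?case
  proof (cases "xs = []")
    case True
    then have "y = x" using Cons.prems(1) by (simp add: saw_iff)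
    then have "ys' = []" using Cons.prems(2) unfolding ys saw_iff
      by (metis distinct.simps(2) last.simps last_in_set)
    then show ?thesis using True ys by simp
  next
    case False
    then obtain b xs' where xs: "xs = b # xs'" by (cases xs) auto
    have sb: "saw F b y xs" and xb: "{x, b} \<in> F" and xn: "x \<notin> set xs"
      using Cons.prems(1) unfolding xs by (auto simp: saw_iff)
    have "ys' \<noteq> []" using Cons.prems xn False unfolding ys saw_iff
      by (metis last.simps last_in_set)
    then obtain c ys'' where ys': "ys' = c # ys''" by (cases ys') auto
    have sc: "saw F c y ys'" and xc: "{x, c} \<in> F" and yn: "x \<notin> set ys'"
      using Cons.prems(2) unfolding ys ys' by (auto simp: saw_iff)
    have "b = c"
    proof (rule ccontr)
      assume bc: "b \<noteq> c"
      have "conn (F - {{x, b}}) x c"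
        using xc bc by (intro conn_edge) (auto simp: doubleton_eq_iff)
      also have "conn (F - {{x, b}}) c y" by (rule saw_avoid_conn[OF sc yn])
      also have "conn (F - {{x, b}}) y b" by (rule conn_sym[OF saw_avoid_conn[OF sb xn]])
      finally show False using ac xb xn xs unfolding acyclic_g_iff by fastforce
    qed
    then show ?thesis using Cons.IH[OF sb] sc ys by simp
  qed
qed

lemma tpath_eq: "acyclic_g F \<Longrightarrow> saw F x y xs \<Longrightarrow> tpath F x y = xs"
  unfolding tpath_def by (rule the_equality) (auto intro: saw_unique)

lemma saw_tpath:
  assumes "acyclic_g F" "conn F x y"
  shows "saw F x y (tpath F x y)"
  using conn_imp_saw[OF assms(2)] tpath_eq[OF assms(1)] by metis

section \<open>Barycentric coordinates\<close>

lemma finite_sg_idx [simp]: "finite sg_idx"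
  by (simp add: sg_idx_def)

text \<open>Coordinates in which \<open>sg_psi a\<close> halves everything and adds 1/2 to the
  coordinate \<open>a\<close>, so that the intersections of cells can be read off. As in
  \<open>sg_u\<close>, an index other than 2 and 3 stands for the first corner.\<close>

definition bary :: "nat \<Rightarrow> complex \<Rightarrow> real" where
  "bary i z = (if i = 2 then Re z - Im z / sqrt 3 else if i = 3 then 2 * Im z / sqrt 3
     else 1 - Re z - Im z / sqrt 3)"

definition sg_tri :: "complex set" where
  "sg_tri = {z. \<forall>i\<in>sg_idx. 0 \<le> bary i z}"

lemma bary_psi:
  "i \<in> sg_idx \<Longrightarrow> a \<in> sg_idx \<Longrightarrow> bary i (sg_psi a z) = bary i z / 2 + (if i = a then 1/2 else 0)"
  by (auto simp: sg_idx_def bary_def sg_psi_def sg_u_def field_simps)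

lemma bary_u: "i \<in> sg_idx \<Longrightarrow> j \<in> sg_idx \<Longrightarrow> bary i (sg_u j) = (if i = j then 1 else 0)"
  by (auto simp: sg_idx_def bary_def sg_u_def field_simps)

lemma bary_sum: "bary 1 z + bary 2 z + bary 3 z = 1"
  by (simp add: bary_def)

lemma bary_eqI:
  assumes "\<And>i. i \<in> sg_idx \<Longrightarrow> bary i z = bary i w"
  shows "z = w"
proof (rule complex_eqI)
  have "bary 3 z = bary 3 w" "bary 2 z = bary 2 w" using assms by (auto simp: sg_idx_def)
  then show "Im z = Im w" "Re z = Re w" by (auto simp: bary_def)
qed

lemma sg_u_eq_iff: "i \<in> sg_idx \<Longrightarrow> j \<in> sg_idx \<Longrightarrow> sg_u i = sg_u j \<longleftrightarrow> i = j"
  using bary_u[of i i] bary_u[of i j] by (auto split: if_splits)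

lemma sg_psi_u: "sg_psi i (sg_u i) = sg_u i"
  by (simp add: sg_psi_def)

lemma sg_psi_u_commute: "sg_psi i (sg_u j) = sg_psi j (sg_u i)"
  by (simp add: sg_psi_def field_simps)

lemma inj_sg_psi: "inj (sg_psi i)"
  by (rule injI) (simp add: sg_psi_def)

lemma sg_psi_eq_iff [simp]: "sg_psi i x = sg_psi i y \<longleftrightarrow> x = y"
  using inj_sg_psi by (metis injD)

lemma sg_u_tri: "i \<in> sg_idx \<Longrightarrow> sg_u i \<in> sg_tri"
  by (simp add: sg_tri_def bary_u)

lemma sg_psi_tri: "a \<in> sg_idx \<Longrightarrow> x \<in> sg_tri \<Longrightarrow> sg_psi a x \<in> sg_tri"
  by (simp add: sg_tri_def bary_psi)

text \<open>The other two coordinates are nonnegative and all three sum to 1, so they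
  vanish.\<close>

lemma sg_tri_corner:
  assumes "x \<in> sg_tri" "a \<in> sg_idx" "bary a x \<ge> 1"
  shows "x = sg_u a"
proof (rule bary_eqI)
  fix i assume "i \<in> sg_idx"
  then show "bary i x = bary i (sg_u a)"
    using assms bary_sum[of x] by (auto simp: sg_tri_def bary_u sg_idx_def)
qed

text \<open>Coordinate \<open>a\<close> is at least 1/2 on cell \<open>a\<close>, and likewise for
  \<open>b\<close>; a common point therefore has both equal to 1/2 and is the midpoint of
  \<open>sg_u a\<close> and \<open>sg_u b\<close>. The gluing arguments rest on this geometric
  fact.\<close>

lemma sg_psi_meet:
  assumes "x \<in> sg_tri" "y \<in> sg_tri" "a \<in> sg_idx" "b \<in> sg_idx" "a \<noteq> b" "sg_psi a x = sg_psi b y"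
  shows "x = sg_u b" "y = sg_u a"
proof -
  have "bary a x / 2 + 1/2 = bary a y / 2" "bary b x / 2 = bary b y / 2 + 1/2"
    using assms bary_psi[of a a x] bary_psi[of a b y] bary_psi[of b a x] bary_psi[of b b y] by auto
  moreover have "bary a x \<ge> 0" "bary b y \<ge> 0" using assms by (auto simp: sg_tri_def)
  ultimately show "x = sg_u b" "y = sg_u a"
    using assms by (auto intro!: sg_tri_corner)
qed

lemma sg_V_tri: "sg_V n \<subseteq> sg_tri"
  by (induction n) (auto simp: sg_u_tri sg_idx_def sg_psi_tri)

lemma sg_u_V: "i \<in> sg_idx \<Longrightarrow> sg_u i \<in> sg_V n"
proof (induction n)
  case 0
  then show ?case by (auto simp: sg_idx_def)
next
  case (Suc n)
  then have "sg_psi i (sg_u i) \<in> sg_V (Suc n)" by auto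
  then show ?case by (simp add: sg_psi_u)
qed

lemma sg_E_edge:
  "e \<in> sg_E n \<Longrightarrow> \<exists>x y. e = {x, y} \<and> x \<noteq> y \<and> x \<in> sg_V n \<and> y \<in> sg_V n"
proof (induction n arbitrary: e)
  case 0
  then show ?case
    using sg_u_eq_iff[of 1 2] sg_u_eq_iff[of 2 3] sg_u_eq_iff[of 3 1]
    by (simp add: sg_idx_def) blast
next
  case (Suc n)
  then obtain i e' where i: "i \<in> sg_idx" "e' \<in> sg_E n" "e = sg_psi i ` e'" by auto
  obtain x y where "e' = {x, y}" "x \<noteq> y" "x \<in> sg_V n" "y \<in> sg_V n" using Suc.IH[OF i(2)] by blast
  then have "e = {sg_psi i x, sg_psi i y}" "sg_psi i x \<noteq> sg_psi i y"
    "sg_psi i x \<in> sg_V (Suc n)" "sg_psi i y \<in> sg_V (Suc n)" using i by auto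
  then show ?case by blast
qed

lemma finite_sg_E: "finite (sg_E n)"
  by (induction n) (auto simp: sg_idx_def)

lemma sg_E_verts: "{x, y} \<in> sg_E n \<Longrightarrow> x \<in> sg_V n \<and> y \<in> sg_V n \<and> x \<noteq> y"
  using sg_E_edge[of "{x, y}" n] by (auto simp: doubleton_eq_iff)

lemma conn_V: "conn F x y \<Longrightarrow> F \<subseteq> sg_E n \<Longrightarrow> x \<in> sg_V n \<Longrightarrow> y \<in> sg_V n"
  by (induction rule: conn_induct) (auto dest: sg_E_verts)

lemma saw_V:
  assumes "saw F x y xs" "F \<subseteq> sg_E n" "x \<in> sg_V n"
  shows "set xs \<subseteq> sg_V n"
proof
  fix z assume "z \<in> set xs"
  then obtain as bs where eq: "xs = as @ z # bs" by (meson split_list)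
  have "conn F x z" using saw_conn[OF saw_prefix] assms(1) unfolding eq .
  then show "z \<in> sg_V n" by (rule conn_V[OF _ assms(2,3)])
qed

section \<open>Gluing subgraphs of the three cells\<close>

definition cell_im :: "nat \<Rightarrow> complex set set \<Rightarrow> complex set set" where
  "cell_im a F = (\<lambda>e. sg_psi a ` e) ` F"

text \<open>\<open>Hs a\<close> is the piece in cell \<open>a\<close>, described in the coordinates
  of the whole triangle. No vertices have to be identified: the shared corners coincide as points of
  the plane.\<close>

definition glue :: "(nat \<Rightarrow> complex set set) \<Rightarrow> complex set set" where
  "glue Hs = (\<Union>a\<in>sg_idx. cell_im a (Hs a))"

lemma sg_E_Suc: "sg_E (Suc n) = glue (\<lambda>a. sg_E n)"
  by (simp add: glue_def cell_im_def)

lemma cell_im_edge_iff [simp]: "{sg_psi a x, sg_psi a y} \<in> cell_im a F \<longleftrightarrow> {x, y} \<in> F"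
proof -
  have "inj (\<lambda>e. sg_psi a ` e)"
    by (rule injI) (simp add: inj_image_eq_iff[OF inj_sg_psi])
  from inj_image_mem_iff[OF this, of "{x, y}" F] show ?thesis by (simp add: cell_im_def)
qed

lemma cell_im_edgeE:
  assumes "{z, z'} \<in> cell_im a F"
  obtains y y' where "z = sg_psi a y" "z' = sg_psi a y'" "{y, y'} \<in> F"
proof -
  have "{z, z'} \<in> (\<lambda>e. sg_psi a ` e) ` F" using assms by (simp add: cell_im_def)
  then obtain e where e: "e \<in> F" "{z, z'} = sg_psi a ` e" by (rule imageE) simp
  then have "z \<in> sg_psi a ` e" "z' \<in> sg_psi a ` e" by (metis insertI1, metis insertI1 insert_commute)
  then obtain y y' where "z = sg_psi a y" "z' = sg_psi a y'" by auto
  then show ?thesis using that assms by simp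
qed

lemma glue_edgeE:
  assumes "{z, z'} \<in> glue Hs"
  obtains a y y' where "a \<in> sg_idx" "z = sg_psi a y" "z' = sg_psi a y'" "{y, y'} \<in> Hs a"
  using assms cell_im_edgeE by (auto simp: glue_def) blast

lemma conn_cell_im: "conn F x y \<Longrightarrow> conn (cell_im a F) (sg_psi a x) (sg_psi a y)"
proof (induction rule: conn_induct)
  case (step y z)
  show ?case by (rule conn_trans[OF step.IH conn_edge]) (simp add: step)
qed simp

lemma conn_glue: "a \<in> sg_idx \<Longrightarrow> conn (Hs a) x y \<Longrightarrow> conn (glue Hs) (sg_psi a x) (sg_psi a y)"
  by (rule conn_mono[OF conn_cell_im]) (auto simp: glue_def)

text \<open>The corner \<open>sg_psi a (sg_u b)\<close> of the cell \<open>a\<close> is addressed by the pair \<open>(a, b)\<close>, so that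
  \<open>(a, b)\<close> and \<open>(b, a)\<close> denote the same point; \<open>P a\<close> is a connection relation inside the cell \<open>a\<close>.\<close>

inductive tconn :: "(nat \<Rightarrow> nat \<Rightarrow> nat \<Rightarrow> bool) \<Rightarrow> nat \<times> nat \<Rightarrow> nat \<times> nat \<Rightarrow> bool"
  for P :: "nat \<Rightarrow> nat \<Rightarrow> nat \<Rightarrow> bool" and x :: "nat \<times> nat" where
  refl: "tconn P x x"
| swap: "tconn P x (a, b) \<Longrightarrow> tconn P x (b, a)"
| step: "tconn P x (a, b) \<Longrightarrow> P a b c \<Longrightarrow> c \<in> sg_idx \<Longrightarrow> tconn P x (a, c)"

definition cellconn :: "(nat \<Rightarrow> complex set set) \<Rightarrow> nat \<Rightarrow> nat \<Rightarrow> nat \<Rightarrow> bool" where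
  "cellconn Hs a b c \<longleftrightarrow> conn (Hs a) (sg_u b) (sg_u c)"

lemma tconn_idx: "tconn P (a, b) z \<Longrightarrow> a \<in> sg_idx \<Longrightarrow> b \<in> sg_idx \<Longrightarrow> fst z \<in> sg_idx \<and> snd z \<in> sg_idx"
  by (induction rule: tconn.induct) auto

lemma tconn_conn:
  assumes "tconn (cellconn Hs) (a, b) z" "a \<in> sg_idx" "b \<in> sg_idx"
  shows "conn (glue Hs) (sg_psi a (sg_u b)) (sg_psi (fst z) (sg_u (snd z)))"
  using assms(1)
proof (induction rule: tconn.induct)
  case (swap c d)
  then show ?case by (simp add: sg_psi_u_commute)
next
  case (step c d e)
  have "c \<in> sg_idx" using tconn_idx[OF step(1)] assms by simp
  then have "conn (glue Hs) (sg_psi c (sg_u d)) (sg_psi c (sg_u e))"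
    using step by (intro conn_glue) (auto simp: cellconn_def)
  with step.IH show ?case by (auto intro: conn_trans)
qed simp

text \<open>Each edge lies in one cell, so a walk changes cells only at a shared corner. What has to
  be remembered of it is a stretch to a corner of the first cell, a chain of corners, and a stretch
  inside the last cell.\<close>

lemma conn_glueD:
  assumes sub: "\<forall>a\<in>sg_idx. Hs a \<subseteq> sg_E n" and a: "a \<in> sg_idx" and y: "y \<in> sg_V n"
    and c: "conn (glue Hs) (sg_psi a y) w"
  shows "(\<exists>v. w = sg_psi a v \<and> conn (Hs a) y v) \<or>
    (\<exists>g\<in>sg_idx. conn (Hs a) y (sg_u g) \<and>
      (\<exists>c\<in>sg_idx. \<exists>d\<in>sg_idx. \<exists>v. w = sg_psi c v \<and> conn (Hs c) (sg_u d) v \<and>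
        tconn (cellconn Hs) (a, g) (c, d)))"
  using c
proof (induction rule: conn_induct)
  case base
  then show ?case by blast
next
  case (step w w')
  obtain b z z' where b: "b \<in> sg_idx" "w = sg_psi b z" "w' = sg_psi b z'" "{z, z'} \<in> Hs b"
    using glue_edgeE[OF step.hyps(2)] .
  have zt: "z \<in> sg_tri" using b sub sg_E_verts sg_V_tri by blast
  from step.IH show ?case
  proof (elim disjE exE bexE conjE)
    fix v assume v: "w = sg_psi a v" "conn (Hs a) y v"
    have vt: "v \<in> sg_tri" using conn_V[OF v(2) bspec[OF sub a] y] sg_V_tri by blast
    show ?thesis
    proof (cases "a = b")
      case True
      then have "conn (Hs a) y z'" using b v conn_trans[OF v(2) conn_edge] by simp
      then show ?thesis using b True by blast
    next
      case False
      \<comment> \<open>The new edge belongs to another cell, so the current vertex is the corner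
        shared with that cell.\<close>
      have "v = sg_u b" "z = sg_u a" using sg_psi_meet[OF vt zt a b(1) False] v b by auto
      then have "conn (Hs a) y (sg_u b)" "conn (Hs b) (sg_u a) z'" "tconn (cellconn Hs) (a, b) (b, a)"
        using v b by (auto intro: conn_edge tconn.intros)
      then show ?thesis using a b by blast
    qed
  next
    fix g c d v assume g: "g \<in> sg_idx" "conn (Hs a) y (sg_u g)" "c \<in> sg_idx" "d \<in> sg_idx"
      "w = sg_psi c v" "conn (Hs c) (sg_u d) v" "tconn (cellconn Hs) (a, g) (c, d)"
    have vt: "v \<in> sg_tri" using conn_V[OF g(6) bspec[OF sub g(3)] sg_u_V[OF g(4)]] sg_V_tri by blast
    show ?thesis
    proof (cases "c = b")
      case True
      then have "conn (Hs c) (sg_u d) z'" using b g conn_trans[OF g(6) conn_edge] by simp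
      then show ?thesis using b g True by blast
    next
      case False
      have "v = sg_u b" "z = sg_u c" using sg_psi_meet[OF vt zt g(3) b(1) False] g b by auto
      then have "conn (Hs b) (sg_u c) z'" "tconn (cellconn Hs) (a, g) (b, c)"
        using g b by (auto intro: conn_edge intro!: tconn.swap[of _ _ c b] tconn.step[OF g(7)] simp: cellconn_def)
      then show ?thesis using g b by blast
    qed
  qed
qed

text \<open>The form needed for the bridge criterion, where both ends of the removed edge lie in one
  cell.\<close>

lemma conn_glue_same_cell:
  assumes sub: "\<forall>a\<in>sg_idx. Hs a \<subseteq> sg_E n" and a: "a \<in> sg_idx"
    and y: "y \<in> sg_V n" "y' \<in> sg_V n"
    and c: "conn (glue Hs) (sg_psi a y) (sg_psi a y')"
  shows "conn (Hs a) y y' \<or> (\<exists>g\<in>sg_idx. \<exists>d\<in>sg_idx. conn (Hs a) y (sg_u g) \<and> conn (Hs a) y' (sg_u d) \<and>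
        tconn (cellconn Hs) (a, g) (a, d))"
  using conn_glueD[OF sub a y(1) c]
proof (elim disjE exE bexE conjE)
  fix g c d v assume g: "g \<in> sg_idx" "conn (Hs a) y (sg_u g)" "c \<in> sg_idx" "d \<in> sg_idx"
      "sg_psi a y' = sg_psi c v" "conn (Hs c) (sg_u d) v" "tconn (cellconn Hs) (a, g) (c, d)"
  show ?thesis
  proof (cases "c = a")
    case True
    then show ?thesis using g conn_sym by auto
  next
    case False
    have "v \<in> sg_tri" "y' \<in> sg_tri"
      using conn_V[OF g(6) bspec[OF sub g(3)] sg_u_V[OF g(4)]] sg_V_tri y by auto
    then have "y' = sg_u c" "v = sg_u a" using sg_psi_meet[of y' v a c] a g False by auto
    moreover from this have "tconn (cellconn Hs) (a, g) (a, c)"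
      using g a by (auto intro!: tconn.swap[of _ _ c a] tconn.step[OF g(7)] simp: cellconn_def)
    ultimately show ?thesis using g by blast
  qed
qed auto

text \<open>Connections between corners see the pieces only through \<open>cellconn\<close>; this is
  what reduces the type of a glued forest to a finite computation.\<close>

lemma conn_glue_corner_iff:
  assumes sub: "\<forall>a\<in>sg_idx. Hs a \<subseteq> sg_E n"
    and i: "a \<in> sg_idx" "b \<in> sg_idx" "c \<in> sg_idx" "d \<in> sg_idx"
  shows "conn (glue Hs) (sg_psi a (sg_u b)) (sg_psi c (sg_u d)) \<longleftrightarrow> tconn (cellconn Hs) (a, b) (c, d)"
proof
  assume "tconn (cellconn Hs) (a, b) (c, d)"
  from tconn_conn[OF this] i show "conn (glue Hs) (sg_psi a (sg_u b)) (sg_psi c (sg_u d))" by simp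
next
  assume "conn (glue Hs) (sg_psi a (sg_u b)) (sg_psi c (sg_u d))"
  from conn_glueD[OF sub i(1) sg_u_V[OF i(2)] this]
  have "\<exists>e\<in>sg_idx. \<exists>f\<in>sg_idx. \<exists>v. sg_psi c (sg_u d) = sg_psi e v \<and> conn (Hs e) (sg_u f) v \<and>
        tconn (cellconn Hs) (a, b) (e, f)"
  proof (elim disjE exE bexE conjE)
    fix v assume "sg_psi c (sg_u d) = sg_psi a v" "conn (Hs a) (sg_u b) v"
    then show ?thesis using i tconn.refl by blast
  next
    fix g e f v assume g: "g \<in> sg_idx" "conn (Hs a) (sg_u b) (sg_u g)" "e \<in> sg_idx" "f \<in> sg_idx"
      "sg_psi c (sg_u d) = sg_psi e v" "conn (Hs e) (sg_u f) v" "tconn (cellconn Hs) (a, g) (e, f)"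
    have "tconn (cellconn Hs) (a, b) (a, g)"
      using g by (auto intro!: tconn.step[OF tconn.refl] simp: cellconn_def)
    moreover have "tconn P x z" if "tconn P y z" "tconn P x y" for P x y z
      using that by (induction rule: tconn.induct) (auto intro: tconn.intros)
    ultimately show ?thesis using g by blast
  qed
  then obtain e f v where e: "e \<in> sg_idx" "f \<in> sg_idx" "sg_psi c (sg_u d) = sg_psi e v"
    "conn (Hs e) (sg_u f) v" "tconn (cellconn Hs) (a, b) (e, f)" by blast
  show "tconn (cellconn Hs) (a, b) (c, d)"
  proof (cases "e = c")
    case True
    then show ?thesis using e i tconn.step[OF e(5)] by (simp add: cellconn_def)
  next
    case False
    have "v \<in> sg_tri" using conn_V[OF e(4) bspec[OF sub e(1)] sg_u_V[OF e(2)]] sg_V_tri by auto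
    then have "d = e" "v = sg_u c"
      using sg_psi_meet[of "sg_u d" v c e] i e False sg_u_tri sg_u_eq_iff by auto
    then show ?thesis
      using e i by (auto intro!: tconn.swap[of _ _ e c] tconn.step[OF e(5)] simp: cellconn_def)
  qed
qed

text \<open>Connections of the corners of the three cells, computed from the connections inside the cells:
  leaving the cell \<open>a\<close> and coming back amounts to walking once around the central hole.\<close>

definition rin :: "(nat \<Rightarrow> nat \<Rightarrow> nat \<Rightarrow> bool) \<Rightarrow> nat \<Rightarrow> nat \<Rightarrow> nat \<Rightarrow> nat \<Rightarrow> nat \<Rightarrow> bool" where
  "rin P a b c g d \<longleftrightarrow> P a g d \<or>
     (P b a c \<and> P c a b \<and> (P a g b \<and> P a c d \<or> P a g c \<and> P a b d))"

text \<open>The target is the point \<open>(b, c)\<close>, the corner of the hole opposite to cell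
  \<open>a\<close>; in \<open>rout\<close> it is the outer corner \<open>(b, b)\<close>, reached
  from \<open>a\<close> either at once or by way of \<open>c\<close>.\<close>

definition rmid :: "(nat \<Rightarrow> nat \<Rightarrow> nat \<Rightarrow> bool) \<Rightarrow> nat \<Rightarrow> nat \<Rightarrow> nat \<Rightarrow> nat \<Rightarrow> bool" where
  "rmid P a b c g \<longleftrightarrow> rin P a b c g b \<and> P b a c \<or> rin P a b c g c \<and> P c a b"

definition rout :: "(nat \<Rightarrow> nat \<Rightarrow> nat \<Rightarrow> bool) \<Rightarrow> nat \<Rightarrow> nat \<Rightarrow> nat \<Rightarrow> nat \<Rightarrow> bool" where
  "rout P a b c g \<longleftrightarrow> rin P a b c g b \<and> P b a b \<or> rin P a b c g c \<and> P c a b \<and> P b c b"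

definition cell_equiv :: "(nat \<Rightarrow> nat \<Rightarrow> nat \<Rightarrow> bool) \<Rightarrow> bool" where
  "cell_equiv P \<longleftrightarrow> (\<forall>a\<in>sg_idx. (\<forall>x\<in>sg_idx. P a x x) \<and> (\<forall>x\<in>sg_idx. \<forall>y\<in>sg_idx. P a x y \<longrightarrow> P a y x) \<and>
     (\<forall>x\<in>sg_idx. \<forall>y\<in>sg_idx. \<forall>z\<in>sg_idx. P a x y \<longrightarrow> P a y z \<longrightarrow> P a x z))"

lemma cell_equiv_cellconn: "cell_equiv (cellconn Hs)"
  unfolding cell_equiv_def cellconn_def using conn_trans conn_sym by blast

text \<open>The reachability table for a start in cell \<open>a\<close>: every shared corner is
  listed under both of its addresses, and the roles of \<open>b\<close> and \<open>c\<close> are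
  exchanged for the last outer corner.\<close>

definition rch :: "(nat \<Rightarrow> nat \<Rightarrow> nat \<Rightarrow> bool) \<Rightarrow> nat \<Rightarrow> nat \<Rightarrow> nat \<Rightarrow> nat \<Rightarrow> nat \<times> nat \<Rightarrow> bool" where
  "rch P a b c g z \<longleftrightarrow>
    (z = (a, a) \<and> rin P a b c g a) \<or>
    (z \<in> {(a, b), (b, a)} \<and> rin P a b c g b) \<or>
    (z \<in> {(a, c), (c, a)} \<and> rin P a b c g c) \<or>
    (z \<in> {(b, c), (c, b)} \<and> rmid P a b c g) \<or>
    (z = (b, b) \<and> rout P a b c g) \<or> (z = (c, c) \<and> rout P a c b g)"

text \<open>The table contains the start and is closed under both rules of \<open>tconn\<close>.
  Transitivity inside the cells merges repeated visits, so that longer chains reach nothing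
  new.\<close>

lemma tconn_imp_rch:
  assumes P: "cell_equiv P" and abc: "sg_idx = {a, b, c}" "a \<noteq> b" "a \<noteq> c" "b \<noteq> c"
    and g: "g \<in> sg_idx" and t: "tconn P (a, g) z"
  shows "rch P a b c g z"
proof -
  have rfl: "P u x x" if "x \<in> {a,b,c}" "u \<in> {a,b,c}" for u x
    using P that unfolding cell_equiv_def abc(1) by blast
  have sy: "P u x y \<Longrightarrow> P u y x" if "x \<in> {a,b,c}" "y \<in> {a,b,c}" "u \<in> {a,b,c}" for u x y
    using P that unfolding cell_equiv_def abc(1) by blast
  have tr: "P u x y \<Longrightarrow> P u y z \<Longrightarrow> P u x z" if "x \<in> {a,b,c}" "y \<in> {a,b,c}" "z \<in> {a,b,c}" "u \<in> {a,b,c}"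
    for u x y z using P that unfolding cell_equiv_def abc(1) by blast
  have ga: "g \<in> {a,b,c}" using g abc by simp
  show ?thesis
    using t
  proof (induction rule: tconn.induct)
    case refl
    have "rin P a b c g g" using ga rfl unfolding rin_def by simp
    then show ?case using ga abc(2-4) unfolding rch_def by blast
  next
    case (swap x y)
    then show ?case unfolding rch_def by auto
  next
    case (step x y z)
    have z: "z \<in> {a,b,c}" using step abc by simp
    have xy: "x \<in> {a,b,c}" "y \<in> {a,b,c}" using step.IH unfolding rch_def by auto
    define R where "R = rin P a b c g"
    have sw: "rin P a c b g d \<longleftrightarrow> R d" for d unfolding R_def rin_def by blast
    have Ra: "R z" if "R y" "P a y z" "y \<in> {a,b,c}" "z \<in> {a,b,c}" for y z
      using that tr[of g y z a] tr[of c y z a] tr[of b y z a] ga unfolding R_def rin_def by blast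
    \<comment> \<open>When both other cells can be traversed, going round the hole reaches the two
      exits of \<open>a\<close> together.\<close>
    have bc: "R b \<longleftrightarrow> R c" if "P b a c" "P c a b"
      using that rfl[of b a] rfl[of c a] unfolding R_def rin_def by blast
    have se: "P u v w \<longleftrightarrow> P u w v" if "u \<in> {a,b,c}" "v \<in> {a,b,c}" "w \<in> {a,b,c}" for u v w
      using sy[OF that(2,3,1)] sy[OF that(3,2,1)] by blast
    have sb: "P b b a \<longleftrightarrow> P b a b" "P b c a \<longleftrightarrow> P b a c" "P b c b \<longleftrightarrow> P b b c"
      and sc: "P c c a \<longleftrightarrow> P c a c" "P c b a \<longleftrightarrow> P c a b" "P c c b \<longleftrightarrow> P c b c"
      by (rule se; simp)+
    have tb: "P b a b \<Longrightarrow> P b b c \<Longrightarrow> P b a c" "P b a c \<Longrightarrow> P b b c \<Longrightarrow> P b a b" "P b a b \<Longrightarrow> P b a c \<Longrightarrow> P b b c"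
      using tr[of a b c b] tr[of a c b b] tr[of b a c b] by (simp_all add: sb)
    have tc: "P c a c \<Longrightarrow> P c b c \<Longrightarrow> P c a b" "P c a b \<Longrightarrow> P c b c \<Longrightarrow> P c a c" "P c a b \<Longrightarrow> P c a c \<Longrightarrow> P c b c"
      using tr[of a c b c] tr[of a b c c] tr[of b a c c] by (simp_all add: sc)
    have ycases: "y = a \<or> y = b \<or> y = c" using xy(2) by blast
    have bc': "P b a c \<longrightarrow> P c a b \<longrightarrow> (R b \<longleftrightarrow> R c)" using bc by blast
    have tb': "P b a b \<longrightarrow> P b b c \<longrightarrow> P b a c" "P b a c \<longrightarrow> P b b c \<longrightarrow> P b a b" "P b a b \<longrightarrow> P b a c \<longrightarrow> P b b c"
      using tb by blast+
    have tc': "P c a c \<longrightarrow> P c b c \<longrightarrow> P c a b" "P c a b \<longrightarrow> P c b c \<longrightarrow> P c a c" "P c a b \<longrightarrow> P c a c \<longrightarrow> P c b c"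
      using tc by blast+
    consider "x = a" | "x = b" | "x = c" using xy by blast
    then show ?case
    proof cases
      case 1
      have "R y" using step.IH xy(2) abc(2-4) 1 unfolding rch_def R_def[symmetric] by auto
      then have "R z" using Ra step.hyps(2) 1 xy z by blast
      then show ?thesis using z 1 unfolding rch_def R_def[symmetric] by blast
    next
      case 2
      have A: "y = a \<Longrightarrow> R b" "y = c \<Longrightarrow> rmid P a b c g" "y = b \<Longrightarrow> rout P a b c g"
        using step.IH abc(2-4) 2 unfolding rch_def sw R_def[symmetric] by auto
      have s: "(z = a \<longrightarrow> P b y a) \<and> (z = b \<longrightarrow> P b y b) \<and> (z = c \<longrightarrow> P b y c)"
        using step.hyps 2 by blast
      have rm: "rmid P a b c g \<longleftrightarrow> R b \<and> P b a c \<or> R c \<and> P c a b"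
        unfolding rmid_def R_def by (rule HOL.refl)
      have ro: "rout P a b c g \<longleftrightarrow> R b \<and> P b a b \<or> R c \<and> P c a b \<and> P b b c"
        unfolding rout_def sw R_def[symmetric] sb sc by (rule HOL.refl)
      have B: "(z = a \<longrightarrow> R b) \<and> (z = c \<longrightarrow> rmid P a b c g) \<and> (z = b \<longrightarrow> rout P a b c g)"
        using ycases
      proof (elim disjE)
        assume y: "y = a"
        show ?thesis using A(1)[OF y] s unfolding y rm ro by blast
      next
        assume y: "y = b"
        show ?thesis using A(3)[OF y] s tb' bc' unfolding y rm ro sb by blast
      next
        assume y: "y = c"
        show ?thesis using A(2)[OF y] s tb' bc' unfolding y rm ro sb by blast
      qed
      then show ?thesis using z 2 unfolding rch_def sw R_def[symmetric] by blast
    next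
      case 3
      have A: "y = a \<Longrightarrow> R c" "y = b \<Longrightarrow> rmid P a b c g" "y = c \<Longrightarrow> rout P a c b g"
        using step.IH abc(2-4) 3 unfolding rch_def sw R_def[symmetric] by auto
      have s: "(z = a \<longrightarrow> P c y a) \<and> (z = b \<longrightarrow> P c y b) \<and> (z = c \<longrightarrow> P c y c)"
        using step.hyps 3 by blast
      have rm: "rmid P a b c g \<longleftrightarrow> R b \<and> P b a c \<or> R c \<and> P c a b"
        unfolding rmid_def R_def by (rule HOL.refl)
      have ro: "rout P a c b g \<longleftrightarrow> R c \<and> P c a c \<or> R b \<and> P b a c \<and> P c b c"
        unfolding rout_def sw R_def[symmetric] sb sc by (rule HOL.refl)
      have B: "(z = a \<longrightarrow> R c) \<and> (z = b \<longrightarrow> rmid P a b c g) \<and> (z = c \<longrightarrow> rout P a c b g)"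
        using ycases
      proof (elim disjE)
        assume y: "y = a"
        show ?thesis using A(1)[OF y] s unfolding y rm ro by blast
      next
        assume y: "y = c"
        show ?thesis using A(3)[OF y] s tc' bc' unfolding y rm ro sc by blast
      next
        assume y: "y = b"
        show ?thesis using A(2)[OF y] s tc' bc' unfolding y rm ro sc by blast
      qed
      then show ?thesis using z 3 unfolding rch_def sw R_def[symmetric] by blast
    qed
  qed
qed

lemma rch_imp_tconn:
  assumes P: "cell_equiv P" and abc: "sg_idx = {a, b, c}"
    and g: "g \<in> sg_idx" and r: "rch P a b c g z"
  shows "tconn P (a, g) z"
proof -
  have i: "a \<in> sg_idx" "b \<in> sg_idx" "c \<in> sg_idx" using abc by auto
  have sy: "P u x y \<Longrightarrow> P u y x" if "x \<in> sg_idx" "y \<in> sg_idx" "u \<in> sg_idx" for u x y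
    using P that unfolding cell_equiv_def by blast
  have st: "tconn P (a, g) (u, y)" if "tconn P (a, g) (u, x)" "P u x y" "y \<in> sg_idx" for u x y
    using that tconn.step by blast
  have sw: "tconn P (a, g) (u, x)" if "tconn P (a, g) (x, u)" for u x
    using that tconn.swap by blast
  have in1: "tconn P (a, g) (a, d)" if "rin P a b c g d" "d \<in> {a, b, c}" for d
  proof -
    have d: "d \<in> sg_idx" using that(2) i by blast
    from that(1) show ?thesis unfolding rin_def
    proof (elim disjE conjE)
      assume "P a g d" then show ?thesis using st[OF tconn.refl] d by blast
    next
      assume h: "P b a c" "P c a b" "P a g b" "P a c d"
      have "tconn P (a, g) (b, a)" using sw st[OF tconn.refl h(3)] i by blast
      then have "tconn P (a, g) (c, b)" using sw st h(1) i by blast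
      then have "tconn P (a, g) (a, c)" using sw st sy[of a b c] h(2) i by blast
      then show ?thesis using st h(4) d by blast
    next
      assume h: "P b a c" "P c a b" "P a g c" "P a b d"
      have "tconn P (a, g) (c, a)" using sw st[OF tconn.refl h(3)] i by blast
      then have "tconn P (a, g) (b, c)" using sw st h(2) i by blast
      then have "tconn P (a, g) (a, b)" using sw st sy[of a c b] h(1) i by blast
      then show ?thesis using st h(4) d by blast
    qed
  qed
  have rsw: "rin P a c b g d \<longleftrightarrow> rin P a b c g d" for d unfolding rin_def by blast
  have mid: "tconn P (a, g) (b, c)" if "rmid P a b c g"
    using that in1 sw st i unfolding rmid_def by blast
  have ob: "tconn P (a, g) (b, b)" if "rout P a b c g"
    using that in1 sw st i unfolding rout_def by blast
  have oc: "tconn P (a, g) (c, c)" if "rout P a c b g"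
    using that in1 sw st i unfolding rout_def rsw by blast
  show ?thesis
    using r in1 mid ob oc sw unfolding rch_def by blast
qed

lemma tconn_iff_rch:
  assumes "cell_equiv P" "sg_idx = {a, b, c}" "a \<noteq> b" "a \<noteq> c" "b \<noteq> c" "g \<in> sg_idx"
  shows "tconn P (a, g) z \<longleftrightarrow> rch P a b c g z"
  using assms tconn_imp_rch rch_imp_tconn by blast

lemma sg_idx_others:
  assumes "a \<in> sg_idx"
  obtains b c where "sg_idx = {a, b, c}" "a \<noteq> b" "a \<noteq> c" "b \<noteq> c"
proof -
  consider "a = 1" | "a = 2" | "a = 3" using assms by (auto simp: sg_idx_def)
  then show ?thesis
  proof cases
    case 1 then show ?thesis using that[of 2 3] by (auto simp: sg_idx_def)
  next
    case 2 then show ?thesis using that[of 1 3] by (auto simp: sg_idx_def)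
  next
    case 3 then show ?thesis using that[of 1 2] by (auto simp: sg_idx_def)
  qed
qed

lemma sg_idx_perm:
  assumes "sg_idx = {a, b, c}" "a \<noteq> b" "a \<noteq> c" "b \<noteq> c"
  shows "(a, b, c) \<in> {(1, 2, 3), (1, 3, 2), (2, 1, 3), (2, 3, 1), (3, 1, 2), (3, 2, 1)}"
proof -
  have "a \<in> {1,2,3}" "b \<in> {1,2,3}" "c \<in> {1,2,3}" using assms(1) unfolding sg_idx_def by auto
  then show ?thesis using assms(2-4) by auto
qed

section \<open>Edges and cycles of a glued graph\<close>

lemma inj_cell_image: "inj (\<lambda>e. sg_psi a ` e)"
  by (rule injI) (simp add: inj_image_eq_iff[OF inj_sg_psi])

lemma cell_im_mem_iff [simp]: "sg_psi a ` e \<in> cell_im a F \<longleftrightarrow> e \<in> F"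
  unfolding cell_im_def using inj_image_mem_iff[OF inj_cell_image] .

lemma cell_im_diff: "cell_im a (F - {e}) = cell_im a F - {sg_psi a ` e}"
  unfolding cell_im_def using image_set_diff[OF inj_cell_image, of a F "{e}"] by simp

text \<open>An edge in two cells would have both ends at their single common point.\<close>

lemma cell_im_disjoint:
  assumes "a \<in> sg_idx" "b \<in> sg_idx" "a \<noteq> b" "e \<in> sg_E n" "F \<subseteq> sg_E n"
  shows "sg_psi a ` e \<notin> cell_im b F"
proof
  assume "sg_psi a ` e \<in> cell_im b F"
  then obtain e' where e': "e' \<in> F" "sg_psi a ` e = sg_psi b ` e'" by (auto simp: cell_im_def)
  obtain x' y' where xy': "e' = {x', y'}" "x' \<in> sg_V n" "y' \<in> sg_V n"
    using sg_E_edge[of e' n] e' assms by blast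
  obtain x y where xy: "e = {x, y}" "x \<noteq> y" "x \<in> sg_V n" "y \<in> sg_V n"
    using sg_E_edge[OF assms(4)] by blast
  have "v = sg_u b" if v: "v \<in> {x, y}" for v
  proof -
    have "sg_psi a v \<in> sg_psi b ` e'" using e'(2) xy(1) v by auto
    then obtain v' where "v' \<in> {x', y'}" "sg_psi a v = sg_psi b v'" using xy' by blast
    moreover have "v \<in> sg_tri" "v' \<in> sg_tri" using calculation v xy xy' sg_V_tri by blast+
    ultimately show ?thesis using sg_psi_meet assms by blast
  qed
  then show False using xy by blast
qed

lemma glue_edgeI: "a \<in> sg_idx \<Longrightarrow> {x, y} \<in> Hs a \<Longrightarrow> {sg_psi a x, sg_psi a y} \<in> glue Hs"
  unfolding glue_def using cell_im_edge_iff[of a x y "Hs a"] by blast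

lemma glue_diff:
  assumes "\<forall>a\<in>sg_idx. Hs a \<subseteq> sg_E n" "a \<in> sg_idx" "e \<in> sg_E n"
  shows "glue Hs - {sg_psi a ` e} = glue (Hs(a := Hs a - {e}))"
proof -
  have "cell_im b (Hs b) - {sg_psi a ` e} = cell_im b ((Hs(a := Hs a - {e})) b)" if "b \<in> sg_idx" for b
    using that assms cell_im_disjoint[of a b e n "Hs b"] by (cases "b = a") (auto simp: cell_im_diff)
  then show ?thesis unfolding glue_def by blast
qed

text \<open>Each cell joins its two corners on the central hole, which closes a cycle around
  it.\<close>

definition hole :: "(nat \<Rightarrow> nat \<Rightarrow> nat \<Rightarrow> bool) \<Rightarrow> bool" where
  "hole P \<longleftrightarrow> P 1 2 3 \<and> P 2 1 3 \<and> P 3 1 2"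

lemma hole_iff:
  assumes P: "cell_equiv P" and abc: "sg_idx = {a, b, c}" "a \<noteq> b" "a \<noteq> c" "b \<noteq> c"
  shows "hole P \<longleftrightarrow> P a b c \<and> P b a c \<and> P c a b"
proof -
  have se: "P u v w \<longleftrightarrow> P u w v" if "u \<in> sg_idx" "v \<in> sg_idx" "w \<in> sg_idx" for u v w
    using P that unfolding cell_equiv_def by blast
  have "P 1 3 2 \<longleftrightarrow> P 1 2 3" "P 2 3 1 \<longleftrightarrow> P 2 1 3" "P 3 2 1 \<longleftrightarrow> P 3 1 2"
    by (rule se; simp add: sg_idx_def)+
  then show ?thesis using sg_idx_perm[OF abc] unfolding hole_def by auto
qed

text \<open>Since two cells meet in one point, a cycle either stays in a cell or passes through all
  three and surrounds the hole. Both directions are carried out with the bridge criterion.\<close>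

lemma acyclic_glue_iff:
  assumes sub: "\<forall>a\<in>sg_idx. Hs a \<subseteq> sg_E n"
  shows "acyclic_g (glue Hs) \<longleftrightarrow> (\<forall>a\<in>sg_idx. acyclic_g (Hs a)) \<and> \<not> hole (cellconn Hs)"
proof (intro iffI conjI ballI notI)
  fix a assume ac: "acyclic_g (glue Hs)" and a: "a \<in> sg_idx"
  show "acyclic_g (Hs a)"
    unfolding acyclic_g_iff
  proof (intro allI impI notI)
    fix x y assume xy: "x \<noteq> y" "{x, y} \<in> Hs a" "conn (Hs a - {{x, y}}) x y"
    have E: "{x, y} \<in> sg_E n" using xy sub a by blast
    have "conn (glue Hs - {sg_psi a ` {x, y}}) (sg_psi a x) (sg_psi a y)"
      unfolding glue_diff[OF sub a E] by (rule conn_glue[OF a]) (use xy in simp)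
    moreover have "{sg_psi a x, sg_psi a y} \<in> glue Hs" by (rule glue_edgeI[of a x y Hs, OF a xy(2)])
    ultimately show False using ac xy(1) unfolding acyclic_g_iff by auto
  qed
next
  assume ac: "acyclic_g (glue Hs)" and h: "hole (cellconn Hs)"
  have c: "conn (Hs 1) (sg_u 2) (sg_u 3)" "conn (Hs 2) (sg_u 1) (sg_u 3)" "conn (Hs 3) (sg_u 1) (sg_u 2)"
    using h by (auto simp: hole_def cellconn_def)
  have i: "1 \<in> sg_idx" "2 \<in> sg_idx" "3 \<in> sg_idx" by (auto simp: sg_idx_def)
  obtain xs where xs: "saw (Hs 1) (sg_u 2) (sg_u 3) xs" using conn_imp_saw[OF c(1)] .
  have ne: "sg_u 2 \<noteq> sg_u 3" using sg_u_eq_iff i by auto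
  obtain y ys where ys: "xs = sg_u 2 # y # ys"
  proof -
    obtain x1 r where "xs = x1 # r" using xs by (cases xs) (auto simp: saw_iff)
    moreover have "r \<noteq> []" using xs ne calculation by (auto simp: saw_iff)
    ultimately show ?thesis using xs that by (cases r) (auto simp: saw_iff)
  qed
  have e: "{sg_u 2, y} \<in> Hs 1" and s: "saw (Hs 1) y (sg_u 3) (y # ys)" and n: "sg_u 2 \<notin> set (y # ys)"
    using xs unfolding ys saw_iff by auto
  \<comment> \<open>Without the first edge of the walk in cell 1, its ends are still joined the long
    way round: along the rest of that walk, then through cells 3 and 2.\<close>
  define e0 where "e0 = {sg_u 2, y}"
  have E: "e0 \<in> sg_E n" using e sub i unfolding e0_def by blast
  define Hs' where "Hs' = Hs(1 := Hs 1 - {e0})"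
  have "conn (Hs' 1) y (sg_u 3)" using saw_avoid_conn[OF s n, of y] by (simp add: Hs'_def e0_def)
  moreover have "conn (Hs' 2) (sg_u 3) (sg_u 1)" "conn (Hs' 3) (sg_u 1) (sg_u 2)"
    using c conn_sym by (auto simp: Hs'_def)
  ultimately have "conn (glue Hs') (sg_psi 1 y) (sg_psi 1 (sg_u 3))"
     "conn (glue Hs') (sg_psi 3 (sg_u 1)) (sg_psi 3 (sg_u 2))"
     "conn (glue Hs') (sg_psi 2 (sg_u 3)) (sg_psi 2 (sg_u 1))"
    using conn_glue i by blast+
  then have "conn (glue Hs') (sg_psi 1 y) (sg_psi 1 (sg_u 2))"
    by (metis conn_trans sg_psi_u_commute)
  then have "conn (glue Hs - {sg_psi 1 ` e0}) (sg_psi 1 (sg_u 2)) (sg_psi 1 y)"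
    unfolding glue_diff[OF sub i(1) E] Hs'_def by (rule conn_sym)
  moreover have "{sg_psi 1 (sg_u 2), sg_psi 1 y} \<in> glue Hs"
    using e i cell_im_edge_iff[of 1 "sg_u 2" y "Hs 1"] unfolding glue_def by blast
  moreover have "sg_psi 1 (sg_u 2) \<noteq> sg_psi 1 y" using n by auto
  ultimately show False using ac unfolding acyclic_g_iff e0_def by auto
next
  assume "(\<forall>a\<in>sg_idx. acyclic_g (Hs a)) \<and> \<not> hole (cellconn Hs)"
  then have ac: "\<And>a. a \<in> sg_idx \<Longrightarrow> acyclic_g (Hs a)" and nh: "\<not> hole (cellconn Hs)" by auto
  show "acyclic_g (glue Hs)"
    unfolding acyclic_g_iff
  proof (intro allI impI notI)
    fix z z' assume z: "z \<noteq> z'" "{z, z'} \<in> glue Hs" and c: "conn (glue Hs - {{z, z'}}) z z'"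
    obtain a y y' where a: "a \<in> sg_idx" and y: "z = sg_psi a y" "z' = sg_psi a y'" "{y, y'} \<in> Hs a"
      using glue_edgeE[OF z(2)] .
    have E: "{y, y'} \<in> sg_E n" using y a sub by blast
    define Hs' where "Hs' = Hs(a := Hs a - {{y, y'}})"
    have sub': "\<forall>a\<in>sg_idx. Hs' a \<subseteq> sg_E n" using sub by (auto simp: Hs'_def)
    have "conn (glue Hs') (sg_psi a y) (sg_psi a y')"
      using c glue_diff[OF sub a E] by (simp add: y Hs'_def)
    from conn_glue_same_cell[OF sub' a _ _ this]
    have d: "conn (Hs' a) y y' \<or> (\<exists>g\<in>sg_idx. \<exists>d\<in>sg_idx. conn (Hs' a) y (sg_u g) \<and> conn (Hs' a) y' (sg_u d) \<and>
        tconn (cellconn Hs') (a, g) (a, d))" using sg_E_verts[OF E] by blast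
    have nc: "\<not> conn (Hs' a) y y'"
      using ac[OF a] y sg_E_verts[OF E] unfolding acyclic_g_iff Hs'_def by simp
    then obtain g d where g: "g \<in> sg_idx" "d \<in> sg_idx" "conn (Hs' a) y (sg_u g)" "conn (Hs' a) y' (sg_u d)"
        "tconn (cellconn Hs') (a, g) (a, d)" using d by blast
    obtain b c where abc: "sg_idx = {a, b, c}" "a \<noteq> b" "a \<noteq> c" "b \<noteq> c" using sg_idx_others[OF a] .
    have "rch (cellconn Hs') a b c g (a, d)"
      using g(5) tconn_iff_rch[OF cell_equiv_cellconn abc g(1)] by simp
    then have "rin (cellconn Hs') a b c g d" using abc g(2) unfolding rch_def by auto
    moreover have "\<not> cellconn Hs' a g d"
      using nc g conn_trans[OF conn_trans[OF g(3), of "sg_u d"] conn_sym[OF g(4)]] by (auto simp: cellconn_def)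
    ultimately have r: "cellconn Hs' b a c" "cellconn Hs' c a b"
      "cellconn Hs' a g b \<and> cellconn Hs' a c d \<or> cellconn Hs' a g c \<and> cellconn Hs' a b d"
      unfolding rin_def by auto
    have up: "conn (Hs a) p q" if "conn (Hs' a) p q" for p q
      by (rule conn_mono[OF that]) (auto simp: Hs'_def)
    \<comment> \<open>Putting the edge back joins the two ends inside cell \<open>a\<close> and
      completes the detour through the other two cells to a circuit of the hole.\<close>
    have yy: "conn (Hs a) y y'" by (rule conn_edge[OF y(3)])
    have k: "conn (Hs a) (sg_u g) (sg_u d)"
      using conn_trans[OF conn_trans[OF conn_sym[OF up[OF g(3)]] yy] up[OF g(4)]] .
    have "conn (Hs a) (sg_u b) (sg_u c)"
      using r(3) unfolding cellconn_def
    proof (elim disjE conjE)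
      assume h: "conn (Hs' a) (sg_u g) (sg_u b)" "conn (Hs' a) (sg_u c) (sg_u d)"
      show ?thesis using conn_trans[OF conn_trans[OF conn_sym[OF up[OF h(1)]] k] conn_sym[OF up[OF h(2)]]] .
    next
      assume h: "conn (Hs' a) (sg_u g) (sg_u c)" "conn (Hs' a) (sg_u b) (sg_u d)"
      show ?thesis using conn_sym[OF conn_trans[OF conn_trans[OF conn_sym[OF up[OF h(1)]] k] conn_sym[OF up[OF h(2)]]]] .
    qed
    moreover have "conn (Hs b) (sg_u a) (sg_u c)" "conn (Hs c) (sg_u a) (sg_u b)"
      using r abc by (auto simp: cellconn_def Hs'_def)
    ultimately have "hole (cellconn Hs)"
      unfolding hole_iff[OF cell_equiv_cellconn abc] by (simp add: cellconn_def)
    then show False using nh by simp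
  qed
qed

lemma sg_idx_ball: "(\<forall>a\<in>sg_idx. Q a) \<longleftrightarrow> Q 1 \<and> Q 2 \<and> Q 3"
  by (simp add: sg_idx_def)

section \<open>Classes of spanning forests and their decomposition\<close>

text \<open>A spanning forest each of whose components contains a corner is classified by the partition it
  induces on the corners: \<open>0\<close> stands for spanning trees, \<open>i \<in> {1,2,3}\<close> for the forests in which
  only \<open>sg_u i\<close> is separated, and \<open>4\<close> for three separated corners.\<close>

definition pc :: "nat \<Rightarrow> nat \<Rightarrow> nat \<Rightarrow> bool" where
  "pc t i j \<longleftrightarrow> i = j \<or> t = 0 \<or> (t < 4 \<and> i \<noteq> t \<and> j \<noteq> t)"

definition Cls :: "nat \<Rightarrow> nat \<Rightarrow> complex set set set" where
  "Cls n t = {F. F \<subseteq> sg_E n \<and> acyclic_g F \<and> (\<forall>x\<in>sg_V n. \<exists>j\<in>sg_idx. conn F x (sg_u j)) \<and>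
     (\<forall>i\<in>sg_idx. \<forall>j\<in>sg_idx. conn F (sg_u i) (sg_u j) \<longleftrightarrow> pc t i j)}"

lemma STrees_eq_Cls: "STrees n = Cls n 0"
proof -
  have "(\<forall>x\<in>sg_V n. \<forall>y\<in>sg_V n. conn F x y) \<longleftrightarrow> (\<forall>x\<in>sg_V n. \<exists>j\<in>sg_idx. conn F x (sg_u j)) \<and>
     (\<forall>i\<in>sg_idx. \<forall>j\<in>sg_idx. conn F (sg_u i) (sg_u j) \<longleftrightarrow> pc 0 i j)" (is "?L \<longleftrightarrow> ?R") for F
  proof
    assume ?L
    then show ?R
      using sg_u_V[of _ n] unfolding pc_def by (auto simp: sg_idx_def)
  next
    assume h: ?R
    show ?L
    proof (intro ballI)
      fix x y assume xy: "x \<in> sg_V n" "y \<in> sg_V n"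
      obtain i j where ij: "i \<in> sg_idx" "j \<in> sg_idx" "conn F x (sg_u i)" "conn F y (sg_u j)" using h xy by blast
      then have k: "conn F (sg_u i) (sg_u j)" using h by (simp add: pc_def)
      show "conn F x y" using conn_trans[OF conn_trans[OF ij(3) k] conn_sym[OF ij(4)]] .
    qed
  qed
  then show ?thesis unfolding STrees_def Cls_def by simp
qed

lemma finite_Cls: "finite (Cls n t)"
proof -
  have "Cls n t \<subseteq> Pow (sg_E n)" unfolding Cls_def by blast
  then show ?thesis using finite_sg_E finite_subset by blast
qed

lemma pc_inj:
  assumes "t \<le> 4" "t' \<le> 4" "\<forall>i\<in>sg_idx. \<forall>j\<in>sg_idx. pc t i j \<longleftrightarrow> pc t' i j"
  shows "t = t'"
proof -
  have "pc t 1 2 \<longleftrightarrow> pc t' 1 2" "pc t 1 3 \<longleftrightarrow> pc t' 1 3" "pc t 2 3 \<longleftrightarrow> pc t' 2 3"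
    using assms(3) by (simp_all add: sg_idx_def)
  moreover have "pc s 1 2 \<longleftrightarrow> s = 0 \<or> s = 3" "pc s 1 3 \<longleftrightarrow> s = 0 \<or> s = 2" "pc s 2 3 \<longleftrightarrow> s = 0 \<or> s = 1"
    for s by (auto simp: pc_def)
  ultimately have "(t = 0 \<or> t = 3) = (t' = 0 \<or> t' = 3)" "(t = 0 \<or> t = 2) = (t' = 0 \<or> t' = 2)"
    "(t = 0 \<or> t = 1) = (t' = 0 \<or> t' = 1)" by simp_all
  then show ?thesis using assms(1,2) by presburger
qed

lemma Cls_disjoint: "F \<in> Cls n t \<Longrightarrow> F \<in> Cls n t' \<Longrightarrow> t \<le> 4 \<Longrightarrow> t' \<le> 4 \<Longrightarrow> t = t'"
  by (rule pc_inj) (auto simp: Cls_def)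

text \<open>An equivalence relation on three corners is one of five partitions.\<close>

lemma Cls_exhaust:
  assumes "F \<subseteq> sg_E n" "acyclic_g F" "\<forall>x\<in>sg_V n. \<exists>j\<in>sg_idx. conn F x (sg_u j)"
  shows "\<exists>t\<le>4. F \<in> Cls n t"
proof -
  define C where "C i j \<longleftrightarrow> conn F (sg_u i) (sg_u j)" for i j :: nat
  have C: "C i i" "C i j \<Longrightarrow> C j i" "C i j \<Longrightarrow> C j k \<Longrightarrow> C i k" for i j k
    unfolding C_def using conn_sym conn_trans by blast+
  have sy: "C 2 1 = C 1 2" "C 3 1 = C 1 3" "C 3 2 = C 2 3" using C(2) by blast+
  have tr: "C 1 2 \<Longrightarrow> C 1 3 \<Longrightarrow> C 2 3" "C 1 2 \<Longrightarrow> C 2 3 \<Longrightarrow> C 1 3" "C 1 3 \<Longrightarrow> C 2 3 \<Longrightarrow> C 1 2"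
    using C by blast+
  define t :: nat where "t = (if C 1 2 then if C 1 3 then 0 else 3 else if C 1 3 then 2 else if C 2 3 then 1 else 4)"
  have "t \<le> 4" by (simp add: t_def)
  moreover have "\<forall>i\<in>sg_idx. \<forall>j\<in>sg_idx. C i j \<longleftrightarrow> pc t i j"
    using tr unfolding sg_idx_def t_def pc_def by (simp add: C(1) sy[unfolded One_nat_def]) argo
  ultimately show ?thesis using assms unfolding Cls_def C_def by blast
qed

section \<open>The class of a glued graph\<close>

definition corner_perms :: "(nat \<times> nat \<times> nat) list" where
  "corner_perms = [(1, 2, 3), (1, 3, 2), (2, 1, 3), (2, 3, 1), (3, 1, 2), (3, 2, 1)]"

text \<open>A finite criterion for the glued graph to belong to class \<open>t\<close>: no cycle
  round the hole, the right partition of the outer corners, and each shared corner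
  \<open>(i, j)\<close> connected to one of the three outer corners.\<close>

definition ok_glue :: "(nat \<Rightarrow> nat \<Rightarrow> nat \<Rightarrow> bool) \<Rightarrow> nat \<Rightarrow> bool" where
  "ok_glue P t \<longleftrightarrow> \<not> hole P \<and> (\<forall>(i, j, k)\<in>set corner_perms.
     (rout P i j k i \<longleftrightarrow> pc t i j) \<and> (rin P i j k i j \<or> rin P j i k j i \<or> rmid P k i j k))"

lemma ok_glue_cong:
  assumes "\<And>a b c. a \<in> sg_idx \<Longrightarrow> b \<in> sg_idx \<Longrightarrow> c \<in> sg_idx \<Longrightarrow> P a b c \<longleftrightarrow> Q a b c"
  shows "ok_glue P t \<longleftrightarrow> ok_glue Q t"
proof -
  have r: "rin P a b c g d \<longleftrightarrow> rin Q a b c g d" if "a \<in> sg_idx" "b \<in> sg_idx" "c \<in> sg_idx" "g \<in> sg_idx" "d \<in> sg_idx"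
    for a b c g d using that assms unfolding rin_def by simp
  have s: "rmid P a b c g \<longleftrightarrow> rmid Q a b c g" "rout P a b c g \<longleftrightarrow> rout Q a b c g"
    if "a \<in> sg_idx" "b \<in> sg_idx" "c \<in> sg_idx" "g \<in> sg_idx"
    for a b c g using that r assms unfolding rmid_def rout_def by simp_all
  have i: "1 \<in> sg_idx" "2 \<in> sg_idx" "3 \<in> sg_idx" by (auto simp: sg_idx_def)
  have h: "hole P \<longleftrightarrow> hole Q" using assms i unfolding hole_def by simp
  show ?thesis using i by (simp add: ok_glue_def corner_perms_def h r s)
qed

lemma corner_perms_idx:
  "(i, j, k) \<in> set corner_perms \<longleftrightarrow> sg_idx = {i, j, k} \<and> i \<noteq> j \<and> i \<noteq> k \<and> j \<noteq> k"
proof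
  assume "(i, j, k) \<in> set corner_perms"
  then show "sg_idx = {i, j, k} \<and> i \<noteq> j \<and> i \<noteq> k \<and> j \<noteq> k"
    unfolding corner_perms_def sg_idx_def by auto
next
  assume "sg_idx = {i, j, k} \<and> i \<noteq> j \<and> i \<noteq> k \<and> j \<noteq> k"
  then show "(i, j, k) \<in> set corner_perms" using sg_idx_perm[of i j k] by (simp add: corner_perms_def)
qed

text \<open>A vertex can leave its cell only through a corner. So its connection to an outer corner
  first reaches a corner of its own cell, and from there on only chains of corners matter.\<close>

lemma verts_glue_iff:
  assumes sub: "\<forall>a\<in>sg_idx. Hs a \<subseteq> sg_E n"
  shows "(\<forall>x\<in>sg_V (Suc n). \<exists>j\<in>sg_idx. conn (glue Hs) x (sg_u j)) \<longleftrightarrow>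
    (\<forall>a\<in>sg_idx. \<forall>x\<in>sg_V n. \<exists>j\<in>sg_idx. conn (Hs a) x (sg_u j)) \<and>
    (\<forall>a\<in>sg_idx. \<forall>b\<in>sg_idx. \<exists>j\<in>sg_idx. tconn (cellconn Hs) (j, j) (a, b))"
proof (intro iffI conjI ballI)
  fix a x assume h: "\<forall>x\<in>sg_V (Suc n). \<exists>j\<in>sg_idx. conn (glue Hs) x (sg_u j)" and a: "a \<in> sg_idx" and x: "x \<in> sg_V n"
  have "sg_psi a x \<in> sg_V (Suc n)" using a x by auto
  then obtain j where j: "j \<in> sg_idx" "conn (glue Hs) (sg_psi a x) (sg_u j)" using h by blast
  from conn_glueD[OF sub a x j(2)] show "\<exists>j\<in>sg_idx. conn (Hs a) x (sg_u j)"
  proof (elim disjE exE conjE)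
    fix v assume v: "sg_u j = sg_psi a v" "conn (Hs a) x v"
    have "v \<in> sg_tri" using conn_V[OF v(2) bspec[OF sub a] x] sg_V_tri by blast
    then have "v = sg_u j"
      using v(1) sg_psi_meet[of "sg_u j" v j a] sg_psi_u[of j] sg_u_tri[OF j(1)] j a
      by (cases "j = a") auto
    then show ?thesis using v j by blast
  qed blast
next
  fix a b assume h: "\<forall>x\<in>sg_V (Suc n). \<exists>j\<in>sg_idx. conn (glue Hs) x (sg_u j)" and ab: "a \<in> sg_idx" "b \<in> sg_idx"
  have "sg_psi a (sg_u b) \<in> sg_V (Suc n)" using ab sg_u_V[of b n] by auto
  then obtain j where j: "j \<in> sg_idx" "conn (glue Hs) (sg_psi a (sg_u b)) (sg_u j)" using h by blast
  have "conn (glue Hs) (sg_psi j (sg_u j)) (sg_psi a (sg_u b))"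
    using conn_sym[OF j(2)] by (simp add: sg_psi_u)
  then show "\<exists>j\<in>sg_idx. tconn (cellconn Hs) (j, j) (a, b)"
    using conn_glue_corner_iff[OF sub j(1) j(1) ab] j by blast
next
  fix x assume h: "(\<forall>a\<in>sg_idx. \<forall>x\<in>sg_V n. \<exists>j\<in>sg_idx. conn (Hs a) x (sg_u j)) \<and>
    (\<forall>a\<in>sg_idx. \<forall>b\<in>sg_idx. \<exists>j\<in>sg_idx. tconn (cellconn Hs) (j, j) (a, b))" and "x \<in> sg_V (Suc n)"
  then obtain a y where a: "a \<in> sg_idx" "y \<in> sg_V n" "x = sg_psi a y" by auto
  obtain b where b: "b \<in> sg_idx" "conn (Hs a) y (sg_u b)" using h a by blast
  obtain j where j: "j \<in> sg_idx" "tconn (cellconn Hs) (j, j) (a, b)" using h a b by blast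
  have "conn (glue Hs) (sg_u j) (sg_psi a (sg_u b))"
    using j conn_glue_corner_iff[OF sub j(1) j(1) a(1) b(1)] by (simp add: sg_psi_u)
  then have "conn (glue Hs) x (sg_u j)"
    using conn_trans[OF conn_glue[of a Hs y "sg_u b", OF a(1) b(2)] conn_sym] a(3) by blast
  then show "\<exists>j\<in>sg_idx. conn (glue Hs) x (sg_u j)" using j by blast
qed

text \<open>All conditions on the glued graph are expressed by \<open>cellconn\<close>, and on a
  class this relation is \<open>pc\<close>. Hence the class of the result is a function of the
  classes of the pieces.\<close>

lemma glue_Cls_iff:
  assumes H: "\<forall>a\<in>sg_idx. Hs a \<in> Cls n (tt a)"
  shows "glue Hs \<in> Cls (Suc n) t \<longleftrightarrow> ok_glue (\<lambda>a. pc (tt a)) t"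
proof -
  have sub: "\<forall>a\<in>sg_idx. Hs a \<subseteq> sg_E n" and ac: "\<forall>a\<in>sg_idx. acyclic_g (Hs a)"
    and v: "\<forall>a\<in>sg_idx. \<forall>x\<in>sg_V n. \<exists>j\<in>sg_idx. conn (Hs a) x (sg_u j)"
    and p: "\<And>a b c. a \<in> sg_idx \<Longrightarrow> b \<in> sg_idx \<Longrightarrow> c \<in> sg_idx \<Longrightarrow> cellconn Hs a b c \<longleftrightarrow> pc (tt a) b c"
    using H unfolding Cls_def cellconn_def by auto
  let ?P = "cellconn Hs"
  have gE: "glue Hs \<subseteq> sg_E (Suc n)"
    using sub unfolding sg_E_Suc glue_def cell_im_def by blast
  have corner: "conn (glue Hs) (sg_u i) (sg_u j) \<longleftrightarrow> rout ?P i j k i"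
    and mid: "tconn ?P (i, i) (i, j) \<longleftrightarrow> rin ?P i j k i j" "tconn ?P (j, j) (i, j) \<longleftrightarrow> rin ?P j i k j i"
       "tconn ?P (k, k) (i, j) \<longleftrightarrow> rmid ?P k i j k"
    if ijk: "(i, j, k) \<in> set corner_perms" for i j k
  proof -
    have d: "sg_idx = {i, j, k}" "i \<noteq> j" "i \<noteq> k" "j \<noteq> k" using ijk by (simp_all add: corner_perms_idx)
    have d2: "sg_idx = {j, i, k}" "j \<noteq> i" "j \<noteq> k" "i \<noteq> k" using d by auto
    have d3: "sg_idx = {k, i, j}" "k \<noteq> i" "k \<noteq> j" "i \<noteq> j" using d by auto
    have m: "i \<in> sg_idx" "j \<in> sg_idx" "k \<in> sg_idx" using d by auto
    have "conn (glue Hs) (sg_u i) (sg_u j) \<longleftrightarrow> tconn ?P (i, i) (j, j)"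
      using conn_glue_corner_iff[OF sub m(1) m(1) m(2) m(2)] by (simp add: sg_psi_u)
    also have "\<dots> \<longleftrightarrow> rout ?P i j k i"
      unfolding tconn_iff_rch[OF cell_equiv_cellconn d m(1)] using d by (simp add: rch_def)
    finally show "conn (glue Hs) (sg_u i) (sg_u j) \<longleftrightarrow> rout ?P i j k i" .
    show "tconn ?P (i, i) (i, j) \<longleftrightarrow> rin ?P i j k i j"
      unfolding tconn_iff_rch[OF cell_equiv_cellconn d m(1)] using d by (simp add: rch_def)
    show "tconn ?P (j, j) (i, j) \<longleftrightarrow> rin ?P j i k j i"
      unfolding tconn_iff_rch[OF cell_equiv_cellconn d2 m(2)] using d by (simp add: rch_def)
    show "tconn ?P (k, k) (i, j) \<longleftrightarrow> rmid ?P k i j k"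
      unfolding tconn_iff_rch[OF cell_equiv_cellconn d3 m(3)] using d by (simp add: rch_def)
  qed
  have "(\<forall>i\<in>sg_idx. \<forall>j\<in>sg_idx. conn (glue Hs) (sg_u i) (sg_u j) \<longleftrightarrow> pc t i j) \<longleftrightarrow>
      (\<forall>(i, j, k)\<in>set corner_perms. conn (glue Hs) (sg_u i) (sg_u j) \<longleftrightarrow> pc t i j)"
    unfolding sg_idx_def corner_perms_def by (auto simp: pc_def)
  also have "\<dots> \<longleftrightarrow> (\<forall>(i, j, k)\<in>set corner_perms. rout ?P i j k i \<longleftrightarrow> pc t i j)"
    using corner by fast
  finally have C: "(\<forall>i\<in>sg_idx. \<forall>j\<in>sg_idx. conn (glue Hs) (sg_u i) (sg_u j) \<longleftrightarrow> pc t i j) \<longleftrightarrow>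
     (\<forall>(i, j, k)\<in>set corner_perms. rout ?P i j k i \<longleftrightarrow> pc t i j)" .
  have "(\<forall>a\<in>sg_idx. \<forall>b\<in>sg_idx. \<exists>j\<in>sg_idx. tconn ?P (j, j) (a, b)) \<longleftrightarrow>
     (\<forall>(i, j, k)\<in>set corner_perms. \<exists>l\<in>sg_idx. tconn ?P (l, l) (i, j))"
  proof -
    have "\<exists>j\<in>sg_idx. tconn ?P (j, j) (a, a)" if "a \<in> sg_idx" for a using tconn.refl that by blast
    then show ?thesis unfolding sg_idx_ball by (simp add: corner_perms_def) (auto simp: sg_idx_def)
  qed
  also have "\<dots> \<longleftrightarrow> (\<forall>(i, j, k)\<in>set corner_perms. rin ?P i j k i j \<or> rin ?P j i k j i \<or> rmid ?P k i j k)"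
  proof (rule ball_cong[OF HOL.refl], clarify)
    fix i j k assume ijk: "(i, j, k) \<in> set corner_perms"
    then have d: "sg_idx = {i, j, k}" by (simp add: corner_perms_idx)
    show "(\<exists>l\<in>sg_idx. tconn ?P (l, l) (i, j)) \<longleftrightarrow> rin ?P i j k i j \<or> rin ?P j i k j i \<or> rmid ?P k i j k"
      unfolding d mid[OF ijk, symmetric] by blast
  qed
  finally have M: "(\<forall>a\<in>sg_idx. \<forall>b\<in>sg_idx. \<exists>j\<in>sg_idx. tconn ?P (j, j) (a, b)) \<longleftrightarrow>
     (\<forall>(i, j, k)\<in>set corner_perms. rin ?P i j k i j \<or> rin ?P j i k j i \<or> rmid ?P k i j k)" .
  have "glue Hs \<in> Cls (Suc n) t \<longleftrightarrow> \<not> hole ?P \<and>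
     (\<forall>a\<in>sg_idx. \<forall>b\<in>sg_idx. \<exists>j\<in>sg_idx. tconn ?P (j, j) (a, b)) \<and>
     (\<forall>i\<in>sg_idx. \<forall>j\<in>sg_idx. conn (glue Hs) (sg_u i) (sg_u j) \<longleftrightarrow> pc t i j)"
    unfolding Cls_def mem_Collect_eq verts_glue_iff[OF sub] acyclic_glue_iff[OF sub]
    using gE ac v by blast
  also have "\<dots> \<longleftrightarrow> ok_glue ?P t"
    unfolding C M ok_glue_def by fast
  also have "\<dots> \<longleftrightarrow> ok_glue (\<lambda>a. pc (tt a)) t"
    by (rule ok_glue_cong[OF p])
  finally show ?thesis .
qed

section \<open>Cutting a forest into its cells and summing over classes\<close>

definition cell_part :: "nat \<Rightarrow> nat \<Rightarrow> complex set set \<Rightarrow> complex set set" where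
  "cell_part n a H = {e \<in> sg_E n. sg_psi a ` e \<in> H}"

lemma cell_part_glue:
  assumes sub: "\<forall>a\<in>sg_idx. Hs a \<subseteq> sg_E n" and a: "a \<in> sg_idx"
  shows "cell_part n a (glue Hs) = Hs a"
proof -
  have "sg_psi a ` e \<in> glue Hs \<longleftrightarrow> e \<in> Hs a" if "e \<in> sg_E n" for e
  proof
    assume "sg_psi a ` e \<in> glue Hs"
    then obtain b where b: "b \<in> sg_idx" "sg_psi a ` e \<in> cell_im b (Hs b)" by (auto simp: glue_def)
    then have "b = a" using cell_im_disjoint[OF a b(1) _ that] sub by blast
    then show "e \<in> Hs a" using b by simp
  next
    assume "e \<in> Hs a"
    then have "sg_psi a ` e \<in> cell_im a (Hs a)" by simp
    then show "sg_psi a ` e \<in> glue Hs" using a unfolding glue_def by blast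
  qed
  then show ?thesis using sub a by (auto simp: cell_part_def)
qed

lemma glue_cell_part:
  assumes "H \<subseteq> sg_E (Suc n)"
  shows "glue (\<lambda>a. cell_part n a H) = H"
proof
  show "glue (\<lambda>a. cell_part n a H) \<subseteq> H" unfolding glue_def cell_part_def cell_im_def by auto
  show "H \<subseteq> glue (\<lambda>a. cell_part n a H)"
  proof
    fix e assume e: "e \<in> H"
    then obtain a e' where "a \<in> sg_idx" "e' \<in> sg_E n" "e = sg_psi a ` e'" using assms by auto
    with e show "e \<in> glue (\<lambda>a. cell_part n a H)" unfolding glue_def cell_part_def cell_im_def by auto
  qed
qed

text \<open>The equivalences for gluing, read backwards, pass acyclicity and the connection of every
  vertex to a corner on to each piece.\<close>

lemma cell_part_Cls:
  assumes H: "H \<in> Cls (Suc n) t" and a: "a \<in> sg_idx"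
  shows "\<exists>s\<le>4. cell_part n a H \<in> Cls n s"
proof (rule Cls_exhaust)
  have HE: "H \<subseteq> sg_E (Suc n)" using H by (simp add: Cls_def)
  have sub: "\<forall>a\<in>sg_idx. cell_part n a H \<subseteq> sg_E n" by (auto simp: cell_part_def)
  show "cell_part n a H \<subseteq> sg_E n" using sub a by blast
  have "acyclic_g (glue (\<lambda>a. cell_part n a H))"
    using H by (simp add: glue_cell_part[OF HE] Cls_def)
  then show "acyclic_g (cell_part n a H)" using acyclic_glue_iff[OF sub] a by blast
  have "\<forall>x\<in>sg_V (Suc n). \<exists>j\<in>sg_idx. conn (glue (\<lambda>a. cell_part n a H)) x (sg_u j)"
    using H by (simp add: glue_cell_part[OF HE] Cls_def)
  then show "\<forall>x\<in>sg_V n. \<exists>j\<in>sg_idx. conn (cell_part n a H) x (sg_u j)"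
    unfolding verts_glue_iff[OF sub] using a by blast
qed

definition tri :: "'b \<Rightarrow> 'b \<Rightarrow> 'b \<Rightarrow> nat \<Rightarrow> 'b" where
  "tri x y z a = (if a = 1 then x else if a = 2 then y else z)"

lemma tri_simps [simp]: "tri x y z 1 = x" "tri x y z (Suc 0) = x" "tri x y z 2 = y" "tri x y z 3 = z"
  by (simp_all add: tri_def)

text \<open>The admissible triples of classes for the cells 1, 2, 3, filtered from all 125
  candidates so that the list can be evaluated.\<close>

definition goods :: "nat \<Rightarrow> (nat \<times> nat \<times> nat) list" where
  "goods t = filter (\<lambda>(x, y, z). ok_glue (\<lambda>a. pc (tri x y z a)) t)
     (List.product [0, 1, 2, 3, 4] (List.product [0, 1, 2, 3, 4] [0, 1, 2, 3, 4]))"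

lemma goods_iff:
  "(x, y, z) \<in> set (goods t) \<longleftrightarrow> x \<le> 4 \<and> y \<le> 4 \<and> z \<le> 4 \<and> ok_glue (\<lambda>a. pc (tri x y z a)) t"
proof -
  have "v \<in> set [0, 1, 2, 3, 4] \<longleftrightarrow> v \<le> 4" for v :: nat by auto
  then show ?thesis
    unfolding goods_def set_filter set_product mem_Collect_eq mem_Times_iff by simp
qed

lemma distinct_goods: "distinct (goods t)"
  unfolding goods_def by (intro distinct_filter distinct_product) auto

lemma glue_cong: "(\<And>a. a \<in> sg_idx \<Longrightarrow> Hs a = Ks a) \<Longrightarrow> glue Hs = glue Ks"
  by (simp add: glue_def)

text \<open>Gluing is a bijection from admissible triples of pieces onto the class. The summand is
  arbitrary because the formula serves both for counting and for averages over walks.\<close>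

lemma sum_Cls_Suc:
  fixes G :: "complex set set \<Rightarrow> real"
  shows "(\<Sum>H\<in>Cls (Suc n) t. G H) = (\<Sum>(x, y, z)\<leftarrow>goods t.
     \<Sum>A\<in>Cls n x. \<Sum>B\<in>Cls n y. \<Sum>C\<in>Cls n z. G (glue (tri A B C)))"
proof -
  define S where "S = (SIGMA tr:set (goods t). Cls n (fst tr) \<times> Cls n (fst (snd tr)) \<times> Cls n (snd (snd tr)))"
  define f where "f = (\<lambda>(tr::nat \<times> nat \<times> nat, A, B, C). glue (tri A B C))"
  have le4: "x \<le> 4" "y \<le> 4" "z \<le> 4" if "(x, y, z) \<in> set (goods t)" for x y z
    using that by (simp_all add: goods_iff)
  have subs: "\<forall>a\<in>sg_idx. tri A B C a \<subseteq> sg_E n" if "A \<in> Cls n x" "B \<in> Cls n y" "C \<in> Cls n z" for A B C x y z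
    using that unfolding sg_idx_ball by (simp add: Cls_def)
  have "bij_betw f S (Cls (Suc n) t)"
  proof (rule bij_betwI')
    fix p q assume p: "p \<in> S" and q: "q \<in> S"
    obtain x y z A B C where p': "p = ((x, y, z), A, B, C)" by (metis prod.exhaust)
    obtain x' y' z' A' B' C' where q': "q = ((x', y', z'), A', B', C')" by (metis prod.exhaust)
    have P: "(x, y, z) \<in> set (goods t)" "A \<in> Cls n x" "B \<in> Cls n y" "C \<in> Cls n z"
      using p unfolding S_def p' by auto
    have Q: "(x', y', z') \<in> set (goods t)" "A' \<in> Cls n x'" "B' \<in> Cls n y'" "C' \<in> Cls n z'"
      using q unfolding S_def q' by auto
    show "f p = f q \<longleftrightarrow> p = q"
    proof
      assume "f p = f q"
      then have g: "glue (tri A B C) = glue (tri A' B' C')" by (simp add: f_def p' q')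
      have e: "tri A B C a = tri A' B' C' a" if "a \<in> sg_idx" for a
        using cell_part_glue[OF subs[OF P(2-4)] that] cell_part_glue[OF subs[OF Q(2-4)] that] g by simp
      have "A = A'" "B = B'" "C = C'" using e[of 1] e[of 2] e[of 3] by (auto simp: sg_idx_def)
      moreover from this have "x = x'" "y = y'" "z = z'"
        using Cls_disjoint P Q le4[OF P(1)] le4[OF Q(1)] by blast+
      ultimately show "p = q" by (simp add: p' q')
    qed simp
  next
    fix p assume p: "p \<in> S"
    obtain x y z A B C where p': "p = ((x, y, z), A, B, C)" by (metis prod.exhaust)
    have P: "(x, y, z) \<in> set (goods t)" "A \<in> Cls n x" "B \<in> Cls n y" "C \<in> Cls n z"
      using p unfolding S_def p' by auto
    have "\<forall>a\<in>sg_idx. tri A B C a \<in> Cls n (tri x y z a)" using P unfolding sg_idx_ball by simp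
    from glue_Cls_iff[OF this] P(1) show "f p \<in> Cls (Suc n) t" by (simp add: f_def p' goods_iff)
  next
    fix H assume H: "H \<in> Cls (Suc n) t"
    let ?Q = "\<lambda>a. cell_part n a H"
    have i: "1 \<in> sg_idx" "2 \<in> sg_idx" "3 \<in> sg_idx" by (auto simp: sg_idx_def)
    obtain x y z where xyz: "x \<le> 4" "?Q 1 \<in> Cls n x" "y \<le> 4" "?Q 2 \<in> Cls n y" "z \<le> 4" "?Q 3 \<in> Cls n z"
      using cell_part_Cls[OF H] i by meson
    have "\<forall>a\<in>sg_idx. tri (?Q 1) (?Q 2) (?Q 3) a \<in> Cls n (tri x y z a)" using xyz unfolding sg_idx_ball by simp
    note ok = glue_Cls_iff[OF this, of t]
    have gl: "glue (tri (?Q 1) (?Q 2) (?Q 3)) = glue ?Q"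
      by (rule glue_cong) (auto simp: sg_idx_def)
    also have "\<dots> = H" using H by (intro glue_cell_part) (simp add: Cls_def)
    finally have gl: "glue (tri (?Q 1) (?Q 2) (?Q 3)) = H" .
    have "(x, y, z) \<in> set (goods t)" using ok H gl xyz by (simp add: goods_iff)
    then have "((x, y, z), ?Q 1, ?Q 2, ?Q 3) \<in> S" using xyz by (simp add: S_def)
    moreover have "H = f ((x, y, z), ?Q 1, ?Q 2, ?Q 3)" using gl by (simp add: f_def)
    ultimately show "\<exists>p\<in>S. H = f p" by blast
  qed
  then have "(\<Sum>H\<in>Cls (Suc n) t. G H) = (\<Sum>p\<in>S. G (f p))"
    by (rule sum.reindex_bij_betw[symmetric])
  also have "\<dots> = (\<Sum>tr\<in>set (goods t). \<Sum>(A, B, C)\<in>Cls n (fst tr) \<times> Cls n (fst (snd tr)) \<times> Cls n (snd (snd tr)).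
       G (glue (tri A B C)))"
    unfolding S_def by (subst sum.Sigma) (auto simp: finite_Cls f_def split_def)
  also have "\<dots> = (\<Sum>tr\<in>set (goods t). case tr of (x, y, z) \<Rightarrow>
     \<Sum>A\<in>Cls n x. \<Sum>B\<in>Cls n y. \<Sum>C\<in>Cls n z. G (glue (tri A B C)))"
    by (intro sum.cong) (auto simp: sum.cartesian_product split_def)
  also have "\<dots> = (\<Sum>(x, y, z)\<leftarrow>goods t.
     \<Sum>A\<in>Cls n x. \<Sum>B\<in>Cls n y. \<Sum>C\<in>Cls n z. G (glue (tri A B C)))"
    by (rule sum_list_distinct_conv_sum_set[OF distinct_goods, symmetric])
  finally show ?thesis .
qed

text \<open>Two cells carry trees; the third carries a two-component forest that separates its two
  corners on the hole. This gives 3 times 2 triples.\<close>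

lemma goods_0: "goods 0 = [(0, 0, 1), (0, 0, 2), (0, 1, 0), (0, 3, 0), (2, 0, 0), (3, 0, 0)]"
  by code_simp

lemma goods_1: "goods 1 = [(0, 1, 1), (1, 0, 1), (1, 0, 2), (1, 1, 0), (1, 3, 0), (2, 0, 1), (3, 1, 0), (4, 0, 0)]"
  by code_simp

lemma goods_2: "goods 2 = [(0, 1, 2), (0, 2, 1), (0, 2, 2), (0, 4, 0), (2, 0, 2), (2, 2, 0), (2, 3, 0), (3, 2, 0)]"
  by code_simp

lemma goods_3: "goods 3 = [(0, 0, 4), (0, 1, 3), (0, 3, 1), (0, 3, 3), (2, 0, 3), (3, 0, 2), (3, 0, 3), (3, 3, 0)]"
  by code_simp

lemma goods_4: "goods 4 = [(0, 1, 4), (0, 2, 4), (0, 4, 1), (0, 4, 3), (1, 0, 4), (1, 1, 2), (1, 1, 3), (1, 2, 1), (1, 2, 2), (1, 3, 1), (1, 3, 3), (1, 4, 0), (2, 0, 4), (2, 2, 1), (2, 2, 3), (2, 3, 1), (2, 3, 3), (3, 1, 2), (3, 1, 3), (3, 2, 2), (3, 2, 3), (3, 4, 0), (4, 0, 2), (4, 0, 3), (4, 2, 0), (4, 3, 0)]"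
  by code_simp

section \<open>Counting\<close>

definition cn :: "nat \<Rightarrow> nat \<Rightarrow> real" where
  "cn n t = real (card (Cls n t))"

lemma cn_Suc: "cn (Suc n) t = (\<Sum>(x, y, z)\<leftarrow>goods t. cn n x * cn n y * cn n z)"
proof -
  have "cn (Suc n) t = (\<Sum>H\<in>Cls (Suc n) t. 1)" by (simp add: cn_def)
  also have "\<dots> = (\<Sum>(x, y, z)\<leftarrow>goods t. cn n x * cn n y * cn n z)"
    unfolding sum_Cls_Suc by (simp add: cn_def mult.assoc)
  finally show ?thesis .
qed

lemma conn_0_iff:
  assumes F: "F \<subseteq> sg_E 0" and ijk: "sg_idx = {i, j, k}" "i \<noteq> j" "i \<noteq> k" "j \<noteq> k"
  shows "conn F (sg_u i) (sg_u j) \<longleftrightarrow> {sg_u i, sg_u j} \<in> F \<or> {sg_u i, sg_u k} \<in> F \<and> {sg_u k, sg_u j} \<in> F"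
    (is "_ \<longleftrightarrow> ?R")
proof
  have i: "i \<in> sg_idx" "j \<in> sg_idx" "k \<in> sg_idx" using ijk by auto
  have d: "sg_u i \<noteq> sg_u j" "sg_u i \<noteq> sg_u k" "sg_u j \<noteq> sg_u k" using sg_u_eq_iff i ijk by auto
  have V: "sg_V 0 = {sg_u i, sg_u j, sg_u k}"
  proof -
    have "sg_V 0 = sg_u ` sg_idx" by (simp add: sg_idx_def)
    then show ?thesis by (simp add: ijk(1))
  qed
  assume "conn F (sg_u i) (sg_u j)"
  then have "sg_u j = sg_u i \<or> (sg_u j = sg_u j \<and> ?R) \<or> (sg_u j = sg_u k \<and> ({sg_u i, sg_u k} \<in> F \<or> {sg_u i, sg_u j} \<in> F \<and> {sg_u j, sg_u k} \<in> F))"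
  proof (induction rule: conn_induct[where P = "\<lambda>z. z = sg_u i \<or> (z = sg_u j \<and> ?R) \<or> (z = sg_u k \<and> ({sg_u i, sg_u k} \<in> F \<or> {sg_u i, sg_u j} \<in> F \<and> {sg_u j, sg_u k} \<in> F))"])
    case (step y z)
    have "z = sg_u i \<or> z = sg_u j \<or> z = sg_u k" using step.hyps(2) F sg_E_verts[of y z 0] unfolding V by blast
    moreover have "y \<noteq> z" using step.hyps(2) F sg_E_verts[of y z 0] by blast
    ultimately show ?case using step.IH step.hyps(2) d by (auto simp: insert_commute)
  qed simp
  then show ?R using d d[symmetric] by simp
next
  assume ?R
  then show "conn F (sg_u i) (sg_u j)"
    using conn_edge conn_trans[OF conn_edge[of "sg_u i" "sg_u k" F] conn_edge] by blast
qed

lemma acyclic_0_iff: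
  assumes F: "F \<subseteq> sg_E 0"
  shows "acyclic_g F \<longleftrightarrow> F \<noteq> sg_E 0"
proof
  have i: "1 \<in> sg_idx" "2 \<in> sg_idx" "3 \<in> sg_idx" by (auto simp: sg_idx_def)
  have d: "sg_u 1 \<noteq> sg_u 2" "sg_u 1 \<noteq> sg_u 3" "sg_u 2 \<noteq> sg_u 3" using sg_u_eq_iff i by auto
  assume ac: "acyclic_g F"
  show "F \<noteq> sg_E 0"
  proof
    assume FE: "F = sg_E 0"
    have "conn (F - {{sg_u 1, sg_u 2}}) (sg_u 1) (sg_u 3)"
      by (rule conn_edge) (use d in \<open>auto simp: FE doubleton_eq_iff\<close>)
    also have "conn (F - {{sg_u 1, sg_u 2}}) (sg_u 3) (sg_u 2)"
      by (rule conn_edge) (use d in \<open>auto simp: FE doubleton_eq_iff\<close>)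
    finally show False using ac d FE unfolding acyclic_g_iff by auto
  qed
next
  assume ne: "F \<noteq> sg_E 0"
  show "acyclic_g F"
    unfolding acyclic_g_iff
  proof (intro allI impI notI)
    fix x y assume xy: "x \<noteq> y" "{x, y} \<in> F" "conn (F - {{x, y}}) x y"
    have V: "sg_V 0 = sg_u ` sg_idx" by (simp add: sg_idx_def)
    obtain i j where ij: "i \<in> sg_idx" "j \<in> sg_idx" "x = sg_u i" "y = sg_u j"
      using xy(2) F sg_E_verts[of x y 0] unfolding V by blast
    then have "i \<noteq> j" using xy by auto
    obtain b c where "sg_idx = {i, b, c}" "i \<noteq> b" "i \<noteq> c" "b \<noteq> c" using sg_idx_others[OF ij(1)] .
    then obtain k where k: "sg_idx = {i, j, k}" "i \<noteq> k" "j \<noteq> k"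
      using ij(2) \<open>i \<noteq> j\<close> by (cases "j = b") (auto simp: insert_commute)
    have "F - {{x, y}} \<subseteq> sg_E 0" using F by blast
    from conn_0_iff[OF this k(1) \<open>i \<noteq> j\<close> k(2,3)] xy(3) ij
    have e: "{sg_u i, sg_u k} \<in> F" "{sg_u k, sg_u j} \<in> F" by auto
    have "sg_E 0 = {{sg_u i, sg_u j}, {sg_u i, sg_u k}, {sg_u k, sg_u j}}"
      using sg_idx_perm[OF k(1) \<open>i \<noteq> j\<close> k(2,3)] by (auto simp: insert_commute)
    then have "sg_E 0 \<subseteq> F" using e xy(2) ij by simp
    then show False using ne F by blast
  qed
qed

lemma corner_perms_ball:
  "(\<forall>(i, j, k)\<in>set corner_perms. Q i j k) \<longleftrightarrow>
    Q 1 2 3 \<and> Q 1 3 2 \<and> Q 2 1 3 \<and> Q 2 3 1 \<and> Q 3 1 2 \<and> Q 3 2 1"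
  by (simp add: corner_perms_def)

lemma Cls_0_iff:
  "F \<in> Cls 0 t \<longleftrightarrow> F \<subseteq> sg_E 0 \<and> F \<noteq> sg_E 0 \<and> (\<forall>(i, j, k)\<in>set corner_perms.
      {sg_u i, sg_u j} \<in> F \<or> {sg_u i, sg_u k} \<in> F \<and> {sg_u k, sg_u j} \<in> F \<longleftrightarrow> pc t i j)"
proof (cases "F \<subseteq> sg_E 0")
  case True
  have "(\<forall>i\<in>sg_idx. \<forall>j\<in>sg_idx. conn F (sg_u i) (sg_u j) \<longleftrightarrow> pc t i j) \<longleftrightarrow>
      (\<forall>(i, j, k)\<in>set corner_perms. conn F (sg_u i) (sg_u j) \<longleftrightarrow> pc t i j)"
    unfolding sg_idx_def corner_perms_def by (auto simp: pc_def)
  also have "\<dots> \<longleftrightarrow> (\<forall>(i, j, k)\<in>set corner_perms.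
      {sg_u i, sg_u j} \<in> F \<or> {sg_u i, sg_u k} \<in> F \<and> {sg_u k, sg_u j} \<in> F \<longleftrightarrow> pc t i j)"
    using conn_0_iff[OF True] by (intro ball_cong HOL.refl) (auto simp: corner_perms_idx)
  finally have C: "(\<forall>i\<in>sg_idx. \<forall>j\<in>sg_idx. conn F (sg_u i) (sg_u j) \<longleftrightarrow> pc t i j) \<longleftrightarrow>
     (\<forall>(i, j, k)\<in>set corner_perms.
      {sg_u i, sg_u j} \<in> F \<or> {sg_u i, sg_u k} \<in> F \<and> {sg_u k, sg_u j} \<in> F \<longleftrightarrow> pc t i j)" .
  have v: "\<forall>x\<in>sg_V 0. \<exists>j\<in>sg_idx. conn F x (sg_u j)"
    by (auto simp: sg_idx_def)
  show ?thesis unfolding Cls_def mem_Collect_eq C acyclic_0_iff[OF True] using True v by blast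
qed (simp add: Cls_def)

text \<open>The seven proper subsets of the three edges: two edges form a tree, one edge separates
  the opposite corner, and no edge separates all corners.\<close>

lemma Cls_0:
  defines "e \<equiv> \<lambda>i j. {sg_u i, sg_u j}"
  shows "Cls 0 0 = {{e 1 2, e 2 3}, {e 2 3, e 3 1}, {e 1 2, e 3 1}}" "Cls 0 1 = {{e 2 3}}" "Cls 0 2 = {{e 3 1}}"
    "Cls 0 3 = {{e 1 2}}" "Cls 0 4 = {{}}"
    "e 1 2 \<noteq> e 2 3" "e 2 3 \<noteq> e 3 1" "e 1 2 \<noteq> e 3 1"
proof -
  have i: "1 \<in> sg_idx" "2 \<in> sg_idx" "3 \<in> sg_idx" by (auto simp: sg_idx_def)
  have d: "sg_u 1 \<noteq> sg_u 2" "sg_u 1 \<noteq> sg_u 3" "sg_u 2 \<noteq> sg_u 3" using sg_u_eq_iff i by auto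
  show D: "e 1 2 \<noteq> e 2 3" "e 2 3 \<noteq> e 3 1" "e 1 2 \<noteq> e 3 1"
    using d unfolding e_def doubleton_eq_iff by auto
  have E: "sg_E 0 = {e 1 2, e 2 3, e 3 1}" by (simp add: e_def)
  have sy: "e 2 1 = e 1 2" "e 3 2 = e 2 3" "e 1 3 = e 3 1" unfolding e_def by (rule insert_commute)+
  define C where "C A t \<longleftrightarrow> (\<forall>(i, j, k)\<in>set corner_perms. (e i j \<in> A \<or> e i k \<in> A \<and> e k j \<in> A) \<longleftrightarrow> pc t i j)" for A t
  have Ci: "C A t \<longleftrightarrow> ((e 1 2 \<in> A \<or> e 3 1 \<in> A \<and> e 2 3 \<in> A) \<longleftrightarrow> pc t 1 2) \<and>
     ((e 3 1 \<in> A \<or> e 1 2 \<in> A \<and> e 2 3 \<in> A) \<longleftrightarrow> pc t 1 3) \<and> ((e 2 3 \<in> A \<or> e 1 2 \<in> A \<and> e 3 1 \<in> A) \<longleftrightarrow> pc t 2 3)" for A t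
  proof -
    have s: "pc t 2 1 \<longleftrightarrow> pc t 1 2" "pc t 3 1 \<longleftrightarrow> pc t 1 3" "pc t 3 2 \<longleftrightarrow> pc t 2 3" unfolding pc_def by auto
    have taut: "((x \<or> z \<and> y) = P \<and> (z \<or> x \<and> y) = Q \<and> (x \<or> y \<and> z) = P \<and> (y \<or> x \<and> z) = R \<and>
       (z \<or> y \<and> x) = Q \<and> (y \<or> z \<and> x) = R) =
       ((x \<or> z \<and> y) = P \<and> (z \<or> x \<and> y) = Q \<and> (y \<or> x \<and> z) = R)" for x y z P Q R
      by (cases x; cases y; cases z) auto
    show ?thesis
      unfolding C_def corner_perms_ball sy s
      by (rule taut)
  qed
  define L0 where "L0 = {{}, {e 1 2}, {e 2 3}, {e 3 1}, {e 1 2, e 2 3}, {e 2 3, e 3 1}, {e 1 2, e 3 1}}"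
  define top where "top = {e 1 2, e 2 3, e 3 1}"
  have K: "F \<in> Cls 0 t \<longleftrightarrow> F \<in> Pow top \<and> F \<noteq> top \<and> C F t" for F t
    using Cls_0_iff[of F t] unfolding E C_def e_def top_def Pow_iff .
  have P: "Pow top = insert top L0"
  proof (rule subset_antisym)
    show "insert top L0 \<subseteq> Pow top" unfolding top_def L0_def by auto
    show "Pow top \<subseteq> insert top L0"
    proof
      fix F assume "F \<in> Pow top"
      then have "F = (if e 1 2 \<in> F then {e 1 2} else {}) \<union> (if e 2 3 \<in> F then {e 2 3} else {}) \<union>
          (if e 3 1 \<in> F then {e 3 1} else {})" (is "_ = ?X") unfolding top_def by auto
      moreover have "?X \<in> insert top L0"
        unfolding top_def L0_def
        by (cases "e 1 2 \<in> F"; cases "e 2 3 \<in> F"; cases "e 3 1 \<in> F") (simp_all add: insert_commute)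
      ultimately show "F \<in> insert top L0" by simp
    qed
  qed
  have N: "top \<notin> L0"
  proof -
    have "e 1 2 \<in> top" "e 2 3 \<in> top" "e 3 1 \<in> top" by (simp_all add: top_def)
    moreover have "e 1 2 \<notin> F \<or> e 2 3 \<notin> F \<or> e 3 1 \<notin> F" if "F \<in> L0" for F
      using that D D[symmetric] unfolding L0_def by auto
    ultimately show ?thesis by blast
  qed
  have L: "Cls 0 t = {F \<in> {{}, {e 1 2}, {e 2 3}, {e 3 1}, {e 1 2, e 2 3}, {e 2 3, e 3 1}, {e 1 2, e 3 1}}. C F t}" for t
    unfolding L0_def[symmetric] by (rule set_eqI) (use N in \<open>auto simp: K P\<close>)
  have M: "C {} t \<longleftrightarrow> \<not> pc t 1 2 \<and> \<not> pc t 1 3 \<and> \<not> pc t 2 3"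
    "C {e 1 2} t \<longleftrightarrow> pc t 1 2 \<and> \<not> pc t 1 3 \<and> \<not> pc t 2 3"
    "C {e 3 1} t \<longleftrightarrow> \<not> pc t 1 2 \<and> pc t 1 3 \<and> \<not> pc t 2 3"
    "C {e 2 3} t \<longleftrightarrow> \<not> pc t 1 2 \<and> \<not> pc t 1 3 \<and> pc t 2 3"
    "C {e 1 2, e 2 3} t \<longleftrightarrow> pc t 1 2 \<and> pc t 1 3 \<and> pc t 2 3"
    "C {e 2 3, e 3 1} t \<longleftrightarrow> pc t 1 2 \<and> pc t 1 3 \<and> pc t 2 3"
    "C {e 1 2, e 3 1} t \<longleftrightarrow> pc t 1 2 \<and> pc t 1 3 \<and> pc t 2 3" for t
    unfolding Ci using D D[symmetric] by auto
  have S: "{F \<in> insert A B. Q F} = (if Q A then insert A {F \<in> B. Q F} else {F \<in> B. Q F})" for A B and Q :: "complex set set \<Rightarrow> bool"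
    by auto
  show "Cls 0 0 = {{e 1 2, e 2 3}, {e 2 3, e 3 1}, {e 1 2, e 3 1}}" "Cls 0 1 = {{e 2 3}}" "Cls 0 2 = {{e 3 1}}"
    "Cls 0 3 = {{e 1 2}}" "Cls 0 4 = {{}}"
    unfolding L S M by (simp_all add: pc_def)
qed

lemma cn_0: "cn 0 0 = 3" "cn 0 1 = 1" "cn 0 2 = 1" "cn 0 3 = 1" "cn 0 4 = 1"
proof -
  show "cn 0 1 = 1" "cn 0 2 = 1" "cn 0 3 = 1" "cn 0 4 = 1"
    unfolding cn_def Cls_0 by simp_all
  have "card {{a, b}, {b, c}, {a, c}} = 3" if "a \<noteq> b" "b \<noteq> c" "a \<noteq> c" for a b c :: "complex set"
  proof -
    have "{a, b} \<noteq> {b, c}" "{b, c} \<noteq> {a, c}" "{a, b} \<noteq> {a, c}" using that by (auto simp: doubleton_eq_iff)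
    then show ?thesis by simp
  qed
  from this[OF Cls_0(6-8)] show "cn 0 0 = 3"
    unfolding cn_def Cls_0 by simp
qed

text \<open>The relation \<open>TR = 3 S\<^sup>2\<close> between the numbers of spanning trees, two-component and three-component
  forests is preserved by the recursion; it makes the conditional laws below independent of \<open>n\<close>.\<close>

lemma cn_relations:
  "cn n 0 > 0 \<and> cn n 1 > 0 \<and> cn n 2 = cn n 1 \<and> cn n 3 = cn n 1 \<and> cn n 0 * cn n 4 = 3 * (cn n 1 * cn n 1)"
proof (induction n)
  case 0
  then show ?case by (simp only: cn_0) simp
next
  case (Suc n)
  define a b d where "a = cn n 0" and "b = cn n 1" and "d = cn n 4"
  have e: "cn n 2 = b" "cn n 3 = b" "a * d = 3 * (b * b)" "a > 0" "b > 0" using Suc by (auto simp: a_def b_def d_def)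
  have c0: "cn (Suc n) 0 = 6 * (a * a * b)"
    unfolding cn_Suc goods_0 by (simp add: e a_def[symmetric] b_def[symmetric, unfolded One_nat_def])
  have c1: "cn (Suc n) t = 7 * (a * b * b) + a * a * d" if "t = 1 \<or> t = 2 \<or> t = 3" for t
    using that
    by (elim disjE) (simp_all only: cn_Suc goods_1 goods_2 goods_3,
       simp_all add: e a_def[symmetric] b_def[symmetric, unfolded One_nat_def] d_def[symmetric] algebra_simps)
  have c4: "cn (Suc n) 4 = 14 * (b * b * b) + 12 * (a * b * d)"
    unfolding cn_Suc goods_4 by (simp add: e a_def[symmetric] b_def[symmetric, unfolded One_nat_def] d_def[symmetric] algebra_simps)
  have c1': "cn (Suc n) t = 10 * (a * b * b)" if "t = 1 \<or> t = 2 \<or> t = 3" for t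
  proof -
    have "a * a * d = a * (3 * (b * b))" using e by (simp add: mult.assoc)
    then show ?thesis using c1[OF that] by simp
  qed
  have "a * b * d = b * (3 * (b * b))" using e by (simp add: mult.assoc mult.left_commute)
  then have c4': "cn (Suc n) 4 = 50 * (b * b * b)" using c4 by simp
  have "cn (Suc n) 0 > 0" "cn (Suc n) 1 > 0" using e c0 c1'[of 1] by simp_all
  moreover have "cn (Suc n) 2 = cn (Suc n) 1" "cn (Suc n) 3 = cn (Suc n) 1" using c1' by simp_all
  \<comment> \<open>The relation reproduces itself because 6 * 50 = 3 * 10 * 10.\<close>
  moreover have "cn (Suc n) 0 * cn (Suc n) 4 = 3 * (cn (Suc n) 1 * cn (Suc n) 1)"
    unfolding c0 c4' c1'[OF disjI1[OF HOL.refl]] by (simp add: algebra_simps)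
  ultimately show ?case by blast
qed

lemma cn_pos: "t \<le> 4 \<Longrightarrow> cn n t > 0"
proof -
  assume "t \<le> 4"
  then consider "t = 0" | "t = 1" | "t = 2" | "t = 3" | "t = 4" by linarith
  moreover have "cn n 4 > 0"
    using cn_relations[of n] by (metis mult_pos_pos zero_less_mult_pos zero_less_numeral)
  ultimately show ?thesis using cn_relations[of n] by cases auto
qed

text \<open>The conditional probability of a triple of classes given the class \<open>t\<close> of
  the glued forest. Six triples are equally likely for a tree. For a two-component forest,
  \<open>TR = 3 S^2\<close> makes the one triple with a three-component piece count as much as three
  of the seven others.\<close>

definition wt :: "nat \<Rightarrow> nat \<times> nat \<times> nat \<Rightarrow> real" where
  "wt t tr = (case tr of (x, y, z) \<Rightarrow> if t = 0 then 1/6 else if x = 4 \<or> y = 4 \<or> z = 4 then 3/10 else 1/10)"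

lemma wt_nonneg: "wt t tr \<ge> 0"
  by (simp add: wt_def split: prod.split)

lemma wt_cn:
  assumes "t \<le> 3" "(x, y, z) \<in> set (goods t)"
  shows "cn n x * cn n y * cn n z = wt t (x, y, z) * cn (Suc n) t"
proof -
  define a b d where "a = cn n 0" and "b = cn n 1" and "d = cn n 4"
  have e: "cn n 2 = b" "cn n 3 = b" "cn n 1 = b" "cn n 0 = a" "cn n 4 = d" "a * d = 3 * (b * b)"
    using cn_relations[of n] by (auto simp: a_def b_def d_def)
  have ad: "a * a * d = 3 * (a * b * b)" "a * d * a = 3 * (a * b * b)" "d * a * a = 3 * (a * b * b)" using e by (simp_all add: algebra_simps)
  have c0: "cn (Suc n) 0 = 6 * (a * a * b)"
    unfolding cn_Suc goods_0 by (simp add: e e[unfolded One_nat_def])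
  have c1: "cn (Suc n) s = 10 * (a * b * b)" if "s = 1 \<or> s = 2 \<or> s = 3" for s
    using that ad
    by (elim disjE) (simp_all only: cn_Suc goods_1 goods_2 goods_3,
       simp_all add: e e[unfolded One_nat_def] algebra_simps)
  have "t = 0 \<or> t = 1 \<or> t = 2 \<or> t = 3" using assms(1) by linarith
  then show ?thesis
  proof (elim disjE)
    assume t: "t = 0"
    show ?thesis using assms(2) unfolding t goods_0 c0
      by (auto simp: wt_def e e[unfolded One_nat_def])
  next
    assume t: "t = 1"
    show ?thesis using assms(2) ad c1[of 1] unfolding t goods_1
      by (auto simp: wt_def e e[unfolded One_nat_def])
  next
    assume t: "t = 2"
    show ?thesis using assms(2) ad c1[of 2] unfolding t goods_2
      by (auto simp: wt_def e e[unfolded One_nat_def])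
  next
    assume t: "t = 3"
    show ?thesis using assms(2) ad c1[of 3] unfolding t goods_3
      by (auto simp: wt_def e e[unfolded One_nat_def])
  qed
qed

section \<open>Gluing self-avoiding walks\<close>

text \<open>Each walk begins at the end of the previous one; \<open>tl\<close> removes the repeated
  point.\<close>

fun joinl :: "'b list list \<Rightarrow> 'b list" where
  "joinl [] = []"
| "joinl [x] = x"
| "joinl (x # y # r) = x @ tl (joinl (y # r))"

lemma saw_join:
  assumes x: "saw F x y xs" and z: "saw F y z ys" and d: "set xs \<inter> set (tl ys) = {}"
  shows "saw F x z (xs @ tl ys)"
proof -
  obtain zs where ys: "ys = y # zs" using z by (cases ys) (auto simp: saw_iff)
  show ?thesis
  proof (cases "zs = []")
    case True
    then show ?thesis using x z ys by (simp add: saw_iff)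
  next
    case False
    then obtain w ws where "zs = w # ws" by (cases zs) auto
    then show ?thesis using x z d unfolding ys saw_iff by (auto simp: successively_append_iff)
  qed
qed

lemma saw_cell:
  assumes a: "a \<in> sg_idx" and s: "saw (Hs a) x y xs"
  shows "saw (glue Hs) (sg_psi a x) (sg_psi a y) (map (sg_psi a) xs)"
proof -
  have "successively (\<lambda>u v. {sg_psi a u, sg_psi a v} \<in> glue Hs) xs"
    using s unfolding saw_def successively_conv_nth by (auto intro!: glue_edgeI[OF a])
  then show ?thesis
    using s inj_on_subset[OF inj_sg_psi]
    unfolding saw_iff by (auto simp: hd_map last_map distinct_map successively_map)
qed

lemma saw_mem_conn:
  assumes "saw F x y xs" "v \<in> set xs"
  shows "conn F x v"
proof -
  obtain as bs where eq: "xs = as @ v # bs" using assms(2) by (meson split_list)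
  show ?thesis using saw_conn[OF saw_prefix] assms(1) unfolding eq .
qed

text \<open>The offspring of a crossing from \<open>p\<close> to \<open>q\<close>, as triples of
  cell, entry corner and exit corner. The walk goes directly through the cells \<open>p\<close> and
  \<open>q\<close> if it can, and otherwise by way of the third cell, whose index is found from 1 +
  2 + 3 = 6.\<close>

definition off :: "(nat \<Rightarrow> nat) \<Rightarrow> nat \<Rightarrow> nat \<Rightarrow> (nat \<times> nat \<times> nat) list" where
  "off tt p q = (let k = 6 - p - q in
     if pc (tt p) p q \<and> pc (tt q) p q then [(p, p, q), (q, p, q)] else [(p, p, k), (k, p, q), (q, k, q)])"

text \<open>A valid crossing: forests of class \<open>t\<close> contain a walk between these
  distinct corners, which excludes class 4.\<close>

definition vcr :: "nat \<Rightarrow> nat \<Rightarrow> nat \<Rightarrow> bool" where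
  "vcr t p q \<longleftrightarrow> p \<in> sg_idx \<and> q \<in> sg_idx \<and> p \<noteq> q \<and> pc t p q"

lemma sg_idx_third:
  assumes "p \<in> sg_idx" "q \<in> sg_idx" "p \<noteq> q"
  shows "sg_idx = {p, q, 6 - p - q}" "p \<noteq> 6 - p - q" "q \<noteq> 6 - p - q"
  using assms unfolding sg_idx_def by auto

text \<open>A connection from \<open>p\<close> to \<open>q\<close> that is not direct must pass
  through the third cell; transitivity inside cell \<open>q\<close> removes the mixed
  routes.\<close>

lemma ok_glue_off:
  assumes ok: "ok_glue (\<lambda>a. pc (tt a)) t" and v: "vcr t p q"
    and k: "k = 6 - p - q"
    and no: "\<not> (pc (tt p) p q \<and> pc (tt q) p q)"
  shows "pc (tt p) p k \<and> pc (tt k) p q \<and> pc (tt q) k q"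
proof -
  have pq: "p \<in> sg_idx" "q \<in> sg_idx" "p \<noteq> q" "pc t p q" using v by (auto simp: vcr_def)
  have "(p, q, k) \<in> set corner_perms"
    unfolding corner_perms_idx k using sg_idx_third[OF pq(1-3)] pq(3) by blast
  then have r: "rout (\<lambda>a. pc (tt a)) p q k p" using ok pq(4) unfolding ok_glue_def by blast
  have tr: "pc s x y \<Longrightarrow> pc s y z \<Longrightarrow> pc s x z" and sy: "pc s x y \<Longrightarrow> pc s y x" for s x y z
    unfolding pc_def by auto
  show ?thesis
    using r no tr[of "tt q" k p q] sy[of "tt q" p k] sy[of "tt q" q k] tr[of "tt q" p k q] sy[of "tt q" k q]
    unfolding rout_def rin_def by argo
qed

lemma off_valid:
  assumes ok: "ok_glue (\<lambda>a. pc (tt a)) t" and v: "vcr t p q" and m: "(a, i, j) \<in> set (off tt p q)"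
  shows "a \<in> sg_idx" "vcr (tt a) i j"
proof -
  have pq: "p \<in> sg_idx" "q \<in> sg_idx" "p \<noteq> q" using v by (auto simp: vcr_def)
  have k: "6 - p - q \<in> sg_idx" "p \<noteq> 6 - p - q" "q \<noteq> 6 - p - q" using sg_idx_third[OF pq] by auto
  show "a \<in> sg_idx" "vcr (tt a) i j"
    using m ok_glue_off[OF ok v HOL.refl] pq k unfolding off_def Let_def vcr_def
    by (auto split: if_splits)
qed

text \<open>By uniqueness it is enough that the concatenated walks form a self-avoiding walk. Walks
  in different cells can meet only at the shared corner, where consecutive ones are joined.\<close>

lemma tpath_glue:
  assumes H: "\<forall>a\<in>sg_idx. Hs a \<in> Cls n (tt a)" and ok: "ok_glue (\<lambda>a. pc (tt a)) t" and v: "vcr t p q"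
  shows "tpath (glue Hs) (sg_u p) (sg_u q) =
    joinl (map (\<lambda>(a, i, j). map (sg_psi a) (tpath (Hs a) (sg_u i) (sg_u j))) (off tt p q))"
proof (rule tpath_eq)
  have "glue Hs \<in> Cls (Suc n) t" using glue_Cls_iff[OF H] ok by blast
  then show "acyclic_g (glue Hs)" by (simp add: Cls_def)
  define \<pi> where "\<pi> a i j = map (sg_psi a) (tpath (Hs a) (sg_u i) (sg_u j))" for a i j
  have pq: "p \<in> sg_idx" "q \<in> sg_idx" "p \<noteq> q" using v by (auto simp: vcr_def)
  define k where "k = 6 - p - q"
  have k: "k \<in> sg_idx" "p \<noteq> k" "q \<noteq> k" using sg_idx_third[OF pq] by (auto simp: k_def)
  have cl: "Hs a \<subseteq> sg_E n" "acyclic_g (Hs a)" "\<And>i j. i \<in> sg_idx \<Longrightarrow> j \<in> sg_idx \<Longrightarrow> conn (Hs a) (sg_u i) (sg_u j) \<longleftrightarrow> pc (tt a) i j"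
    if "a \<in> sg_idx" for a using H that unfolding Cls_def by auto
  have s0: "saw (Hs a) (sg_u i) (sg_u j) (tpath (Hs a) (sg_u i) (sg_u j))"
    if "a \<in> sg_idx" "i \<in> sg_idx" "j \<in> sg_idx" "pc (tt a) i j" for a i j
    using cl[OF that(1)] that by (intro saw_tpath) auto
  have s: "saw (glue Hs) (sg_psi a (sg_u i)) (sg_psi a (sg_u j)) (\<pi> a i j)"
    if "a \<in> sg_idx" "i \<in> sg_idx" "j \<in> sg_idx" "pc (tt a) i j" for a i j
    unfolding \<pi>_def by (rule saw_cell[of a Hs, OF that(1) s0[OF that]])
  have tri: "set (tpath (Hs a) (sg_u i) (sg_u j)) \<subseteq> sg_tri"
    if "a \<in> sg_idx" "i \<in> sg_idx" "j \<in> sg_idx" "pc (tt a) i j" for a i j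
    using saw_V[OF s0[OF that] cl(1)[OF that(1)] sg_u_V[OF that(2)]] sg_V_tri by blast
  have meet: "x = sg_psi a (sg_u b) \<and> conn (Hs a) (sg_u i) (sg_u b) \<and> conn (Hs b) (sg_u i') (sg_u a)"
    if x: "x \<in> set (\<pi> a i j)" "x \<in> set (\<pi> b i' j')" and ab: "a \<noteq> b"
      and i: "a \<in> sg_idx" "i \<in> sg_idx" "j \<in> sg_idx" "pc (tt a) i j"
      and i': "b \<in> sg_idx" "i' \<in> sg_idx" "j' \<in> sg_idx" "pc (tt b) i' j'" for x a i j b i' j'
  proof -
    obtain u where u: "u \<in> set (tpath (Hs a) (sg_u i) (sg_u j))" "x = sg_psi a u" using x(1) by (auto simp: \<pi>_def)
    obtain w where w: "w \<in> set (tpath (Hs b) (sg_u i') (sg_u j'))" "x = sg_psi b w" using x(2) by (auto simp: \<pi>_def)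
    have "u \<in> sg_tri" "w \<in> sg_tri" using u w tri[OF i] tri[OF i'] by auto
    then have uw: "u = sg_u b" "w = sg_u a" using sg_psi_meet[of u w a b] u w ab i(1) i'(1) by auto
    have "conn (Hs a) (sg_u i) u" "conn (Hs b) (sg_u i') w"
      using saw_mem_conn[OF s0[OF i] u(1)] saw_mem_conn[OF s0[OF i'] w(1)] by auto
    then show ?thesis using uw u by blast
  qed
  have hd_tl: "sg_psi a (sg_u i) \<notin> set (tl (\<pi> a i j))"
    if "a \<in> sg_idx" "i \<in> sg_idx" "j \<in> sg_idx" "pc (tt a) i j" for a i j
    using s[OF that] unfolding saw_iff by (cases "\<pi> a i j") auto
  have tlsub: "x \<in> set (tl ys) \<Longrightarrow> x \<in> set ys" for x :: complex and ys by (cases ys) auto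
  have neighbour: "set (\<pi> a i b) \<inter> set (tl (\<pi> b a j)) = {}"
    if ab: "a \<noteq> b" and i: "a \<in> sg_idx" "i \<in> sg_idx" "b \<in> sg_idx" "pc (tt a) i b"
      and i': "j \<in> sg_idx" "pc (tt b) a j" for a i b j
  proof (rule equals0I)
    fix x assume x: "x \<in> set (\<pi> a i b) \<inter> set (tl (\<pi> b a j))"
    then have x1: "x \<in> set (\<pi> a i b)" and x2: "x \<in> set (\<pi> b a j)" using tlsub by blast+
    have "x = sg_psi a (sg_u b)"
      using meet[OF x1 x2 ab i(1) i(2) i(3) i(4) i(3) i(1) i'(1) i'(2)] by blast
    then show False using x hd_tl[OF i(3,1) i'] by (simp add: sg_psi_u_commute)
  qed
  show "saw (glue Hs) (sg_u p) (sg_u q)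
     (joinl (map (\<lambda>(a, i, j). map (sg_psi a) (tpath (Hs a) (sg_u i) (sg_u j))) (off tt p q)))"
  proof (cases "pc (tt p) p q \<and> pc (tt q) p q")
    case True
    have "saw (glue Hs) (sg_u p) (sg_u q) (\<pi> p p q @ tl (\<pi> q p q))"
    proof (rule saw_join)
      show "saw (glue Hs) (sg_u p) (sg_psi p (sg_u q)) (\<pi> p p q)"
        using s[of p p q] pq True by (simp add: sg_psi_u)
      show "saw (glue Hs) (sg_psi p (sg_u q)) (sg_u q) (\<pi> q p q)"
        using s[of q p q] pq True by (simp add: sg_psi_u sg_psi_u_commute[of p q])
      show "set (\<pi> p p q) \<inter> set (tl (\<pi> q p q)) = {}"
        using neighbour[of p q p q] pq True by blast
    qed
    then show ?thesis using True by (simp add: off_def \<pi>_def)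
  next
    case False
    have pc: "pc (tt p) p k" "pc (tt k) p q" "pc (tt q) k q"
      using ok_glue_off[OF ok v k_def False] by auto
    have s1: "saw (glue Hs) (sg_u p) (sg_psi p (sg_u k)) (\<pi> p p k)"
      using s[of p p k] pq k pc by (simp add: sg_psi_u)
    have s2: "saw (glue Hs) (sg_psi p (sg_u k)) (sg_psi k (sg_u q)) (\<pi> k p q)"
      using s[of k p q] pq k pc by (simp add: sg_psi_u_commute[of p k])
    have s3: "saw (glue Hs) (sg_psi k (sg_u q)) (sg_u q) (\<pi> q k q)"
      using s[of q k q] pq k pc by (simp add: sg_psi_u sg_psi_u_commute[of k q])
    have s23: "saw (glue Hs) (sg_psi p (sg_u k)) (sg_u q) (\<pi> k p q @ tl (\<pi> q k q))"
      by (rule saw_join[OF s2 s3]) (use neighbour[of k q p q] pq k pc in blast)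
    \<comment> \<open>If the first and the last part met at the corner shared by \<open>p\<close>
      and \<open>q\<close>, both cells would offer the direct route.\<close>
    have "set (\<pi> p p k) \<inter> set (\<pi> q k q) = {}"
    proof (rule equals0I)
      fix x assume x: "x \<in> set (\<pi> p p k) \<inter> set (\<pi> q k q)"
      have "conn (Hs p) (sg_u p) (sg_u q) \<and> conn (Hs q) (sg_u k) (sg_u p)"
        using meet[of x p p k q k q] x pq k pc by blast
      then have "pc (tt p) p q" "pc (tt q) k p" using cl(3)[of p p q] cl(3)[of q k p] pq k by auto
      then show False using False pc(3) unfolding pc_def by auto
    qed
    moreover have "set (\<pi> p p k) \<inter> set (tl (\<pi> k p q)) = {}"
      using neighbour[of p k p q] pq k pc by blast
    moreover have "\<pi> k p q \<noteq> []" using s2 by (simp add: saw_iff)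
    then have "tl (\<pi> k p q @ tl (\<pi> q k q)) = tl (\<pi> k p q) @ tl (\<pi> q k q)" by simp
    ultimately have "set (\<pi> p p k) \<inter> set (tl (\<pi> k p q @ tl (\<pi> q k q))) = {}"
      using tlsub by fastforce
    note j = saw_join[OF s1 s23 this]
    have o: "off tt p q = [(p, p, k), (k, p, q), (q, k, q)]"
      unfolding off_def Let_def k_def[symmetric] by (rule if_not_P[OF False])
    show ?thesis using j unfolding o by (simp add: \<pi>_def)
  qed
qed

section \<open>Averages over walks\<close>

lemma sg_psiw_simps [simp]:
  "sg_psiw [] = id" "sg_psiw (i # w) = sg_psi i \<circ> sg_psiw w" "sg_psiw (v @ w) = sg_psiw v \<circ> sg_psiw w"
proof -
  show *: "sg_psiw [] = id" "\<And>i w. sg_psiw (i # w) = sg_psi i \<circ> sg_psiw w" by (simp_all add: sg_psiw_def)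
  show "sg_psiw (v @ w) = sg_psiw v \<circ> sg_psiw w"
    by (induction v) (simp_all add: * comp_assoc)
qed

text \<open>\<open>Ecr n t p q F\<close> is the mean of \<open>F\<close> over the walk from \<open>sg_u p\<close> to \<open>sg_u q\<close> in a uniform element of
  \<open>Cls n t\<close>. A crossing \<open>(w, t, p, q)\<close> stands for such a walk transported to the cell \<open>w\<close>, and
  \<open>Elist\<close> averages over independent walks through a list of crossings.\<close>

definition Ecr :: "nat \<Rightarrow> nat \<Rightarrow> nat \<Rightarrow> nat \<Rightarrow> (complex list \<Rightarrow> real) \<Rightarrow> real" where
  "Ecr n t p q F = (\<Sum>H\<in>Cls n t. F (tpath H (sg_u p) (sg_u q))) / cn n t"

primrec Elist :: "nat \<Rightarrow> (nat list \<times> nat \<times> nat \<times> nat) list \<Rightarrow> (complex list list \<Rightarrow> real) \<Rightarrow> real" where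
  "Elist n [] F = F []"
| "Elist n (c # cs) F = (case c of (w, t, p, q) \<Rightarrow>
     Ecr n t p q (\<lambda>\<pi>. Elist n cs (\<lambda>\<pi>s. F (map (sg_psiw w) \<pi> # \<pi>s))))"

text \<open>The walks that actually occur for a crossing; integrands under \<open>Elist\<close> need
  to be compared only on them.\<close>

definition cwalk :: "nat \<Rightarrow> nat list \<times> nat \<times> nat \<times> nat \<Rightarrow> complex list \<Rightarrow> bool" where
  "cwalk n c \<pi> \<longleftrightarrow> (case c of (w, t, p, q) \<Rightarrow>
     \<exists>H\<in>Cls n t. \<pi> = map (sg_psiw w) (tpath H (sg_u p) (sg_u q)))"

lemma cn_nonneg: "cn n t \<ge> 0"
  by (simp add: cn_def)

lemma Ecr_mono:
  "(\<And>H. H \<in> Cls n t \<Longrightarrow> F (tpath H (sg_u p) (sg_u q)) \<le> G (tpath H (sg_u p) (sg_u q))) \<Longrightarrow>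
    Ecr n t p q F \<le> Ecr n t p q G"
  unfolding Ecr_def by (intro divide_right_mono sum_mono cn_nonneg)

lemma Ecr_cmult: "Ecr n t p q (\<lambda>\<pi>. a * F \<pi>) = a * Ecr n t p q F"
  unfolding Ecr_def by (simp add: sum_distrib_left)

lemma Ecr_sum_list:
  "Ecr n t p q (\<lambda>\<pi>. \<Sum>x\<leftarrow>xs. F x \<pi>) = (\<Sum>x\<leftarrow>xs. Ecr n t p q (F x))"
  by (induction xs) (simp_all add: Ecr_def sum.distrib add_divide_distrib)

lemma Ecr_const: "t \<le> 4 \<Longrightarrow> Ecr n t p q (\<lambda>\<pi>. a) = a"
  using cn_pos[of t n] by (simp add: Ecr_def cn_def)

lemma Elist_mono:
  assumes "\<And>\<pi>s. list_all2 (cwalk n) cs \<pi>s \<Longrightarrow> F \<pi>s \<le> G \<pi>s"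
  shows "Elist n cs F \<le> Elist n cs G"
  using assms
proof (induction cs arbitrary: F G)
  case (Cons c cs)
  obtain w t p q where c: "c = (w, t, p, q)" by (metis prod.exhaust)
  have "Elist n cs (\<lambda>\<pi>s. F (map (sg_psiw w) (tpath H (sg_u p) (sg_u q)) # \<pi>s))
      \<le> Elist n cs (\<lambda>\<pi>s. G (map (sg_psiw w) (tpath H (sg_u p) (sg_u q)) # \<pi>s))" if "H \<in> Cls n t" for H
    using that by (intro Cons.IH Cons.prems) (auto simp: cwalk_def c)
  then show ?case by (simp add: c Ecr_mono)
qed simp

lemma Elist_cong:
  assumes "\<And>\<pi>s. list_all2 (cwalk n) cs \<pi>s \<Longrightarrow> F \<pi>s = G \<pi>s"
  shows "Elist n cs F = Elist n cs G"
  using assms by (intro antisym Elist_mono) auto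

lemma Elist_cmult: "Elist n cs (\<lambda>\<pi>s. a * F \<pi>s) = a * Elist n cs F"
  by (induction cs arbitrary: F) (simp_all add: Ecr_cmult split: prod.split)

lemma Elist_sum_list: "Elist n cs (\<lambda>\<pi>s. \<Sum>x\<leftarrow>xs. F x \<pi>s) = (\<Sum>x\<leftarrow>xs. Elist n cs (F x))"
proof (induction cs arbitrary: F)
  case (Cons c cs)
  obtain w t p q where c: "c = (w, t, p, q)" by (metis prod.exhaust)
  show ?case by (simp add: c Cons.IH Ecr_sum_list)
qed simp

lemma Elist_append: "Elist n (cs @ ds) F = Elist n cs (\<lambda>\<pi>s. Elist n ds (\<lambda>\<rho>s. F (\<pi>s @ \<rho>s)))"
  by (induction cs arbitrary: F) (simp_all split: prod.split)

lemma Elist_shift: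
  "Elist n (map (\<lambda>(v, t, p, q). (w @ v, t, p, q)) cs) F = Elist n cs (\<lambda>\<pi>s. F (map (map (sg_psiw w)) \<pi>s))"
  by (induction cs arbitrary: F) (simp_all split: prod.split)

definition offc :: "nat list \<Rightarrow> nat \<times> nat \<times> nat \<Rightarrow> nat \<Rightarrow> nat \<Rightarrow> (nat list \<times> nat \<times> nat \<times> nat) list" where
  "offc w tr p q = (case tr of (x, y, z) \<Rightarrow>
     map (\<lambda>(a, i, j). (w @ [a], tri x y z a, i, j)) (off (tri x y z) p q))"

lemma offc_shift: "offc w tr p q = map (\<lambda>(v, t, p, q). (w @ v, t, p, q)) (offc [] tr p q)"
  by (simp add: offc_def split_def o_def)

lemma joinl_eq: "\<forall>\<pi>\<in>set \<pi>s. \<pi> \<noteq> [] \<Longrightarrow> joinl (\<pi> # \<pi>s) = \<pi> @ concat (map tl \<pi>s)"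
proof (induction \<pi>s arbitrary: \<pi>)
  case (Cons \<rho> \<pi>s)
  then show ?case by simp
qed simp

text \<open>A walk inside a chain may be replaced by its own subdivision. This lets crossings be
  refined one at a time.\<close>

lemma joinl_insert:
  assumes "\<forall>\<pi>\<in>set (\<sigma>s @ \<pi>s @ \<rho>s). \<pi> \<noteq> []" "\<pi>s \<noteq> []"
  shows "joinl (\<sigma>s @ joinl \<pi>s # \<rho>s) = joinl (\<sigma>s @ \<pi>s @ \<rho>s)"
proof -
  obtain \<pi> \<pi>s' where p: "\<pi>s = \<pi> # \<pi>s'" using assms(2) by (cases \<pi>s) auto
  have j: "joinl \<pi>s = \<pi> @ concat (map tl \<pi>s')" using assms(1) by (simp add: p joinl_eq)
  have ne: "\<pi> \<noteq> []" using assms(1) p by simp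
  show ?thesis
  proof (cases \<sigma>s)
    case Nil
    then show ?thesis using assms(1) j by (simp add: p joinl_eq)
  next
    case (Cons \<sigma> \<sigma>s')
    have 1: "joinl (\<sigma> # \<sigma>s' @ joinl \<pi>s # \<rho>s) = \<sigma> @ concat (map tl (\<sigma>s' @ joinl \<pi>s # \<rho>s))"
      by (rule joinl_eq) (use assms(1) Cons j ne in auto)
    have 2: "joinl (\<sigma> # \<sigma>s' @ \<pi>s @ \<rho>s) = \<sigma> @ concat (map tl (\<sigma>s' @ \<pi>s @ \<rho>s))"
      by (rule joinl_eq) (use assms(1) Cons in auto)
    show ?thesis using 1 2 ne unfolding j by (simp add: Cons p)
  qed
qed

lemma map_joinl: "\<forall>\<pi>\<in>set \<pi>s. \<pi> \<noteq> [] \<Longrightarrow> map f (joinl \<pi>s) = joinl (map (map f) \<pi>s)"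
proof (cases \<pi>s)
  case (Cons \<pi> \<pi>s')
  assume h: "\<forall>\<pi>\<in>set \<pi>s. \<pi> \<noteq> []"
  have "map f (joinl \<pi>s) = map f \<pi> @ concat (map (map f) (map tl \<pi>s'))"
    using h by (simp add: Cons joinl_eq map_concat)
  also have "map (map f) (map tl \<pi>s') = map tl (map (map f) \<pi>s')" by (simp add: map_tl)
  also have "map f \<pi> @ concat (map tl (map (map f) \<pi>s')) = joinl (map (map f) \<pi>s)"
    unfolding Cons list.map by (rule joinl_eq[symmetric]) (use h Cons in auto)
  finally show ?thesis .
qed simp

lemma vcr_le: "vcr t p q \<Longrightarrow> t \<le> 3"
  by (auto simp: vcr_def pc_def)

lemma tpath_saw:
  assumes "H \<in> Cls n t" "vcr t p q"
  shows "saw H (sg_u p) (sg_u q) (tpath H (sg_u p) (sg_u q))"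
  using assms by (intro saw_tpath) (auto simp: Cls_def vcr_def)

definition vc :: "nat \<Rightarrow> nat list \<times> nat \<times> nat \<times> nat \<Rightarrow> bool" where
  "vc k c \<longleftrightarrow> (case c of (w, t, p, q) \<Rightarrow> w \<in> sg_words k \<and> vcr t p q)"

lemma Elist_const: "\<forall>c\<in>set cs. vc k c \<Longrightarrow> Elist n cs (\<lambda>_. a) = a"
proof (induction cs)
  case (Cons d cs)
  obtain w t p q where d: "d = (w, t, p, q)" by (metis prod.exhaust)
  have "t \<le> 4" using Cons.prems vcr_le[of t p q] by (simp add: d vc_def)
  then show ?case using Cons by (simp add: d Ecr_const)
qed simp

lemma cwalk_nonempty:
  assumes "list_all2 (cwalk n) cs \<pi>s" "\<forall>c\<in>set cs. vc k c"
  shows "\<forall>\<pi>\<in>set \<pi>s. \<pi> \<noteq> []"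
  using assms
proof (induction rule: list_all2_induct)
  case (Cons c cs \<pi> \<pi>s)
  obtain w t p q where c: "c = (w, t, p, q)" by (metis prod.exhaust)
  have "\<pi> \<noteq> []" using Cons.hyps(1) Cons.prems tpath_saw[of _ n t p q]
    unfolding cwalk_def c by (auto simp: saw_iff vc_def)
  then show ?case using Cons by auto
qed simp

lemma offc_vc:
  assumes "tr \<in> set (goods t)" "vcr t p q" "w \<in> sg_words k"
  shows "\<forall>c\<in>set (offc w tr p q). vc (Suc k) c"
proof -
  obtain x y z where tr: "tr = (x, y, z)" by (metis prod.exhaust)
  have ok: "ok_glue (\<lambda>a. pc (tri x y z a)) t" using assms(1) by (simp add: tr goods_iff)
  show ?thesis
    using off_valid[OF ok assms(2)] assms(3) by (auto simp: offc_def tr vc_def sg_words_def)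
qed

text \<open>The decomposition sums over pieces in the order 1, 2, 3 of the cells, while a walk
  visits the cells in the order \<open>a\<close>, \<open>b\<close>, \<open>c\<close>.\<close>

lemma sum_tri:
  fixes g :: "complex set set \<Rightarrow> complex set set \<Rightarrow> complex set set \<Rightarrow> real"
  assumes "(a, b, c) \<in> set corner_perms"
  shows "(\<Sum>A\<in>Cls n x. \<Sum>B\<in>Cls n y. \<Sum>C\<in>Cls n z. g (tri A B C a) (tri A B C b) (tri A B C c)) =
    (\<Sum>A\<in>Cls n (tri x y z a). \<Sum>B\<in>Cls n (tri x y z b). \<Sum>C\<in>Cls n (tri x y z c). g A B C)"
proof -
  have s12: "(\<Sum>A\<in>P. \<Sum>B\<in>Q. \<Sum>C\<in>R. f A B C) = (\<Sum>B\<in>Q. \<Sum>A\<in>P. \<Sum>C\<in>R. f A B C)"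
    and s23: "(\<Sum>A\<in>P. \<Sum>B\<in>Q. \<Sum>C\<in>R. f A B C) = (\<Sum>A\<in>P. \<Sum>C\<in>R. \<Sum>B\<in>Q. f A B C)"
    for P Q R :: "complex set set set" and f :: "complex set set \<Rightarrow> complex set set \<Rightarrow> complex set set \<Rightarrow> real"
    by (rule sum.swap) (intro sum.cong HOL.refl sum.swap)
  consider "(a, b, c) = (1, 2, 3)" | "(a, b, c) = (1, 3, 2)" | "(a, b, c) = (2, 1, 3)"
    | "(a, b, c) = (2, 3, 1)" | "(a, b, c) = (3, 1, 2)" | "(a, b, c) = (3, 2, 1)"
    using assms unfolding corner_perms_def by auto
  then show ?thesis
  proof cases
    case 1 then show ?thesis by simp
  next
    case 2 then show ?thesis by simp (rule s23)
  next
    case 3 then show ?thesis by simp (rule s12)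
  next
    case 4 then show ?thesis by simp (rule trans[OF s12 s23])
  next
    case 5 then show ?thesis by simp (rule trans[OF s23 s12])
  next
    case 6 then show ?thesis by simp (rule trans[OF trans[OF s12 s23] s12])
  qed
qed

text \<open>The branching property: given the triple of classes, the pieces are independent and
  uniform in their classes, and the triple has probabilities \<open>wt\<close> that do not involve
  \<open>n\<close>.\<close>

lemma Ecr_Suc:
  assumes v: "vcr t p q"
  shows "Ecr (Suc n) t p q F = (\<Sum>tr\<leftarrow>goods t. wt t tr * Elist n (offc [] tr p q) (\<lambda>\<pi>s. F (joinl \<pi>s)))"
proof -
  have cS: "cn (Suc n) t > 0" using vcr_le[OF v] by (intro cn_pos) simp
  define k where "k = 6 - p - q"
  have pq: "p \<in> sg_idx" "q \<in> sg_idx" "p \<noteq> q" using v by (auto simp: vcr_def)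
  have perm: "(p, q, k) \<in> set corner_perms"
    unfolding corner_perms_idx k_def using sg_idx_third[OF pq] pq(3) by blast
  have perm': "(p, k, q) \<in> set corner_perms"
    using perm unfolding corner_perms_idx by (auto simp: insert_commute)
  define W where "W X a i j = map (sg_psi a) (tpath X (sg_u i) (sg_u j))" for X a i j
  have key: "(\<Sum>A\<in>Cls n x. \<Sum>B\<in>Cls n y. \<Sum>C\<in>Cls n z. F (tpath (glue (tri A B C)) (sg_u p) (sg_u q))) =
      wt t (x, y, z) * cn (Suc n) t * Elist n (offc [] (x, y, z) p q) (\<lambda>\<pi>s. F (joinl \<pi>s))"
    if g: "(x, y, z) \<in> set (goods t)" for x y z
  proof -
    let ?t = "tri x y z"
    have ok: "ok_glue (\<lambda>a. pc (?t a)) t" and le: "x \<le> 4" "y \<le> 4" "z \<le> 4" using g by (auto simp: goods_iff)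
    have pos: "cn n (?t a) > 0" for a using le by (simp add: tri_def cn_pos)
    have cprod: "cn n x * cn n y * cn n z = cn n (?t a) * cn n (?t b) * cn n (?t c)"
      if "(a, b, c) \<in> set corner_perms" for a b c
      using that unfolding corner_perms_def by (auto simp: tri_def)
    have tp: "tpath (glue (tri A B C)) (sg_u p) (sg_u q) = joinl (map (\<lambda>(a, i, j). W (tri A B C a) a i j) (off ?t p q))"
      if "A \<in> Cls n x" "B \<in> Cls n y" "C \<in> Cls n z" for A B C
    proof -
      have "\<forall>a\<in>sg_idx. tri A B C a \<in> Cls n (?t a)" using that unfolding sg_idx_ball by simp
      from tpath_glue[OF this ok v] show ?thesis unfolding W_def .
    qed
    have "(\<Sum>A\<in>Cls n x. \<Sum>B\<in>Cls n y. \<Sum>C\<in>Cls n z. F (tpath (glue (tri A B C)) (sg_u p) (sg_u q))) =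
       (\<Sum>A\<in>Cls n x. \<Sum>B\<in>Cls n y. \<Sum>C\<in>Cls n z. F (joinl (map (\<lambda>(a, i, j). W (tri A B C a) a i j) (off ?t p q))))"
      by (intro sum.cong HOL.refl) (simp add: tp)
    also have "\<dots> = cn n x * cn n y * cn n z * Elist n (offc [] (x, y, z) p q) (\<lambda>\<pi>s. F (joinl \<pi>s))"
    proof (cases "pc (?t p) p q \<and> pc (?t q) p q")
      case True
      then have o: "off ?t p q = [(p, p, q), (q, p, q)]" by (simp add: off_def)
      have "(\<Sum>A\<in>Cls n x. \<Sum>B\<in>Cls n y. \<Sum>C\<in>Cls n z. F (joinl (map (\<lambda>(a, i, j). W (tri A B C a) a i j) (off ?t p q))))
        = (\<Sum>A\<in>Cls n (?t p). \<Sum>B\<in>Cls n (?t q). \<Sum>C\<in>Cls n (?t k). F (joinl [W A p p q, W B q p q]))"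
        unfolding o using sum_tri[OF perm, where g = "\<lambda>A B C. F (joinl [W A p p q, W B q p q])"] by simp
      \<comment> \<open>The cell that the walk does not visit contributes only its number of
        forests.\<close>
      also have "\<dots> = cn n (?t k) * (\<Sum>A\<in>Cls n (?t p). \<Sum>B\<in>Cls n (?t q). F (joinl [W A p p q, W B q p q]))"
        by (simp add: cn_def sum_distrib_left)
      also have "\<dots> = cn n (?t p) * cn n (?t q) * cn n (?t k) * Elist n (offc [] (x, y, z) p q) (\<lambda>\<pi>s. F (joinl \<pi>s))"
        unfolding offc_def using pos[of p] pos[of q]
        by (simp add: o Ecr_def W_def sum_divide_distrib[symmetric])
      finally show ?thesis unfolding cprod[OF perm] .
    next
      case False
      have o: "off ?t p q = [(p, p, k), (k, p, q), (q, k, q)]"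
        unfolding off_def Let_def k_def[symmetric] by (rule if_not_P[OF False])
      have "(\<Sum>A\<in>Cls n x. \<Sum>B\<in>Cls n y. \<Sum>C\<in>Cls n z. F (joinl (map (\<lambda>(a, i, j). W (tri A B C a) a i j) (off ?t p q))))
        = (\<Sum>A\<in>Cls n (?t p). \<Sum>B\<in>Cls n (?t k). \<Sum>C\<in>Cls n (?t q). F (joinl [W A p p k, W B k p q, W C q k q]))"
        unfolding o using sum_tri[OF perm', where g = "\<lambda>A B C. F (joinl [W A p p k, W B k p q, W C q k q])"] by simp
      also have "\<dots> = cn n (?t p) * cn n (?t k) * cn n (?t q) * Elist n (offc [] (x, y, z) p q) (\<lambda>\<pi>s. F (joinl \<pi>s))"
        unfolding offc_def using pos[of p] pos[of q] pos[of k]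
        by (simp add: o Ecr_def W_def sum_divide_distrib[symmetric])
      finally show ?thesis unfolding cprod[OF perm'] .
    qed
    also have "cn n x * cn n y * cn n z = wt t (x, y, z) * cn (Suc n) t"
      using wt_cn[OF vcr_le[OF v] g] .
    finally show ?thesis .
  qed
  have "Ecr (Suc n) t p q F * cn (Suc n) t = (\<Sum>H\<in>Cls (Suc n) t. F (tpath H (sg_u p) (sg_u q)))"
    using cS by (simp add: Ecr_def)
  also have "\<dots> = (\<Sum>tr\<leftarrow>goods t. (wt t tr * Elist n (offc [] tr p q) (\<lambda>\<pi>s. F (joinl \<pi>s))) * cn (Suc n) t)"
    unfolding sum_Cls_Suc by (intro arg_cong[where f = sum_list] map_cong HOL.refl) (auto simp: key)
  also have "\<dots> = (\<Sum>tr\<leftarrow>goods t. wt t tr * Elist n (offc [] tr p q) (\<lambda>\<pi>s. F (joinl \<pi>s))) * cn (Suc n) t"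
    by (rule sum_list_mult_const)
  finally show ?thesis using cS by simp
qed

lemma Ecr_Suc_word:
  assumes v: "vcr t p q"
  shows "Ecr (Suc n) t p q (\<lambda>\<pi>. F (map (sg_psiw w) \<pi>)) =
    (\<Sum>tr\<leftarrow>goods t. wt t tr * Elist n (offc w tr p q) (\<lambda>\<pi>s. F (joinl \<pi>s)))"
proof -
  have "Elist n (offc [] tr p q) (\<lambda>\<pi>s. F (map (sg_psiw w) (joinl \<pi>s))) = Elist n (offc w tr p q) (\<lambda>\<pi>s. F (joinl \<pi>s))"
    if "tr \<in> set (goods t)" for tr
  proof -
    have "\<forall>c\<in>set (offc [] tr p q). vc (Suc 0) c" using offc_vc[OF that v, of "[]" 0] by (simp add: sg_words_def)
    then show ?thesis
      unfolding offc_shift[of w] Elist_shift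
      by (intro Elist_cong) (simp add: map_joinl cwalk_nonempty)
  qed
  then show ?thesis
    unfolding Ecr_Suc[OF v] by (intro arg_cong[where f = sum_list] map_cong HOL.refl) simp
qed

lemma wt_sum: "t \<le> 3 \<Longrightarrow> (\<Sum>tr\<leftarrow>goods t. wt t tr) = 1"
proof -
  assume "t \<le> 3"
  then have "t = 0 \<or> t = 1 \<or> t = 2 \<or> t = 3" by linarith
  then show ?thesis by (elim disjE) (simp_all only: goods_0 goods_1 goods_2 goods_3, simp_all add: wt_def)
qed

lemma wt_average_le:
  assumes "t \<le> 3" "\<And>tr. tr \<in> set (goods t) \<Longrightarrow> f tr \<le> b"
  shows "(\<Sum>tr\<leftarrow>goods t. wt t tr * f tr) \<le> b"
proof -
  have "(\<Sum>tr\<leftarrow>goods t. wt t tr * f tr) \<le> (\<Sum>tr\<leftarrow>goods t. wt t tr * b)"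
    by (intro sum_list_mono mult_left_mono assms wt_nonneg)
  also have "\<dots> = b" using wt_sum[OF assms(1)] by (simp add: sum_list_mult_const)
  finally show ?thesis .
qed

section \<open>Refining a chain of crossings\<close>

definition cstart :: "nat list \<times> nat \<times> nat \<times> nat \<Rightarrow> complex" where
  "cstart c = (case c of (w, t, p, q) \<Rightarrow> sg_psiw w (sg_u p))"

definition cend :: "nat list \<times> nat \<times> nat \<times> nat \<Rightarrow> complex" where
  "cend c = (case c of (w, t, p, q) \<Rightarrow> sg_psiw w (sg_u q))"

definition vchain :: "nat \<Rightarrow> (nat list \<times> nat \<times> nat \<times> nat) list \<Rightarrow> bool" where
  "vchain k cs \<longleftrightarrow> (\<forall>c\<in>set cs. vc k c) \<and> successively (\<lambda>c d. cend c = cstart d) cs"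

lemma offc_chain:
  assumes "tr \<in> set (goods t)" "vcr t p q" "w \<in> sg_words k"
  shows "vchain (Suc k) (offc w tr p q)" "offc w tr p q \<noteq> []"
    "cstart (hd (offc w tr p q)) = sg_psiw w (sg_u p)" "cend (last (offc w tr p q)) = sg_psiw w (sg_u q)"
proof -
  obtain x y z where tr: "tr = (x, y, z)" by (metis prod.exhaust)
  show "vchain (Suc k) (offc w tr p q)"
    using offc_vc[OF assms] sg_psi_u_commute unfolding vchain_def
    by (simp add: offc_def tr off_def Let_def cend_def cstart_def)
  show "offc w tr p q \<noteq> []"
    "cstart (hd (offc w tr p q)) = sg_psiw w (sg_u p)" "cend (last (offc w tr p q)) = sg_psiw w (sg_u q)"
    by (simp_all add: offc_def tr off_def Let_def cend_def cstart_def sg_psi_u)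
qed

text \<open>Crossings are replaced by their offspring from left to right: \<open>ds\<close> is the
  part already at the finer level, \<open>cs\<close> the part still to be split. Each split is an
  average over offspring, so a bound for all fine chains carries over.\<close>

lemma Elist_refine:
  assumes base: "\<And>ds. vchain (Suc k) ds \<Longrightarrow> ds \<noteq> [] \<Longrightarrow> Elist n ds (\<lambda>\<sigma>s. F (joinl \<sigma>s)) \<le> b"
  shows "vchain (Suc k) ds \<Longrightarrow> vchain k cs \<Longrightarrow> ds \<noteq> [] \<or> cs \<noteq> [] \<Longrightarrow>
     (ds \<noteq> [] \<Longrightarrow> cs \<noteq> [] \<Longrightarrow> cend (last ds) = cstart (hd cs)) \<Longrightarrow>
     Elist n ds (\<lambda>\<sigma>s. Elist (Suc n) cs (\<lambda>\<rho>s. F (joinl (\<sigma>s @ \<rho>s)))) \<le> b"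
proof (induction cs arbitrary: ds)
  case Nil
  then show ?case using base by simp
next
  case (Cons c cs)
  obtain w t p q where c: "c = (w, t, p, q)" by (metis prod.exhaust)
  have w: "w \<in> sg_words k" and v: "vcr t p q" and cs: "\<forall>c\<in>set cs. vc k c"
    using Cons.prems(2) by (auto simp: vchain_def vc_def c)
  have "Elist n ds (\<lambda>\<sigma>s. Elist (Suc n) (c # cs) (\<lambda>\<rho>s. F (joinl (\<sigma>s @ \<rho>s)))) =
     Elist n ds (\<lambda>\<sigma>s. \<Sum>tr\<leftarrow>goods t. wt t tr * Elist n (offc w tr p q) (\<lambda>\<pi>s.
        Elist (Suc n) cs (\<lambda>\<rho>s. F (joinl (\<sigma>s @ joinl \<pi>s # \<rho>s)))))"
    using Ecr_Suc_word[OF v, where F = "\<lambda>\<pi>. Elist (Suc n) cs (\<lambda>\<rho>s. F (joinl (_ @ \<pi> # \<rho>s)))"]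
    by (simp add: c)
  also have "\<dots> = (\<Sum>tr\<leftarrow>goods t. wt t tr * Elist n ds (\<lambda>\<sigma>s. Elist n (offc w tr p q) (\<lambda>\<pi>s.
        Elist (Suc n) cs (\<lambda>\<rho>s. F (joinl (\<sigma>s @ joinl \<pi>s # \<rho>s))))))"
    by (simp add: Elist_sum_list Elist_cmult)
  also have "\<dots> \<le> b"
  proof (rule wt_average_le[OF vcr_le[OF v]])
    fix tr assume tr: "tr \<in> set (goods t)"
    note oc = offc_chain[OF tr v w]
    have "Elist n ds (\<lambda>\<sigma>s. Elist n (offc w tr p q) (\<lambda>\<pi>s.
        Elist (Suc n) cs (\<lambda>\<rho>s. F (joinl (\<sigma>s @ joinl \<pi>s # \<rho>s))))) =
      Elist n ds (\<lambda>\<sigma>s. Elist n (offc w tr p q) (\<lambda>\<pi>s.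
        Elist (Suc n) cs (\<lambda>\<rho>s. F (joinl ((\<sigma>s @ \<pi>s) @ \<rho>s)))))"
    proof (intro Elist_cong)
      fix \<sigma>s \<pi>s \<rho>s
      assume h: "list_all2 (cwalk n) ds \<sigma>s" "list_all2 (cwalk n) (offc w tr p q) \<pi>s"
        "list_all2 (cwalk (Suc n)) cs \<rho>s"
      have "\<forall>\<pi>\<in>set (\<sigma>s @ \<pi>s @ \<rho>s). \<pi> \<noteq> []"
        using cwalk_nonempty[OF h(1), of "Suc k"] cwalk_nonempty[OF h(2), of "Suc k"] cwalk_nonempty[OF h(3) cs]
          Cons.prems(1) oc(1) by (auto simp: vchain_def)
      moreover have "\<pi>s \<noteq> []" using h(2) oc(2) by auto
      ultimately have "joinl (\<sigma>s @ joinl \<pi>s # \<rho>s) = joinl (\<sigma>s @ \<pi>s @ \<rho>s)" by (rule joinl_insert)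
      then show "F (joinl (\<sigma>s @ joinl \<pi>s # \<rho>s)) = F (joinl ((\<sigma>s @ \<pi>s) @ \<rho>s))" by simp
    qed
    also have "\<dots> = Elist n (ds @ offc w tr p q) (\<lambda>\<sigma>s. Elist (Suc n) cs (\<lambda>\<rho>s. F (joinl (\<sigma>s @ \<rho>s))))"
      by (simp add: Elist_append)
    also have "\<dots> \<le> b"
    proof (rule Cons.IH)
      show "vchain (Suc k) (ds @ offc w tr p q)"
        using Cons.prems(1,4) oc unfolding vchain_def c
        by (auto simp: successively_append_iff cstart_def)
      show "vchain k cs" using Cons.prems(2) by (auto simp: vchain_def successively_Cons)
      show "ds @ offc w tr p q \<noteq> [] \<or> cs \<noteq> []" using oc(2) by simp
      show "cend (last (ds @ offc w tr p q)) = cstart (hd cs)" if "cs \<noteq> []"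
        using that Cons.prems(2) oc(2,4) by (auto simp: vchain_def successively_Cons c cend_def)
    qed
    finally show "Elist n ds (\<lambda>\<sigma>s. Elist n (offc w tr p q) (\<lambda>\<pi>s.
        Elist (Suc n) cs (\<lambda>\<rho>s. F (joinl (\<sigma>s @ joinl \<pi>s # \<rho>s))))) \<le> b" .
  qed
  finally show ?case .
qed

lemma Elist_refine_iter:
  assumes "\<And>ds. vchain (k + m) ds \<Longrightarrow> ds \<noteq> [] \<Longrightarrow> Elist n ds (\<lambda>\<sigma>s. F (joinl \<sigma>s)) \<le> b"
    and "vchain k cs" "cs \<noteq> []"
  shows "Elist (n + m) cs (\<lambda>\<sigma>s. F (joinl \<sigma>s)) \<le> b"
  using assms
proof (induction m arbitrary: k cs)
  case (Suc m)
  have "Elist (n + m) ds (\<lambda>\<sigma>s. F (joinl \<sigma>s)) \<le> b" if "vchain (Suc k) ds" "ds \<noteq> []" for ds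
    using Suc.IH[of "Suc k" ds] Suc.prems(1) that by simp
  from Elist_refine[where k = k and n = "n + m" and F = F and b = b and ds = "[]" and cs = cs, OF this]
  have "vchain (Suc k) [] \<Longrightarrow> Elist (Suc (n + m)) cs (\<lambda>\<rho>s. F (joinl \<rho>s)) \<le> b"
    using Suc.prems(2,3) by simp
  then show ?case by (simp add: vchain_def)
qed simp

text \<open>The whole walk is a chain of one crossing, of the empty word. Estimates for it thereby
  reduce to chains of independent crossings of cells of level \<open>m\<close>.\<close>

lemma Ecr_refine:
  assumes "\<And>ds. vchain m ds \<Longrightarrow> ds \<noteq> [] \<Longrightarrow> Elist n ds (\<lambda>\<sigma>s. F (joinl \<sigma>s)) \<le> b"
    and v: "vcr t p q"
  shows "Ecr (n + m) t p q F \<le> b"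
  using Elist_refine_iter[of 0 m n F b "[([], t, p, q)]"] assms
  by (simp add: vchain_def vc_def sg_words_def)

section \<open>Exponential moments of the number of steps\<close>

definition steps :: "'b list \<Rightarrow> nat" where
  "steps \<pi> = length \<pi> - 1"

lemma steps_map [simp]: "steps (map f \<pi>) = steps \<pi>"
  by (simp add: steps_def)

lemma steps_joinl: "\<forall>\<pi>\<in>set \<pi>s. \<pi> \<noteq> [] \<Longrightarrow> steps (joinl \<pi>s) = sum_list (map steps \<pi>s)"
proof (cases \<pi>s)
  case (Cons \<pi> \<pi>s')
  assume h: "\<forall>\<pi>\<in>set \<pi>s. \<pi> \<noteq> []"
  have "length (concat (map tl \<pi>s')) = sum_list (map steps \<pi>s')"
    by (induction \<pi>s') (simp_all add: steps_def)
  moreover have "length \<pi> \<ge> 1" using h by (cases \<pi>) (auto simp: Cons)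
  ultimately show ?thesis using h by (simp add: Cons joinl_eq steps_def)
qed (simp add: steps_def)

definition Mg :: "nat \<Rightarrow> nat \<Rightarrow> nat \<Rightarrow> nat \<Rightarrow> real \<Rightarrow> real" where
  "Mg n t p q y = Ecr n t p q (\<lambda>\<pi>. exp (y * real (steps \<pi>)))"

lemma Mg_nonneg: "Mg n t p q y \<ge> 0"
  unfolding Mg_def Ecr_def by (intro divide_nonneg_nonneg sum_nonneg cn_nonneg) simp

lemma Elist_exp:
  "Elist n cs (\<lambda>\<pi>s. exp (y * real (sum_list (map steps \<pi>s)))) = (\<Prod>(w, t, p, q)\<leftarrow>cs. Mg n t p q y)"
proof (induction cs)
  case (Cons c cs)
  obtain w t p q where c: "c = (w, t, p, q)" by (metis prod.exhaust)
  have "Elist n (c # cs) (\<lambda>\<pi>s. exp (y * real (sum_list (map steps \<pi>s)))) =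
     Ecr n t p q (\<lambda>\<pi>. exp (y * real (steps \<pi>)) * Elist n cs (\<lambda>\<pi>s. exp (y * real (sum_list (map steps \<pi>s)))))"
    by (simp add: c distrib_left exp_add Elist_cmult)
  also have "\<dots> = Mg n t p q y * Elist n cs (\<lambda>\<pi>s. exp (y * real (sum_list (map steps \<pi>s))))"
    using Ecr_cmult[of n t p q "Elist n cs (\<lambda>\<pi>s. exp (y * real (sum_list (map steps \<pi>s))))"]
    by (simp add: Mg_def mult.commute)
  finally show ?case by (simp add: c Cons.IH)
qed simp

lemma Mg_Suc:
  assumes v: "vcr t p q"
  shows "Mg (Suc n) t p q y = (\<Sum>tr\<leftarrow>goods t. wt t tr * (\<Prod>(w, s, i, j)\<leftarrow>offc [] tr p q. Mg n s i j y))"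
proof -
  have "Elist n (offc [] tr p q) (\<lambda>\<pi>s. exp (y * real (steps (joinl \<pi>s)))) = (\<Prod>(w, s, i, j)\<leftarrow>offc [] tr p q. Mg n s i j y)"
    if "tr \<in> set (goods t)" for tr
  proof -
    have "\<forall>c\<in>set (offc [] tr p q). vc (Suc 0) c" using offc_vc[OF that v, of "[]" 0] by (simp add: sg_words_def)
    then show ?thesis
      unfolding Elist_exp[symmetric] by (intro Elist_cong) (simp add: steps_joinl cwalk_nonempty)
  qed
  then show ?thesis
    unfolding Mg_def[of "Suc n"] Ecr_Suc[OF v] by (intro arg_cong[where f = sum_list] map_cong HOL.refl) simp
qed

lemma offc_length: "length (offc w tr p q) = 2 \<or> length (offc w tr p q) = 3"
  by (simp add: offc_def off_def Let_def split: prod.split)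

lemma prod_list_le_power:
  fixes f :: "'b \<Rightarrow> real"
  assumes "\<forall>x\<in>set xs. 0 \<le> f x \<and> f x \<le> b" "0 \<le> b"
  shows "prod_list (map f xs) \<le> b ^ length xs"
  using assms
proof (induction xs)
  case (Cons x xs)
  have "0 \<le> prod_list (map f xs)" using Cons.prems(1) by (induction xs) auto
  then show ?case using Cons by (simp add: mult_mono)
qed simp

lemma Mg_Suc_le:
  assumes v: "vcr t p q" and b: "\<And>s i j. vcr s i j \<Longrightarrow> Mg n s i j y \<le> b" and "0 \<le> b" "b ^ 2 \<le> d" "b ^ 3 \<le> d"
  shows "Mg (Suc n) t p q y \<le> d"
  unfolding Mg_Suc[OF v]
proof (rule wt_average_le[OF vcr_le[OF v]])
  fix tr assume tr: "tr \<in> set (goods t)"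
  have vc: "\<forall>c\<in>set (offc [] tr p q). vc (Suc 0) c" using offc_vc[OF tr v, of "[]" 0] by (simp add: sg_words_def)
  have "prod_list (map (\<lambda>(w, s, i, j). Mg n s i j y) (offc [] tr p q)) \<le> b ^ length (offc [] tr p q)"
    by (rule prod_list_le_power) (use vc b assms(3) in \<open>auto simp: vc_def Mg_nonneg\<close>)
  also have "\<dots> \<le> d" using offc_length[of "[]" tr p q] assms(4,5) by auto
  finally show "prod_list (map (\<lambda>(w, s, i, j). Mg n s i j y) (offc [] tr p q)) \<le> d" .
qed

text \<open>A crossing has at least two offspring, and for a bound of at most 1 a third factor can
  only help; the exponent doubles in each generation.\<close>

lemma Mg_contract:
  assumes b: "\<And>s i j. vcr s i j \<Longrightarrow> Mg n s i j y \<le> b" "0 \<le> b" "b \<le> 1"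
  shows "vcr t p q \<Longrightarrow> Mg (n + m) t p q y \<le> b ^ (2 ^ m)"
proof (induction m arbitrary: t p q)
  case (Suc m)
  let ?b = "b ^ (2 ^ m)"
  have 01: "0 \<le> ?b" "?b \<le> 1" using b by (auto intro: power_le_one)
  have "Mg (Suc (n + m)) t p q y \<le> ?b ^ 2"
    by (rule Mg_Suc_le[OF Suc.prems Suc.IH]) (use 01 in \<open>auto intro: power_decreasing\<close>)
  also have "?b ^ 2 = b ^ (2 ^ Suc m)" by (simp add: power_mult[symmetric] mult.commute)
  finally show ?case by simp
qed (use b in simp)

text \<open>For a bound of at least 1 the worst case is three offspring.\<close>

lemma Mg_expand:
  assumes b: "\<And>s i j. vcr s i j \<Longrightarrow> Mg n s i j y \<le> b" "1 \<le> b"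
  shows "vcr t p q \<Longrightarrow> Mg (n + m) t p q y \<le> b ^ (3 ^ m)"
proof (induction m arbitrary: t p q)
  case (Suc m)
  let ?b = "b ^ (3 ^ m)"
  have 01: "1 \<le> ?b" using b by simp
  have "Mg (Suc (n + m)) t p q y \<le> ?b ^ 3"
    by (rule Mg_Suc_le[OF Suc.prems Suc.IH]) (use 01 in \<open>auto intro: power_increasing\<close>)
  also have "?b ^ 3 = b ^ (3 ^ Suc m)" by (simp add: power_mult[symmetric] mult.commute)
  finally show ?case by simp
qed (use b in simp)

text \<open>\<open>hvec\<close> is the eigenvector for the eigenvalue \<open>abar\<close> of the mean offspring matrix
  \<open>((5/3, 2/3), (6/5, 1))\<close> of the two kinds of crossings (tree, two-component forest).\<close>

definition hvec :: "nat \<Rightarrow> real" where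
  "hvec t = (if t = 0 then 1 else sqrt 205 / 10 - 1/2)"

lemma sqrt205: "14 \<le> sqrt 205" "sqrt 205 \<le> 15"
  by (auto intro: real_le_rsqrt real_le_lsqrt)

lemma abar_bounds: "2 < abar" "abar < 3" "abar \<ge> 34/15"
  using sqrt205 by (auto simp: abar_def)

lemma hvec_bounds: "9/10 \<le> hvec t" "hvec t \<le> 1"
  using sqrt205 by (auto simp: hvec_def)

lemma hvec_eigen: "5/3 + 2/3 * hvec 1 = abar * hvec 0" "6/5 + hvec 1 = abar * hvec 1"
  by (simp_all add: hvec_def abar_def algebra_simps)

text \<open>The mean total weight of the offspring is \<open>abar\<close> times the weight of the
  parent. The twelve valid choices of \<open>t\<close>, \<open>p\<close>, \<open>q\<close> are
  evaluated one by one; trees yield 5/3 and 2/3 offspring of the two kinds, two-component forests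
  6/5 and 1.\<close>

lemma hvec_drift:
  assumes v: "vcr t p q"
  shows "(\<Sum>tr\<leftarrow>goods t. wt t tr * (\<Sum>(w, s, i, j)\<leftarrow>offc [] tr p q. hvec s)) = abar * hvec t"
proof -
  define \<eta> where "\<eta> = hvec 1"
  have h: "hvec 0 = 1" "hvec 1 = \<eta>" "hvec (Suc 0) = \<eta>" "hvec 2 = \<eta>" "hvec 3 = \<eta>" "hvec 4 = \<eta>"
    by (auto simp: hvec_def \<eta>_def)
  have e: "abar * hvec 0 = 5/3 + 2/3 * \<eta>" "abar * \<eta> = 6/5 + \<eta>"
    using hvec_eigen by (simp_all add: \<eta>_def)
  have pq: "p = 1 \<and> q = 2 \<or> p = 2 \<and> q = 1 \<or> p = 1 \<and> q = 3 \<or> p = 3 \<and> q = 1 \<or> p = 2 \<and> q = 3 \<or> p = 3 \<and> q = 2"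
    using v by (auto simp: vcr_def sg_idx_def)
  have t: "t = 0 \<or> t = 1 \<or> t = 2 \<or> t = 3" using vcr_le[OF v] by linarith
  have pcv: "pc t p q" using v by (simp add: vcr_def)
  define D where "D t p q = (\<Sum>tr\<leftarrow>goods t. wt t tr * (\<Sum>(w, s, i, j)\<leftarrow>offc [] tr p q. hvec s))" for t p q
  note s = wt_def offc_def off_def pc_def tri_def h
  have "D 0 1 2 = 5/3 + 2/3 * \<eta>" "D 0 2 1 = 5/3 + 2/3 * \<eta>" "D 0 1 3 = 5/3 + 2/3 * \<eta>"
      "D 0 3 1 = 5/3 + 2/3 * \<eta>" "D 0 2 3 = 5/3 + 2/3 * \<eta>" "D 0 3 2 = 5/3 + 2/3 * \<eta>"
    unfolding D_def goods_0 by (simp_all add: s field_simps)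
  moreover have "D 1 2 3 = 6/5 + \<eta>" "D 1 3 2 = 6/5 + \<eta>"
    unfolding D_def goods_1 by (simp_all add: s field_simps)
  moreover have "D 2 1 3 = 6/5 + \<eta>" "D 2 3 1 = 6/5 + \<eta>"
    unfolding D_def goods_2 by (simp_all add: s field_simps)
  moreover have "D 3 1 2 = 6/5 + \<eta>" "D 3 2 1 = 6/5 + \<eta>"
    unfolding D_def goods_3 by (simp_all add: s field_simps)
  ultimately have D: "D 0 1 2 = 5/3 + 2/3 * \<eta>" "D 0 2 1 = 5/3 + 2/3 * \<eta>" "D 0 1 3 = 5/3 + 2/3 * \<eta>"
      "D 0 3 1 = 5/3 + 2/3 * \<eta>" "D 0 2 3 = 5/3 + 2/3 * \<eta>" "D 0 3 2 = 5/3 + 2/3 * \<eta>"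
      "D 1 2 3 = 6/5 + \<eta>" "D 1 3 2 = 6/5 + \<eta>" "D 2 1 3 = 6/5 + \<eta>" "D 2 3 1 = 6/5 + \<eta>"
      "D 3 1 2 = 6/5 + \<eta>" "D 3 2 1 = 6/5 + \<eta>"
    by blast+
  have R: "abar * hvec t = (if t = 0 then 5/3 + 2/3 * \<eta> else 6/5 + \<eta>)"
    using t e h by auto
  have "D t p q = (if t = 0 then 5/3 + 2/3 * \<eta> else 6/5 + \<eta>)"
    using t
  proof (elim disjE)
    assume t: "t = 0"
    show ?thesis using pq D unfolding t by auto
  next
    assume t: "t = 1"
    then have "p = 2 \<and> q = 3 \<or> p = 3 \<and> q = 2" using pq pcv by (auto simp: pc_def)
    then show ?thesis using D unfolding t by auto
  next
    assume t: "t = 2"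
    then have "p = 1 \<and> q = 3 \<or> p = 3 \<and> q = 1" using pq pcv by (auto simp: pc_def)
    then show ?thesis using D unfolding t by auto
  next
    assume t: "t = 3"
    then have "p = 1 \<and> q = 2 \<or> p = 2 \<and> q = 1" using pq pcv by (auto simp: pc_def)
    then show ?thesis using D unfolding t by auto
  qed
  then have "D t p q = abar * hvec t" by (simp only: R)
  then show ?thesis by (simp add: D_def)
qed

lemma exp_le_quadratic:
  fixes w :: real
  assumes "\<bar>w\<bar> \<le> 1"
  shows "exp w \<le> 1 + w + w\<^sup>2"
proof (cases "w \<ge> 0")
  case True
  then show ?thesis using assms exp_bound by auto
next
  case False
  define y where "y = - w"
  have y: "0 < y" using False by (simp add: y_def)
  have "exp w = 1 / exp y" by (simp add: y_def exp_minus inverse_eq_divide)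
  also have "\<dots> \<le> 1 / (1 + y)" using y exp_ge_add_one_self[of y] by (intro divide_left_mono) auto
  also have "\<dots> \<le> 1 - y + y\<^sup>2"
  proof -
    have "1 \<le> (1 - y + y\<^sup>2) * (1 + y)" using y by (simp add: algebra_simps power2_eq_square)
    then show ?thesis using y by (simp add: divide_le_eq)
  qed
  finally show ?thesis by (simp add: y_def)
qed

text \<open>At most three offspring of weight at most 1 give a total weight between 0 and 3, so for
  \<open>\<bar>z\<bar> \<le> 1/3\<close> the quadratic bound on \<open>exp\<close> applies with
  error at most \<open>9 * z^2\<close>. The linear term is the drift, and 1 + x is at most
  \<open>exp x\<close>.\<close>

lemma offspring_exp_le:
  assumes v: "vcr t p q" and z: "\<bar>z\<bar> \<le> 1/3"
  shows "(\<Sum>tr\<leftarrow>goods t. wt t tr * exp (z * (\<Sum>(w, s, i, j)\<leftarrow>offc [] tr p q. hvec s))) \<le>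
    exp (abar * hvec t * z + 9 * z\<^sup>2)"
proof -
  define h where "h tr = (\<Sum>(w, s, i, j)\<leftarrow>offc [] tr p q. hvec s)" for tr
  have h03: "0 \<le> h tr" "h tr \<le> 3" for tr
  proof -
    have "0 \<le> sum_list (map (\<lambda>(w, s, i, j). hvec s) cs) \<and> sum_list (map (\<lambda>(w, s, i, j). hvec s) cs) \<le> real (length cs)"
      for cs :: "(nat list \<times> nat \<times> nat \<times> nat) list"
    proof (induction cs)
      case (Cons c cs)
      obtain w s i j where c: "c = (w, s, i, j)" by (metis prod.exhaust)
      show ?case using Cons hvec_bounds[of s] by (simp add: c)
    qed simp
    from this[of "offc [] tr p q"] show "0 \<le> h tr" "h tr \<le> 3"
      using offc_length[of "[]" tr p q] unfolding h_def by linarith+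
  qed
  have "exp (z * h tr) \<le> (1 + 9 * z\<^sup>2) + z * h tr" for tr
  proof -
    have "\<bar>z * h tr\<bar> \<le> (1/3) * 3" unfolding abs_mult by (intro mult_mono z) (use h03[of tr] in auto)
    then have "exp (z * h tr) \<le> 1 + z * h tr + (z * h tr)\<^sup>2" by (intro exp_le_quadratic) simp
    also have "(z * h tr)\<^sup>2 \<le> 9 * z\<^sup>2"
    proof -
      have "(h tr)\<^sup>2 \<le> 3\<^sup>2" using h03[of tr] by (intro power_mono) auto
      then have "z\<^sup>2 * (h tr)\<^sup>2 \<le> z\<^sup>2 * 9" by (intro mult_left_mono) auto
      then show ?thesis by (simp add: power_mult_distrib mult.commute)
    qed
    finally show ?thesis by simp
  qed
  then have "(\<Sum>tr\<leftarrow>goods t. wt t tr * exp (z * h tr)) \<le> (\<Sum>tr\<leftarrow>goods t. wt t tr * ((1 + 9 * z\<^sup>2) + z * h tr))"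
    by (intro sum_list_mono mult_left_mono wt_nonneg)
  also have "\<dots> = (\<Sum>tr\<leftarrow>goods t. wt t tr * (1 + 9 * z\<^sup>2) + (wt t tr * h tr) * z)"
    by (simp add: algebra_simps)
  also have "\<dots> = (1 + 9 * z\<^sup>2) + abar * hvec t * z"
    using wt_sum[OF vcr_le[OF v]] hvec_drift[OF v]
    by (simp add: sum_list_addf sum_list_mult_const h_def)
  also have "\<dots> \<le> exp (abar * hvec t * z + 9 * z\<^sup>2)"
    using exp_ge_add_one_self[of "abar * hvec t * z + 9 * z\<^sup>2"] by linarith
  finally show ?thesis by (simp add: h_def)
qed

text \<open>The quadratic correction \<open>18 u\<^sup>2\<close> absorbs the second-order term of each generation because
  \<open>abar\<^sup>2 - abar > 2\<close>.\<close>

lemma Mg_bound: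
  assumes base: "\<And>t p q u. vcr t p q \<Longrightarrow> 0 \<le> u \<Longrightarrow> Mg 0 t p q (c * u) \<le> exp (hvec t * (\<sigma> * u))"
    and s: "\<bar>\<sigma>\<bar> = 1"
  shows "vcr t p q \<Longrightarrow> 0 \<le> u \<Longrightarrow> u \<le> 1/18 \<Longrightarrow>
     Mg n t p q (c * u / abar ^ n) \<le> exp (hvec t * (\<sigma> * u + 18 * u\<^sup>2))"
proof (induction n arbitrary: t p q u)
  case 0
  have "Mg 0 t p q (c * u) \<le> exp (hvec t * (\<sigma> * u))" using base 0 by blast
  also have "\<dots> \<le> exp (hvec t * (\<sigma> * u + 18 * u\<^sup>2))"
    using hvec_bounds(1)[of t] by (simp add: mult_left_mono)
  finally show ?case by simp
next
  case (Suc n)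
  note ab = abar_bounds
  define u' where "u' = u / abar"
  \<comment> \<open>The exponent per unit of weight supplied by the induction hypothesis for one
    child. The bound 1/18 on \<open>u'\<close> makes its quadratic part at most its linear part,
    whence \<open>\<bar>z\<bar> \<le> 2 * u' \<le> 1/9\<close>.\<close>
  define z where "z = \<sigma> * u' + 18 * u'\<^sup>2"
  have u': "0 \<le> u'" "u' \<le> 1/18" "u = abar * u'"
  proof -
    show "0 \<le> u'" "u = abar * u'" using Suc.prems ab by (auto simp: u'_def)
    have "u' \<le> u / 1" unfolding u'_def using Suc.prems ab by (intro divide_left_mono) auto
    then show "u' \<le> 1/18" using Suc.prems by simp
  qed
  have uu: "18 * u'\<^sup>2 \<le> u'" using mult_right_mono[OF u'(2,1)] by (simp add: power2_eq_square)
  have zb: "\<bar>z\<bar> \<le> 2 * u'"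
  proof -
    have "\<bar>\<sigma> * u'\<bar> = u'" using s u' by (simp add: abs_mult)
    then have "\<sigma> * u' \<le> u'" "- (\<sigma> * u') \<le> u'"
      using abs_ge_self[of "\<sigma> * u'"] abs_ge_minus_self[of "\<sigma> * u'"] by linarith+
    moreover have "0 \<le> u'\<^sup>2" by simp
    ultimately show ?thesis using uu unfolding z_def abs_le_iff by linarith
  qed
  have arg: "c * u / abar ^ Suc n = c * u' / abar ^ n"
    using ab by (simp add: u'_def)
  have "Mg (Suc n) t p q (c * u / abar ^ Suc n) =
     (\<Sum>tr\<leftarrow>goods t. wt t tr * (\<Prod>(w, s, i, j)\<leftarrow>offc [] tr p q. Mg n s i j (c * u' / abar ^ n)))"
    unfolding arg by (rule Mg_Suc[OF Suc.prems(1)])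
  also have "\<dots> \<le> (\<Sum>tr\<leftarrow>goods t. wt t tr * exp (z * (\<Sum>(w, s, i, j)\<leftarrow>offc [] tr p q. hvec s)))"
  proof (intro sum_list_mono mult_left_mono wt_nonneg)
    fix tr assume tr: "tr \<in> set (goods t)"
    have vc: "\<forall>c\<in>set (offc [] tr p q). vc (Suc 0) c"
      using offc_vc[OF tr Suc.prems(1), of "[]" 0] by (simp add: sg_words_def)
    define P where "P cs = (\<Prod>(w, s, i, j)\<leftarrow>cs. Mg n s i j (c * u' / abar ^ n))" for cs :: "(nat list \<times> nat \<times> nat \<times> nat) list"
    define h where "h cs = (\<Sum>(w, s, i, j)\<leftarrow>cs. hvec s)" for cs :: "(nat list \<times> nat \<times> nat \<times> nat) list"
    have Ph: "P [] = 1" "P ((w, s, i, j) # cs) = Mg n s i j (c * u' / abar ^ n) * P cs"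
        "h [] = 0" "h ((w, s, i, j) # cs) = hvec s + h cs" for w s i j cs
      by (simp_all add: P_def h_def)
    have "0 \<le> P cs \<and> P cs \<le> exp (z * h cs)" if "\<forall>c\<in>set cs. vc (Suc 0) c" for cs
      using that
    proof (induction cs)
      case (Cons d cs)
      obtain w s i j where d: "d = (w, s, i, j)" by (metis prod.exhaust)
      have "vcr s i j" using Cons.prems by (simp add: d vc_def)
      from Suc.IH[OF this u'(1,2)] have 1: "Mg n s i j (c * u' / abar ^ n) \<le> exp (hvec s * z)" by (simp add: z_def)
      have 2: "0 \<le> P cs" "P cs \<le> exp (z * h cs)" using Cons by auto
      have "Mg n s i j (c * u' / abar ^ n) * P cs \<le> exp (hvec s * z) * exp (z * h cs)"
        by (rule mult_mono[OF 1 2(2)]) (use 2 in auto)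
      also have "\<dots> = exp (z * (hvec s + h cs))" by (simp add: exp_add[symmetric] algebra_simps)
      finally show ?case using 2 by (simp add: d Ph Mg_nonneg)
    qed (simp add: Ph)
    note this[OF vc, unfolded P_def h_def]
    then show "(\<Prod>(w, s, i, j)\<leftarrow>offc [] tr p q. Mg n s i j (c * u' / abar ^ n))
       \<le> exp (z * (\<Sum>(w, s, i, j)\<leftarrow>offc [] tr p q. hvec s))" by blast
  qed
  also have "\<dots> \<le> exp (abar * hvec t * z + 9 * z\<^sup>2)"
    using zb u' by (intro offspring_exp_le[OF Suc.prems(1)]) auto
  also have "\<dots> \<le> exp (hvec t * (\<sigma> * u + 18 * u\<^sup>2))"
  proof -
    \<comment> \<open>The second-order cost is at most \<open>36 * u'^2\<close>. Rescaling from
      \<open>u'\<close> to \<open>u = abar * u'\<close> gains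
      \<open>18 * u'^2 * hvec t * abar * (abar - 1)\<close>, and the last three factors have product
      at least 2.\<close>
    have "z\<^sup>2 \<le> (2 * u')\<^sup>2" using zb by (metis abs_ge_zero power2_abs power_mono)
    then have 1: "9 * z\<^sup>2 \<le> 36 * u'\<^sup>2" by (simp add: power_mult_distrib)
    have "(34/15) * (19/15) \<le> abar * (abar - 1)" using ab by (intro mult_mono) auto
    then have "5/2 \<le> abar * (abar - 1)" by simp
    then have "(9/10) * (5/2) \<le> hvec t * (abar * (abar - 1))"
      using hvec_bounds(1)[of t] by (intro mult_mono) auto
    then have "2 \<le> hvec t * (abar * (abar - 1))" by simp
    then have 2: "36 * u'\<^sup>2 \<le> 18 * u'\<^sup>2 * (hvec t * (abar * (abar - 1)))"
      using mult_left_mono[of 2 "hvec t * (abar * (abar - 1))" "18 * u'\<^sup>2"] by simp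
    have 3: "hvec t * (\<sigma> * u + 18 * u\<^sup>2) - abar * hvec t * z = 18 * u'\<^sup>2 * (hvec t * (abar * (abar - 1)))"
      unfolding u'(3) z_def by (simp add: algebra_simps power2_eq_square)
    have "abar * hvec t * z + 9 * z\<^sup>2 \<le> hvec t * (\<sigma> * u + 18 * u\<^sup>2)" using 1 2 3 by linarith
    then show ?thesis by simp
  qed
  finally show ?case .
qed

lemma steps_0:
  assumes H: "H \<in> Cls 0 t" and v: "vcr t p q"
  shows "1 \<le> steps (tpath H (sg_u p) (sg_u q))" "steps (tpath H (sg_u p) (sg_u q)) \<le> 2"
proof -
  let ?\<pi> = "tpath H (sg_u p) (sg_u q)"
  have s: "saw H (sg_u p) (sg_u q) ?\<pi>" by (rule tpath_saw[OF H v])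
  have i: "p \<in> sg_idx" "q \<in> sg_idx" "sg_u p \<noteq> sg_u q" using v sg_u_eq_iff by (auto simp: vcr_def)
  have "set ?\<pi> \<subseteq> sg_V 0" using saw_V[OF s _ sg_u_V[OF i(1)], of 0] H unfolding Cls_def by blast
  then have "set ?\<pi> \<subseteq> sg_u ` sg_idx" by (simp add: sg_idx_def)
  then have "card (set ?\<pi>) \<le> card (sg_u ` sg_idx)" by (intro card_mono) auto
  also have "\<dots> \<le> card sg_idx" by (rule card_image_le) simp
  also have "\<dots> = 3" by (simp add: sg_idx_def)
  finally have "length ?\<pi> \<le> 3" using s distinct_card[of ?\<pi>] by (simp add: saw_iff)
  then show "steps ?\<pi> \<le> 2" by (simp add: steps_def)
  have "length ?\<pi> \<noteq> 0" "length ?\<pi> \<noteq> 1"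
    using s i by (auto simp: saw_iff length_Suc_conv)
  then show "1 \<le> steps ?\<pi>" unfolding steps_def by linarith
qed

lemma Mg_0_le:
  assumes v: "vcr t p q" and b: "\<And>d::nat. 1 \<le> d \<Longrightarrow> d \<le> 2 \<Longrightarrow> y * real d \<le> b"
  shows "Mg 0 t p q y \<le> exp b"
proof -
  have "Mg 0 t p q y \<le> Ecr 0 t p q (\<lambda>\<pi>. exp b)"
    unfolding Mg_def by (rule Ecr_mono) (use b steps_0[OF _ v] in auto)
  also have "\<dots> = exp b" using vcr_le[OF v] by (simp add: Ecr_const)
  finally show ?thesis .
qed

lemma Mg_lower:
  assumes v: "vcr t p q"
  shows "Mg (n + m) t p q (- 1 / (36 * abar ^ n)) \<le> exp (- (2 ^ m) / 80)"
proof -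
  have b: "Mg 0 t p q (-1 * u) \<le> exp (hvec t * (-1 * u))" if "vcr t p q" "0 \<le> u" for t p q u
  proof (rule Mg_0_le[OF that(1)])
    fix d :: nat assume "1 \<le> d"
    then have "u * 1 \<le> u * real d" using that by (intro mult_left_mono) auto
    moreover have "hvec t * u \<le> 1 * u" using hvec_bounds(2) that by (intro mult_right_mono) auto
    ultimately show "- 1 * u * real d \<le> hvec t * (- 1 * u)" by simp
  qed
  have "Mg n s i j (- 1 / (36 * abar ^ n)) \<le> exp (- 1 / 80)" if "vcr s i j" for s i j
  proof -
    \<comment> \<open>The value \<open>u = 1/36\<close> minimises \<open>- u + 18 * u^2\<close>; the
      minimum is -1/72, and the weight is at least 9/10.\<close>
    have "Mg n s i j (-1 * (1/36) / abar ^ n) \<le> exp (hvec s * (-1 * (1/36) + 18 * (1/36)\<^sup>2))"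
      by (rule Mg_bound[OF b _ that]) auto
    also have "hvec s * (-1 * (1/36) + 18 * (1/36)\<^sup>2) \<le> - 1/80"
      using hvec_bounds(1)[of s] by (simp add: power2_eq_square)
    finally show ?thesis by (simp add: divide_simps)
  qed
  from Mg_contract[OF this _ _ v, where m = m] have "Mg (n + m) t p q (- 1 / (36 * abar ^ n)) \<le> exp (- 1 / 80) ^ (2 ^ m)" by simp
  also have "\<dots> = exp (- (2 ^ m) / 80)" by (simp add: exp_of_nat_mult[symmetric])
  finally show ?thesis .
qed

lemma Mg_upper:
  assumes v: "vcr t p q"
  shows "Mg (n + m) t p q (1 / (108 * abar ^ n)) \<le> exp (3 ^ m / 24)"
proof -
  \<comment> \<open>The factor 1/3 fits level 0, where a walk has at most two steps and the weight
    is at least 9/10.\<close>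
  have b: "Mg 0 t p q (1/3 * u) \<le> exp (hvec t * (1 * u))" if "vcr t p q" "0 \<le> u" for t p q u
  proof (rule Mg_0_le[OF that(1)])
    fix d :: nat assume "d \<le> 2"
    then have "u * real d \<le> u * 2" using that by (intro mult_left_mono) auto
    moreover have "9/10 * u \<le> hvec t * u" using hvec_bounds(1) that by (intro mult_right_mono) auto
    ultimately show "1/3 * u * real d \<le> hvec t * (1 * u)" using that by simp
  qed
  have "Mg n s i j (1 / (108 * abar ^ n)) \<le> exp (1 / 24)" if "vcr s i j" for s i j
  proof -
    have "Mg n s i j (1/3 * (1/36) / abar ^ n) \<le> exp (hvec s * (1 * (1/36) + 18 * (1/36)\<^sup>2))"
      by (rule Mg_bound[OF b _ that]) auto
    also have "hvec s * (1 * (1/36) + 18 * (1/36)\<^sup>2) \<le> 1/24"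
      using hvec_bounds(2)[of s] by (simp add: power2_eq_square)
    finally show ?thesis by (simp add: divide_simps)
  qed
  from Mg_expand[OF this _ v, where m = m] have "Mg (n + m) t p q (1 / (108 * abar ^ n)) \<le> exp (1 / 24) ^ (3 ^ m)" by simp
  also have "\<dots> = exp (3 ^ m / 24)" by (simp add: exp_of_nat_mult[symmetric])
  finally show ?thesis .
qed

section \<open>Exponential Markov bounds for the number of steps\<close>

lemma steps_lower_tail:
  assumes v: "vcr t p q"
  shows "Ecr (n + m) t p q (\<lambda>\<pi>. of_bool (real (steps \<pi>) \<le> x)) \<le> exp (x / (36 * abar ^ n) - 2 ^ m / 80)"
proof -
  define y where "y = 1 / (36 * abar ^ n)"
  have y: "y > 0" using abar_bounds by (simp add: y_def)
  have "Ecr (n + m) t p q (\<lambda>\<pi>. of_bool (real (steps \<pi>) \<le> x)) \<le>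
     Ecr (n + m) t p q (\<lambda>\<pi>. exp (y * x) * exp (- y * real (steps \<pi>)))"
    using y by (intro Ecr_mono) (auto simp: exp_add[symmetric])
  also have "\<dots> = exp (y * x) * Mg (n + m) t p q (- y)" by (simp add: Ecr_cmult Mg_def)
  also have "\<dots> \<le> exp (y * x) * exp (- (2 ^ m) / 80)"
    using Mg_lower[OF v, of n m] by (intro mult_left_mono) (auto simp: y_def)
  also have "\<dots> = exp (x / (36 * abar ^ n) - 2 ^ m / 80)" by (simp add: exp_add[symmetric] y_def)
  finally show ?thesis .
qed

lemma steps_upper_tail:
  assumes v: "vcr t p q"
  shows "Ecr (n + m) t p q (\<lambda>\<pi>. of_bool (x < real (steps \<pi>))) \<le> exp (3 ^ m / 24 - x / (108 * abar ^ n))"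
proof -
  define y where "y = 1 / (108 * abar ^ n)"
  have y: "y > 0" using abar_bounds by (simp add: y_def)
  have "Ecr (n + m) t p q (\<lambda>\<pi>. of_bool (x < real (steps \<pi>))) \<le>
     Ecr (n + m) t p q (\<lambda>\<pi>. exp (- y * x) * exp (y * real (steps \<pi>)))"
    using y by (intro Ecr_mono) (auto simp: exp_add[symmetric])
  also have "\<dots> = exp (- y * x) * Mg (n + m) t p q y" by (simp add: Ecr_cmult Mg_def)
  also have "\<dots> \<le> exp (- y * x) * exp (3 ^ m / 24)"
    using Mg_upper[OF v, of n m] by (intro mult_left_mono) (auto simp: y_def)
  also have "\<dots> = exp (3 ^ m / 24 - x / (108 * abar ^ n))" by (simp add: exp_add[symmetric] y_def)
  finally show ?thesis .
qed

section \<open>Linear interpolation of concatenated walks\<close>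

lemma LI_ge: "real (steps xs) \<le> t \<Longrightarrow> LI xs t = last xs"
  by (simp add: LI_def steps_def)

lemma LI_lt:
  assumes "0 \<le> t" "t < real (steps xs)"
  shows "LI xs t = of_real (real (nat \<lfloor>t\<rfloor>) + 1 - t) * xs ! nat \<lfloor>t\<rfloor> + of_real (t - real (nat \<lfloor>t\<rfloor>)) * xs ! Suc (nat \<lfloor>t\<rfloor>)"
    "nat \<lfloor>t\<rfloor> < steps xs" "real (nat \<lfloor>t\<rfloor>) \<le> t" "t \<le> real (nat \<lfloor>t\<rfloor>) + 1"
proof -
  show "LI xs t = of_real (real (nat \<lfloor>t\<rfloor>) + 1 - t) * xs ! nat \<lfloor>t\<rfloor> + of_real (t - real (nat \<lfloor>t\<rfloor>)) * xs ! Suc (nat \<lfloor>t\<rfloor>)"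
  proof -
    have "\<not> t \<ge> real (length xs - 1)" using assms(2) by (simp add: steps_def)
    then show ?thesis unfolding LI_def Let_def by (rule if_not_P)
  qed
  show "nat \<lfloor>t\<rfloor> < steps xs" "real (nat \<lfloor>t\<rfloor>) \<le> t" "t \<le> real (nat \<lfloor>t\<rfloor>) + 1" using assms by linarith+
qed

lemma LI_convex:
  assumes "convex C" "set xs \<subseteq> C" "xs \<noteq> []" "0 \<le> t"
  shows "LI xs t \<in> C"
proof (cases "t < real (steps xs)")
  case True
  note l = LI_lt[OF assms(4) True]
  have "xs ! nat \<lfloor>t\<rfloor> \<in> C" "xs ! Suc (nat \<lfloor>t\<rfloor>) \<in> C"
    using l(2) assms(2) by (auto simp: steps_def)
  from convexD[OF assms(1) this, of "real (nat \<lfloor>t\<rfloor>) + 1 - t" "t - real (nat \<lfloor>t\<rfloor>)"] l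
  show ?thesis by (simp add: scaleR_conv_of_real)
next
  case False
  then show ?thesis using assms by (simp add: LI_ge subsetD)
qed

lemma LI_append:
  assumes ne: "xs \<noteq> []" "ys \<noteq> []" "last xs = hd ys" and t: "0 \<le> t"
  shows "LI (xs @ tl ys) t = (if t \<le> real (steps xs) then LI xs t else LI ys (t - real (steps xs)))"
proof -
  define a b where "a = steps xs" and "b = steps ys"
  have la: "length xs = Suc a" and lb: "length ys = Suc b" using ne by (cases xs; cases ys; simp add: a_def b_def steps_def)+
  have st: "steps (xs @ tl ys) = a + b" using la lb by (simp add: steps_def)
  have nth1: "(xs @ tl ys) ! k = xs ! k" if "k \<le> a" for k using that la by (simp add: nth_append)
  have nth2: "(xs @ tl ys) ! k = ys ! (k - a)" if "a \<le> k" "k \<le> a + b" for k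
  proof (cases "k = a")
    case True
    then have "(xs @ tl ys) ! k = last xs" using la ne by (simp add: nth_append last_conv_nth)
    then show ?thesis using True ne by (simp add: hd_conv_nth)
  next
    case False
    then have "(xs @ tl ys) ! k = tl ys ! (k - Suc a)" using that la by (simp add: nth_append)
    also have "\<dots> = ys ! Suc (k - Suc a)" using that False lb by (intro nth_tl) simp
    also have "Suc (k - Suc a) = k - a" using that False by simp
    finally show ?thesis .
  qed
  have lastj: "last (xs @ tl ys) = last ys"
    using ne by (cases ys) auto
  show ?thesis
  proof (cases "t < real a")
    case True
    then have 1: "t < real (steps (xs @ tl ys))" "t < real (steps xs)" by (simp_all add: st a_def[symmetric])
    note l = LI_lt[OF t 1(1)] LI_lt[OF t 1(2)]
    show ?thesis using l(6) 1(2) unfolding l(1,5) by (simp add: nth1 a_def[symmetric])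
  next
    case False
    note ta = False
    show ?thesis
    proof (cases "t < real (a + b)")
      case True
      then have 1: "t < real (steps (xs @ tl ys))" by (simp add: st)
      note l = LI_lt[OF t 1]
      define k where "k = nat \<lfloor>t\<rfloor>"
      have k: "a \<le> k" "k < a + b" "real k \<le> t" "t \<le> real k + 1" using ta t True l unfolding k_def st by linarith+
      have n: "(xs @ tl ys) ! k = ys ! (k - a)" "(xs @ tl ys) ! Suc k = ys ! Suc (k - a)"
        using nth2[of k] nth2[of "Suc k"] k by (simp_all add: Suc_diff_le)
      have L: "LI (xs @ tl ys) t = of_real (real k + 1 - t) * ys ! (k - a) + of_real (t - real k) * ys ! Suc (k - a)"
        unfolding l(1) k_def[symmetric] n ..
      \<comment> \<open>At the junction the claim assigns the time to the first walk, whereas the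
        index \<open>k = a\<close> already belongs to the second; both give the shared
        point.\<close>
      show ?thesis
      proof (cases "t = real a")
        case True
        then have "k = a" using k_def by simp
        then have "LI (xs @ tl ys) t = hd ys" using L True ne by (simp add: hd_conv_nth)
        then show ?thesis using True ne by (simp add: LI_ge a_def)
      next
        case False
        then have tt: "t > real a" using ta by simp
        have 2: "0 \<le> t - real a" "t - real a < real (steps ys)" using tt True by (simp_all add: b_def[symmetric])
        have fl: "nat \<lfloor>t - real a\<rfloor> = k - a" 
        proof -
          have "\<lfloor>t - real a\<rfloor> = \<lfloor>t\<rfloor> - int a" by linarith
          then show ?thesis by (simp add: k_def nat_diff_distrib')
        qed
        have "LI ys (t - real a) = of_real (real k + 1 - t) * ys ! (k - a) + of_real (t - real k) * ys ! Suc (k - a)"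
          using LI_lt(1)[OF 2] k unfolding fl by (simp add: of_nat_diff)
        then show ?thesis using L tt by (simp add: a_def[symmetric])
      qed
    next
      case False
      then have L: "LI (xs @ tl ys) t = last ys" using lastj by (simp add: LI_ge st)
      show ?thesis
      proof (cases "t = real a")
        case True
        then have "b = 0" using False by simp
        then have "last ys = hd ys" using lb by (cases ys) auto
        then show ?thesis using L True ne by (simp add: LI_ge a_def)
      next
        case False
        then have "t > real a" using ta by simp
        moreover have "real (steps ys) \<le> t - real a" using \<open>\<not> t < real (a + b)\<close> by (simp add: b_def[symmetric])
        ultimately show ?thesis using L LI_ge[of ys "t - real a"] by (simp add: a_def[symmetric])
      qed
    qed
  qed
qed

lemma hd_joinl: "\<pi> \<noteq> [] \<Longrightarrow> hd (joinl (\<pi> # \<pi>s)) = hd \<pi>"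
  by (cases \<pi>s) auto

lemma joinl_nonempty: "\<pi> \<noteq> [] \<Longrightarrow> joinl (\<pi> # \<pi>s) \<noteq> []"
  by (cases \<pi>s) auto

lemma set_joinl: "\<forall>\<pi>\<in>set \<pi>s. \<pi> \<noteq> [] \<Longrightarrow> set (joinl \<pi>s) \<subseteq> \<Union>(set ` set \<pi>s)"
proof (induction \<pi>s rule: joinl.induct)
  case (3 \<pi> \<rho> r)
  then have "set (joinl (\<rho> # r)) \<subseteq> \<Union>(set ` set (\<rho> # r))" by simp
  moreover have "set (tl (joinl (\<rho> # r))) \<subseteq> set (joinl (\<rho> # r))"
    by (cases "joinl (\<rho> # r)") auto
  ultimately show ?case by auto
qed auto

lemma LI_joinl:
  assumes "\<pi> \<noteq> []" "\<rho> \<noteq> []" "last \<pi> = hd \<rho>" "0 \<le> t"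
  shows "LI (joinl (\<pi> # \<rho> # r)) t =
     (if t \<le> real (steps \<pi>) then LI \<pi> t else LI (joinl (\<rho> # r)) (t - real (steps \<pi>)))"
proof -
  have "joinl (\<rho> # r) \<noteq> []" "last \<pi> = hd (joinl (\<rho> # r))"
    using assms by (auto simp: hd_joinl joinl_nonempty)
  from LI_append[OF assms(1) this assms(4)] show ?thesis by simp
qed

section \<open>Displacement of the walk in a short time\<close>

text \<open>\<open>next_fast ds S \<tau>\<close>: the crossing following the one in progress at time \<open>S\<close> takes time at most \<open>\<tau>\<close>.\<close>

fun next_fast :: "nat list \<Rightarrow> real \<Rightarrow> real \<Rightarrow> bool" where
  "next_fast [] S \<tau> \<longleftrightarrow> False"
| "next_fast [d] S \<tau> \<longleftrightarrow> False"
| "next_fast (d # e # ds) S \<tau> \<longleftrightarrow> (if S \<le> real d then real e \<le> \<tau> else next_fast (e # ds) (S - real d) \<tau>)"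

text \<open>The bound is required on a convex set, so that it also covers the points of the linear
  interpolation between the vertices.\<close>

definition small_walk :: "real \<Rightarrow> complex list \<Rightarrow> bool" where
  "small_walk D \<pi> \<longleftrightarrow> \<pi> \<noteq> [] \<and> (\<exists>C. convex C \<and> set \<pi> \<subseteq> C \<and> (\<forall>x\<in>C. \<forall>y\<in>C. norm (x - y) \<le> D))"

lemma small_walk_LI:
  assumes "small_walk D \<pi>" "0 \<le> s" "0 \<le> t"
  shows "norm (LI \<pi> s - LI \<pi> t) \<le> D" "norm (LI \<pi> s - last \<pi>) \<le> D" "norm (LI \<pi> s - hd \<pi>) \<le> D"
proof -
  obtain C where C: "convex C" "set \<pi> \<subseteq> C" "\<forall>x\<in>C. \<forall>y\<in>C. norm (x - y) \<le> D" and ne: "\<pi> \<noteq> []"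
    using assms(1) by (auto simp: small_walk_def)
  have "LI \<pi> s \<in> C" "LI \<pi> t \<in> C" "last \<pi> \<in> C" "hd \<pi> \<in> C"
    using LI_convex[OF C(1,2) ne] assms C(2) ne by auto
  then show "norm (LI \<pi> s - LI \<pi> t) \<le> D" "norm (LI \<pi> s - last \<pi>) \<le> D" "norm (LI \<pi> s - hd \<pi>) \<le> D"
    using C(3) by blast+
qed

text \<open>If the crossing after the one in progress lasts longer than \<open>\<tau>\<close>, only
  these two cells are visited up to time \<open>S + t\<close>, hence the factor 2. When no crossing
  follows, the walk stays in its current cell, which fits \<open>next_fast\<close> being false
  there.\<close>

lemma displacement_le:
  assumes "0 \<le> D" "0 \<le> t" "t \<le> \<tau>"
  shows "\<forall>\<pi>\<in>set \<pi>s. small_walk D \<pi> \<Longrightarrow> successively (\<lambda>\<pi> \<rho>. last \<pi> = hd \<rho>) \<pi>s \<Longrightarrow> \<pi>s \<noteq> [] \<Longrightarrow>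
    \<not> next_fast (map steps \<pi>s) S \<tau> \<Longrightarrow> 0 \<le> S \<Longrightarrow>
    norm (LI (joinl \<pi>s) (S + t) - LI (joinl \<pi>s) S) \<le> 2 * D"
proof (induction \<pi>s arbitrary: S rule: joinl.induct)
  case (2 \<pi>)
  have "norm (LI \<pi> (S + t) - LI \<pi> S) \<le> D" using 2 assms by (intro small_walk_LI(1)) auto
  then show ?case using assms by simp
next
  case (3 \<pi> \<rho> r)
  have sm: "small_walk D \<pi>" "small_walk D \<rho>" and ne: "\<pi> \<noteq> []" "\<rho> \<noteq> []" and l: "last \<pi> = hd \<rho>"
    using 3(2,3) by (auto simp: small_walk_def)
  have J: "LI (joinl (\<pi> # \<rho> # r)) u = (if u \<le> real (steps \<pi>) then LI \<pi> u else LI (joinl (\<rho> # r)) (u - real (steps \<pi>)))"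
    if "0 \<le> u" for u by (rule LI_joinl[OF ne l that])
  show ?case
  proof (cases "S \<le> real (steps \<pi>)")
    case True
    have e: "\<tau> < real (steps \<rho>)" using 3(5) True by simp
    show ?thesis
    proof (cases "S + t \<le> real (steps \<pi>)")
      case t: True
      then have "norm (LI (joinl (\<pi> # \<rho> # r)) (S + t) - LI (joinl (\<pi> # \<rho> # r)) S) \<le> D"
        using small_walk_LI(1)[OF sm(1), of "S + t" S] True 3(6) assms J by simp
      then show ?thesis using assms by simp
    next
      case False
      define u where "u = S + t - real (steps \<pi>)"
      have u: "0 \<le> u" "u \<le> real (steps \<rho>)" using False e True assms by (auto simp: u_def)
      have "LI (joinl (\<rho> # r)) u = LI \<rho> u"
      proof (cases r)
        case (Cons \<rho>' r')
        have "\<rho>' \<noteq> []" "last \<rho> = hd \<rho>'" using 3(2,3) by (auto simp: Cons small_walk_def)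
        from LI_joinl[OF ne(2) this u(1)] u(2) show ?thesis by (simp add: Cons)
      qed simp
      then have "LI (joinl (\<pi> # \<rho> # r)) (S + t) = LI \<rho> u" using J[of "S + t"] False 3(6) assms by (simp add: u_def)
      moreover have "LI (joinl (\<pi> # \<rho> # r)) S = LI \<pi> S" using J[of S] True 3(6) by simp
      moreover have "norm (LI \<rho> u - LI \<pi> S) \<le> norm (LI \<rho> u - hd \<rho>) + norm (LI \<pi> S - last \<pi>)"
        using norm_triangle_ineq4[of "LI \<rho> u - hd \<rho>" "LI \<pi> S - last \<pi>"] l by simp
      ultimately show ?thesis
        using small_walk_LI(3)[OF sm(2) u(1), of 0] small_walk_LI(2)[OF sm(1) 3(6), of 0] by simp
    qed
  next
    case False
    have "norm (LI (joinl (\<rho> # r)) ((S - real (steps \<pi>)) + t) - LI (joinl (\<rho> # r)) (S - real (steps \<pi>))) \<le> 2 * D"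
      by (rule 3(1)) (use 3(2-6) False in auto)
    then show ?thesis using J[of S] J[of "S + t"] False 3(6) assms by (simp add: algebra_simps)
  qed
qed simp

text \<open>Which crossing comes next is decided by the lengths of the earlier ones, and these are
  averaged over first. Its own length is independent of them, so the bound for one crossing
  suffices, whatever the length of the chain.\<close>

lemma next_fast_prob:
  assumes b: "\<And>t p q. vcr t p q \<Longrightarrow> Ecr n t p q (\<lambda>\<pi>. of_bool (real (steps \<pi>) \<le> \<tau>)) \<le> b" and b0: "0 \<le> b"
  shows "\<forall>c\<in>set cs. vc k c \<Longrightarrow> Elist n cs (\<lambda>\<pi>s. of_bool (next_fast (map steps \<pi>s) S \<tau>)) \<le> b"
proof (induction cs arbitrary: S)
  case Nil
  then show ?case using b0 by simp
next
  case (Cons c cs)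
  obtain w t p q where c: "c = (w, t, p, q)" by (metis prod.exhaust)
  have v: "vcr t p q" using Cons.prems by (simp add: c vc_def)
  have "Elist n cs (\<lambda>\<pi>s. of_bool (next_fast (d # map steps \<pi>s) S \<tau>)) \<le> b" for d
  proof (cases cs)
    case Nil
    then show ?thesis using b0 by simp
  next
    case (Cons c' cs')
    obtain w' t' p' q' where c': "c' = (w', t', p', q')" by (metis prod.exhaust)
    have v': "vcr t' p' q'" using Cons.prems \<open>cs = c' # cs'\<close> by (simp add: c' vc_def)
    show ?thesis
    proof (cases "S \<le> real d")
      case True
      \<comment> \<open>The next crossing has been found; all later ones integrate to 1.\<close>
      have "Elist n cs (\<lambda>\<pi>s. of_bool (next_fast (d # map steps \<pi>s) S \<tau>)) =
         Ecr n t' p' q' (\<lambda>\<pi>. of_bool (real (steps \<pi>) \<le> \<tau>))"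
        using Cons.prems True by (simp add: \<open>cs = c' # cs'\<close> c' Elist_const[of cs' k])
      also have "\<dots> \<le> b" by (rule b[OF v'])
      finally show ?thesis .
    next
      case False
      have "Elist n cs (\<lambda>\<pi>s. of_bool (next_fast (d # map steps \<pi>s) S \<tau>)) =
         Elist n cs (\<lambda>\<pi>s. of_bool (next_fast (map steps \<pi>s) (S - real d) \<tau>))"
      proof (rule Elist_cong)
        fix \<pi>s assume "list_all2 (cwalk n) cs \<pi>s"
        then obtain \<pi> r where "\<pi>s = \<pi> # r" by (cases \<pi>s) (auto simp: \<open>cs = c' # cs'\<close>)
        then show "of_bool (next_fast (d # map steps \<pi>s) S \<tau>) = (of_bool (next_fast (map steps \<pi>s) (S - real d) \<tau>) :: real)"
          using False by simp
      qed
      also have "\<dots> \<le> b" using Cons.IH Cons.prems by simp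
      finally show ?thesis .
    qed
  qed
  then have "Elist n (c # cs) (\<lambda>\<pi>s. of_bool (next_fast (map steps \<pi>s) S \<tau>)) \<le> Ecr n t p q (\<lambda>_. b)"
    by (simp add: c Ecr_mono)
  also have "\<dots> = b" using vcr_le[OF v] by (simp add: Ecr_const)
  finally show ?case .
qed

lemma convex_sg_tri: "convex sg_tri"
proof -
  have "bary i (u *\<^sub>R x + v *\<^sub>R y) = u * bary i x + v * bary i y" if "u + v = 1" for i u v and x y :: complex
  proof -
    have v: "v = 1 - u" using that by simp
    show ?thesis unfolding bary_def v by (simp add: field_simps)
  qed
  then show ?thesis unfolding convex_def sg_tri_def by simp
qed

lemma sg_tri_norm: "z \<in> sg_tri \<Longrightarrow> norm z \<le> 1"
proof -
  assume z: "z \<in> sg_tri"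
  have eq: "z = of_real (bary 2 z) + of_real (bary 3 z) * sg_u 3"
    by (rule complex_eqI) (simp_all add: bary_def sg_u_def field_simps)
  have "norm (sg_u 3) = 1" by (simp add: sg_u_def cmod_def power_divide)
  then have "norm z \<le> \<bar>bary 2 z\<bar> + \<bar>bary 3 z\<bar>"
    using norm_triangle_ineq[of "of_real (bary 2 z)" "of_real (bary 3 z) * sg_u 3"] eq by (simp add: norm_mult)
  then show ?thesis using z bary_sum[of z] by (simp add: sg_tri_def sg_idx_def)
qed

lemma sg_psiw_affine: "\<exists>b. \<forall>x. sg_psiw w x = b + (1 / 2 ^ length w) *\<^sub>R x"
proof (induction w)
  case (Cons i w)
  then obtain b where "\<forall>x. sg_psiw w x = b + (1 / 2 ^ length w) *\<^sub>R x" by blast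
  then have "\<forall>x. sg_psiw (i # w) x = ((b - sg_u i) / 2 + sg_u i) + (1 / 2 ^ length (i # w)) *\<^sub>R x"
    by (simp add: sg_psi_def scaleR_conv_of_real field_simps)
  then show ?case by blast
qed (auto intro: exI[of _ 0])

lemma small_walk_cell:
  assumes "w \<in> sg_words k" "set \<pi> \<subseteq> sg_tri" "\<pi> \<noteq> []"
  shows "small_walk (2 / 2 ^ k) (map (sg_psiw w) \<pi>)"
proof -
  obtain b where b: "\<forall>x. sg_psiw w x = b + (1 / 2 ^ length w) *\<^sub>R x" using sg_psiw_affine by blast
  have k: "length w = k" using assms(1) by (simp add: sg_words_def)
  have im: "sg_psiw w ` sg_tri = (\<lambda>x. b + (1 / 2 ^ k) *\<^sub>R x) ` sg_tri" using b k by simp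
  have "convex (sg_psiw w ` sg_tri)" unfolding im by (rule convex_affinity[OF convex_sg_tri])
  moreover have "norm (x - y) \<le> 2 / 2 ^ k" if xy: "x \<in> sg_psiw w ` sg_tri" "y \<in> sg_psiw w ` sg_tri" for x y
  proof -
    obtain x' y' where x': "x' \<in> sg_tri" "y' \<in> sg_tri" "x = b + (1 / 2 ^ k) *\<^sub>R x'" "y = b + (1 / 2 ^ k) *\<^sub>R y'"
      using xy unfolding im by blast
    have "x - y = (1 / 2 ^ k) *\<^sub>R (x' - y')" by (simp add: x' algebra_simps)
    then have "norm (x - y) = norm (x' - y') / 2 ^ k" by (simp only: norm_scaleR) simp
    also have "\<dots> \<le> 2 / 2 ^ k"
      using norm_triangle_ineq4[of x' y'] sg_tri_norm[OF x'(1)] sg_tri_norm[OF x'(2)]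
      by (intro divide_right_mono) auto
    finally show ?thesis .
  qed
  ultimately show ?thesis using assms unfolding small_walk_def
    by (intro conjI exI[of _ "sg_psiw w ` sg_tri"]) auto
qed

lemma tpath_tri: "H \<in> Cls n t \<Longrightarrow> vcr t p q \<Longrightarrow> set (tpath H (sg_u p) (sg_u q)) \<subseteq> sg_tri"
  using saw_V[OF tpath_saw, of H n t p q n] sg_V_tri sg_u_V[of p n] by (auto simp: Cls_def vcr_def)

lemma cwalk_props:
  assumes "cwalk n c \<pi>" "vc k c"
  shows "small_walk (2 / 2 ^ k) \<pi>" "hd \<pi> = cstart c" "last \<pi> = cend c"
proof -
  obtain w t p q where c: "c = (w, t, p, q)" by (metis prod.exhaust)
  have v: "vcr t p q" and w: "w \<in> sg_words k" using assms(2) by (auto simp: vc_def c)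
  obtain H where H: "H \<in> Cls n t" "\<pi> = map (sg_psiw w) (tpath H (sg_u p) (sg_u q))"
    using assms(1) by (auto simp: cwalk_def c)
  have s: "saw H (sg_u p) (sg_u q) (tpath H (sg_u p) (sg_u q))" by (rule tpath_saw[OF H(1) v])
  then show "small_walk (2 / 2 ^ k) \<pi>"
    unfolding H(2) by (intro small_walk_cell w tpath_tri[OF H(1) v]) (simp add: saw_iff)
  show "hd \<pi> = cstart c" "last \<pi> = cend c"
    using s by (auto simp: H(2) c cstart_def cend_def saw_iff hd_map last_map)
qed

lemma cwalk_chain:
  assumes "list_all2 (cwalk n) cs \<pi>s" "vchain k cs"
  shows "(\<forall>\<pi>\<in>set \<pi>s. small_walk (2 / 2 ^ k) \<pi>) \<and> successively (\<lambda>\<pi> \<rho>. last \<pi> = hd \<rho>) \<pi>s"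
  using assms
proof (induction rule: list_all2_induct)
  case (Cons c cs \<pi> \<pi>s)
  have vc: "vc k c" "vchain k cs" using Cons.prems by (auto simp: vchain_def successively_Cons)
  have "last \<pi> = hd (hd \<pi>s)" if "\<pi>s \<noteq> []"
  proof -
    obtain \<rho> r where r: "\<pi>s = \<rho> # r" using \<open>\<pi>s \<noteq> []\<close> by (cases \<pi>s) simp_all
    obtain d ds where d: "cs = d # ds" "cwalk n d \<rho>" using Cons.hyps(2) by (cases cs) (auto simp: r)
    have "cend c = cstart d" "vc k d" using Cons.prems by (auto simp: vchain_def d)
    then show ?thesis using cwalk_props(3)[OF Cons.hyps(1) vc(1)] cwalk_props(2)[OF d(2)] by (simp add: r)
  qed
  then show ?case
    using Cons.IH[OF vc(2)] cwalk_props(1)[OF Cons.hyps(1) vc(1)] by (auto simp: successively_Cons)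
qed simp

text \<open>Cells of level \<open>k\<close> have diameter at most \<open>2 / 2 ^ k\<close>, and two
  of them give the threshold. The bound is uniform in the starting time \<open>S\<close>.\<close>

lemma displacement_prob:
  assumes v: "vcr t p q" and S: "0 \<le> S"
    and b: "\<And>t p q. vcr t p q \<Longrightarrow> Ecr n t p q (\<lambda>\<pi>. of_bool (real (steps \<pi>) \<le> \<tau>)) \<le> b" and b0: "0 \<le> b"
  shows "Ecr (n + k) t p q (\<lambda>\<pi>. of_bool (\<exists>u. 0 \<le> u \<and> u \<le> \<tau> \<and> norm (LI \<pi> (S + u) - LI \<pi> S) > 4 / 2 ^ k)) \<le> b"
proof (rule Ecr_refine[OF _ v])
  fix ds assume ds: "vchain k ds" "ds \<noteq> []"
  have "Elist n ds (\<lambda>\<sigma>s. of_bool (\<exists>u. 0 \<le> u \<and> u \<le> \<tau> \<and> norm (LI (joinl \<sigma>s) (S + u) - LI (joinl \<sigma>s) S) > 4 / 2 ^ k))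
     \<le> Elist n ds (\<lambda>\<sigma>s. of_bool (next_fast (map steps \<sigma>s) S \<tau>))"
  proof (rule Elist_mono)
    fix \<sigma>s assume l: "list_all2 (cwalk n) ds \<sigma>s"
    have ne: "\<sigma>s \<noteq> []" using l ds by auto
    have "norm (LI (joinl \<sigma>s) (S + u) - LI (joinl \<sigma>s) S) \<le> 4 / 2 ^ k"
      if "\<not> next_fast (map steps \<sigma>s) S \<tau>" "0 \<le> u" "u \<le> \<tau>" for u
      using displacement_le[of "2 / 2 ^ k" u \<tau> \<sigma>s S] cwalk_chain[OF l ds(1)] that ne S by simp
    then have "next_fast (map steps \<sigma>s) S \<tau>"
      if "\<exists>u. 0 \<le> u \<and> u \<le> \<tau> \<and> norm (LI (joinl \<sigma>s) (S + u) - LI (joinl \<sigma>s) S) > 4 / 2 ^ k"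
      using that by (meson not_le)
    then show "of_bool (\<exists>u. 0 \<le> u \<and> u \<le> \<tau> \<and> norm (LI (joinl \<sigma>s) (S + u) - LI (joinl \<sigma>s) S) > 4 / 2 ^ k)
      \<le> (of_bool (next_fast (map steps \<sigma>s) S \<tau>) :: real)" by auto
  qed
  also have "\<dots> \<le> b"
    by (rule next_fast_prob[OF b b0]) (use ds in \<open>auto simp: vchain_def\<close>)
  finally show "Elist n ds (\<lambda>\<sigma>s. of_bool (\<exists>u. 0 \<le> u \<and> u \<le> \<tau> \<and> norm (LI (joinl \<sigma>s) (S + u) - LI (joinl \<sigma>s) S) > 4 / 2 ^ k)) \<le> b" .
qed

section \<open>Return to the starting corner\<close>

lemma LI_map_affine:
  assumes "\<forall>x. f x = b + c *\<^sub>R x" "xs \<noteq> []" "0 \<le> t"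
  shows "LI (map f xs) t = f (LI xs t)"
proof (cases "t < real (steps xs)")
  case True
  then have 1: "t < real (steps (map f xs))" by simp
  define k where "k = nat \<lfloor>t\<rfloor>"
  note l = LI_lt[OF assms(3) True, folded k_def] LI_lt[OF assms(3) 1, folded k_def]
  have kl: "Suc k < length xs" using l(2) by (simp add: steps_def)
  have "LI (map f xs) t = of_real (real k + 1 - t) * f (xs ! k) + of_real (t - real k) * f (xs ! Suc k)"
    using l(5) kl by simp
  also have "\<dots> = f (LI xs t)"
    unfolding l(1) using assms(1) by (simp add: scaleR_conv_of_real algebra_simps)
  finally show ?thesis .
next
  case False
  then show ?thesis using assms by (simp add: LI_ge last_map)
qed

text \<open>The walk starts in the cell of its starting corner and never comes back to it.\<close>

lemma off_first:
  assumes "vcr t p q"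
  shows "\<exists>j r. off tt p q = (p, p, j) # r \<and> r \<noteq> [] \<and> (\<forall>(a, i, l)\<in>set r. a \<noteq> p)"
  using assms sg_idx_third[of p q] unfolding vcr_def off_def Let_def by auto

lemma bary_1_away:
  assumes "a \<in> sg_idx" "a \<noteq> 1" "z \<in> sg_tri"
  shows "1 - bary 1 (sg_psi a z) \<ge> 1/2"
proof -
  have "bary 1 z \<le> 1" using assms(3) bary_sum[of z] by (auto simp: sg_tri_def sg_idx_def)
  then show ?thesis using bary_psi[of 1 a z] assms by (simp add: sg_idx_def)
qed

lemma convex_bary: "convex {z. 1 - bary 1 z \<ge> 1/2}"
proof -
  have "{z. 1 - bary 1 z \<ge> 1/2} = {z. inner (Complex 1 (1 / sqrt 3)) z \<ge> 1/2}"
    by (auto simp: bary_def inner_complex_def)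
  then show ?thesis by (simp only: convex_halfspace_ge)
qed

text \<open>Only the first child can come near the starting corner, since the other cells keep
  \<open>1 - bary 1\<close> at least 1/2; and \<open>sg_psi 1\<close> halves this quantity, so the
  first child poses the same problem with \<open>k\<close> smaller by one. For \<open>k = 0\<close>,
  a walk that has ended by time \<open>T\<close> rests at \<open>sg_u q\<close>, where
  \<open>bary 1\<close> is 0.\<close>

lemma return_prob:
  assumes b: "\<And>t p q. vcr t p q \<Longrightarrow> Ecr n t p q (\<lambda>\<pi>. of_bool (T < real (steps \<pi>))) \<le> b" and T: "0 \<le> T"
  shows "vcr t 1 q \<Longrightarrow> Ecr (n + k) t 1 q (\<lambda>\<pi>. of_bool (\<exists>u\<ge>T. 1 - bary 1 (LI \<pi> u) < 1 / 2 ^ k)) \<le> b"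
proof (induction k arbitrary: t q)
  case 0
  have "Ecr n t 1 q (\<lambda>\<pi>. of_bool (\<exists>u\<ge>T. 1 - bary 1 (LI \<pi> u) < 1)) \<le> Ecr n t 1 q (\<lambda>\<pi>. of_bool (T < real (steps \<pi>)))"
  proof (rule Ecr_mono)
    fix H assume H: "H \<in> Cls n t"
    let ?\<pi> = "tpath H (sg_u 1) (sg_u q)"
    have l: "last ?\<pi> = sg_u q" using tpath_saw[OF H 0] by (simp add: saw_iff)
    have "bary 1 (sg_u q) = 0" using 0 bary_u[of 1 q] by (auto simp: vcr_def)
    then have "\<not> 1 - bary 1 (LI ?\<pi> u) < 1" if "\<not> T < real (steps ?\<pi>)" "T \<le> u" for u
      using that l by (simp add: LI_ge)
    then show "of_bool (\<exists>u\<ge>T. 1 - bary 1 (LI ?\<pi> u) < 1) \<le> (of_bool (T < real (steps ?\<pi>)) :: real)" by auto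
  qed
  also have "\<dots> \<le> b" by (rule b[OF 0])
  finally show ?case by simp
next
  case (Suc k)
  have "Ecr (Suc (n + k)) t 1 q (\<lambda>\<pi>. of_bool (\<exists>u\<ge>T. 1 - bary 1 (LI \<pi> u) < 1 / 2 ^ Suc k)) \<le> b"
    unfolding Ecr_Suc[OF Suc.prems]
  proof (rule wt_average_le[OF vcr_le[OF Suc.prems]])
    fix tr assume tr: "tr \<in> set (goods t)"
    obtain x y z where xyz: "tr = (x, y, z)" by (metis prod.exhaust)
    obtain j r where o: "off (tri x y z) 1 q = (1, 1, j) # r" and rne: "r \<noteq> []" and r1: "\<forall>(a, i, l)\<in>set r. a \<noteq> 1"
      using off_first[OF Suc.prems] by blast
    define cs where "cs = map (\<lambda>(a, i, j). ([a], tri x y z a, i, j)) r"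
    have oc: "offc [] tr 1 q = ([1], x, 1, j) # cs" unfolding cs_def offc_def xyz prod.case o by simp
    have vcs: "vchain (Suc 0) (([1], x, 1, j) # cs)"
      using offc_chain(1)[OF tr Suc.prems, of "[]" 0] unfolding oc by (simp add: sg_words_def)
    have v: "vcr x 1 j" using vcs by (simp add: vchain_def vc_def)
    have "Elist (n + k) (offc [] tr 1 q) (\<lambda>\<pi>s. of_bool (\<exists>u\<ge>T. 1 - bary 1 (LI (joinl \<pi>s) u) < 1 / 2 ^ Suc k)) \<le>
       Elist (n + k) (offc [] tr 1 q) (\<lambda>\<pi>s. of_bool (\<exists>u\<ge>T. 1 - bary 1 (LI (hd \<pi>s) u) < 1 / 2 ^ Suc k))"
    proof (rule Elist_mono)
      fix \<pi>s assume l: "list_all2 (cwalk (n + k)) (offc [] tr 1 q) \<pi>s"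
      obtain \<pi> \<rho>s where p: "\<pi>s = \<pi> # \<rho>s" and lr: "list_all2 (cwalk (n + k)) cs \<rho>s"
        using l unfolding oc by (cases \<pi>s) auto
      have "\<rho>s \<noteq> []" using lr rne by (auto simp: cs_def)
      then obtain \<rho> r' where rr: "\<rho>s = \<rho> # r'" by (cases \<rho>s) auto
      have ch: "(\<forall>\<pi>\<in>set \<pi>s. small_walk (2 / 2 ^ Suc 0) \<pi>) \<and> successively (\<lambda>\<pi> \<rho>. last \<pi> = hd \<rho>) \<pi>s"
        by (rule cwalk_chain[OF l]) (use vcs oc in simp)
      have ne: "\<pi> \<noteq> []" "\<forall>\<rho>\<in>set \<rho>s. \<rho> \<noteq> []" "\<rho> \<noteq> []" "last \<pi> = hd \<rho>"
        using ch by (auto simp: p rr small_walk_def)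
      have away: "set (joinl \<rho>s) \<subseteq> {z. 1 - bary 1 z \<ge> 1/2}"
      proof
        fix v assume "v \<in> set (joinl \<rho>s)"
        then obtain \<rho>' where r': "\<rho>' \<in> set \<rho>s" "v \<in> set \<rho>'" using set_joinl[OF ne(2)] by blast
        then obtain c where c: "c \<in> set cs" "cwalk (n + k) c \<rho>'"
          using lr by (metis list_all2_conv_all_nth in_set_conv_nth)
        obtain a i l where ail: "(a, i, l) \<in> set r" "c = ([a], tri x y z a, i, l)" using c(1) by (auto simp: cs_def)
        have va: "vcr (tri x y z a) i l" "a \<in> sg_idx" using vcs c(1) unfolding ail(2) by (auto simp: vchain_def vc_def sg_words_def)
        obtain H where H: "H \<in> Cls (n + k) (tri x y z a)" "\<rho>' = map (sg_psi a) (tpath H (sg_u i) (sg_u l))"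
          using c(2) by (auto simp: cwalk_def ail(2))
        obtain v' where v': "v' \<in> sg_tri" "v = sg_psi a v'" using r'(2) tpath_tri[OF H(1) va(1)] by (auto simp: H(2))
        have "a \<noteq> 1" using r1 ail(1) by auto
        then show "v \<in> {z. 1 - bary 1 z \<ge> 1/2}" using bary_1_away[OF va(2) _ v'(1)] by (simp add: v'(2))
      qed
      have jne: "joinl \<rho>s \<noteq> []" using ne by (simp add: rr joinl_nonempty)
      have "1 - bary 1 (LI \<pi> u) < 1 / 2 ^ Suc k"
        if u: "T \<le> u" "1 - bary 1 (LI (joinl \<pi>s) u) < 1 / 2 ^ Suc k" for u
      proof (cases "u \<le> real (steps \<pi>)")
        case True
        then show ?thesis using LI_joinl[OF ne(1,3,4), of u r'] u T by (simp add: p rr)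
      next
        case False
        then have m1: "LI (joinl \<pi>s) u = LI (joinl \<rho>s) (u - real (steps \<pi>))"
          using LI_joinl[OF ne(1,3,4), of u r'] u T by (simp add: p rr)
        have "LI (joinl \<rho>s) (u - real (steps \<pi>)) \<in> {z. 1 - bary 1 z \<ge> 1/2}"
          by (rule LI_convex[OF convex_bary away jne]) (use False in simp)
        then have "1/2 \<le> 1 - bary 1 (LI (joinl \<pi>s) u)" unfolding m1 mem_Collect_eq .
        moreover have "1 / 2 ^ Suc k \<le> (1/2 :: real)" by (simp add: field_simps)
        ultimately show ?thesis using u(2) by linarith
      qed
      then show "of_bool (\<exists>u\<ge>T. 1 - bary 1 (LI (joinl \<pi>s) u) < 1 / 2 ^ Suc k) \<le>
        (of_bool (\<exists>u\<ge>T. 1 - bary 1 (LI (hd \<pi>s) u) < 1 / 2 ^ Suc k) :: real)" by (auto simp: p)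
    qed
    also have "\<dots> = Ecr (n + k) x 1 j (\<lambda>\<pi>. of_bool (\<exists>u\<ge>T. 1 - bary 1 (LI (map (sg_psi 1) \<pi>) u) < 1 / 2 ^ Suc k))"
    proof -
      have "\<forall>c\<in>set cs. vc (Suc 0) c" using vcs by (simp add: vchain_def)
      then show ?thesis unfolding oc by (simp add: Elist_const[of cs "Suc 0"])
    qed
    also have "\<dots> \<le> Ecr (n + k) x 1 j (\<lambda>\<pi>. of_bool (\<exists>u\<ge>T. 1 - bary 1 (LI \<pi> u) < 1 / 2 ^ k))"
    proof (rule Ecr_mono)
      fix H assume H: "H \<in> Cls (n + k) x"
      let ?\<pi> = "tpath H (sg_u 1) (sg_u j)"
      have ne: "?\<pi> \<noteq> []" using tpath_saw[OF H v] by (simp add: saw_iff)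
      have af: "\<forall>x. sg_psi 1 x = sg_u 1 / 2 + (1/2) *\<^sub>R x" by (simp add: sg_psi_def scaleR_conv_of_real field_simps)
      have "1 - bary 1 (LI ?\<pi> u) < 1 / 2 ^ k"
        if "T \<le> u" "1 - bary 1 (LI (map (sg_psi 1) ?\<pi>) u) < 1 / 2 ^ Suc k" for u
      proof -
        have e1: "LI (map (sg_psi 1) ?\<pi>) u = sg_psi 1 (LI ?\<pi> u)" using LI_map_affine[OF af ne] T that(1) by simp
        have e2: "bary 1 (sg_psi 1 (LI ?\<pi> u)) = bary 1 (LI ?\<pi> u) / 2 + 1/2"
          using bary_psi[of 1 1 "LI ?\<pi> u"] by (simp add: sg_idx_def)
        have e3: "(1 :: real) / 2 ^ Suc k = (1 / 2 ^ k) / 2" by simp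
        have "1 - (x / 2 + 1/2) < y / 2 \<Longrightarrow> 1 - x < y" for x y :: real by linarith
        then show ?thesis using that(2) unfolding e1 e2 e3 .
      qed
      then show "of_bool (\<exists>u\<ge>T. 1 - bary 1 (LI (map (sg_psi 1) ?\<pi>) u) < 1 / 2 ^ Suc k) \<le>
        (of_bool (\<exists>u\<ge>T. 1 - bary 1 (LI ?\<pi> u) < 1 / 2 ^ k) :: real)" by auto
    qed
    also have "\<dots> \<le> b" by (rule Suc.IH[OF v])
    finally show "Elist (n + k) (offc [] tr 1 q) (\<lambda>\<pi>s. of_bool (\<exists>u\<ge>T. 1 - bary 1 (LI (joinl \<pi>s) u) < 1 / 2 ^ Suc k)) \<le> b" .
  qed
  then show ?case by simp
qed

text \<open>Here \<open>1 - bary 1 z\<close> is \<open>Re z + Im z / sqrt 3\<close>, and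
  \<open>bary 2 z \<ge> 0\<close> bounds the second term by the first.\<close>

lemma norm_ge_bary:
  assumes "z \<in> sg_tri"
  shows "(1 - bary 1 z) / 2 \<le> norm z"
proof -
  have "(1 - bary 1 z) / 2 \<le> Re z" using assms by (simp add: bary_def sg_tri_def sg_idx_def field_simps)
  also have "\<dots> \<le> norm z" by (rule complex_Re_le_cmod)
  finally show ?thesis .
qed

section \<open>Scales\<close>

lemma gamma_facts:
  "abar powr gamma_l = 2" "abar powr gamma_r = 3" "0 < gamma_l" "gamma_l < 1" "1 < gamma_r"
proof -
  have l: "ln abar > 0" "abar > 0" using abar_bounds by auto
  show "abar powr gamma_l = 2" "abar powr gamma_r = 3"
    using l abar_bounds by (simp_all add: powr_def gamma_l_def gamma_r_def)
  show "0 < gamma_l" using l by (simp add: gamma_l_def)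
  have "ln 2 < ln abar" "ln abar < ln 3" using abar_bounds by (simp_all add: ln_less_cancel_iff)
  then show "gamma_l < 1" "1 < gamma_r" using l by (simp_all add: gamma_l_def gamma_r_def)
qed

lemma power_powr_commute: "0 < a \<Longrightarrow> (a ^ n) powr x = (a powr x) ^ n" for a x :: real
  by (simp add: powr_realpow[symmetric] powr_powr mult.commute)

lemma abar_power_powr: "(abar ^ j) powr gamma_l = 2 ^ j"
  using abar_bounds by (simp add: power_powr_commute gamma_facts)

lemma geometric_scale:
  fixes a y :: real
  assumes "1 < a" "1 \<le> y"
  shows "\<exists>m. y \<le> a ^ m \<and> a ^ m \<le> a * y"
proof -
  define m where "m = (LEAST m. y \<le> a ^ m)"
  have "\<exists>m. y \<le> a ^ m" using real_arch_pow[OF assms(1), of y] less_imp_le by blast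
  then have m: "y \<le> a ^ m" unfolding m_def by (rule LeastI_ex)
  have "a ^ m \<le> a * y"
  proof (cases m)
    case 0
    have "1 * 1 \<le> a * y" using assms by (intro mult_mono) auto
    then show ?thesis using 0 by simp
  next
    case (Suc m')
    then have "\<not> y \<le> a ^ m'" using not_less_Least[of m' "\<lambda>m. y \<le> a ^ m"] by (simp add: m_def)
    then show ?thesis using assms Suc by simp
  qed
  with m show ?thesis by blast
qed

lemma ln_ge_1: "3 \<le> j \<Longrightarrow> 1 \<le> ln (real j)"
proof -
  assume "3 \<le> j"
  then have "exp 1 \<le> real j" using exp_le by linarith
  then show ?thesis using \<open>3 \<le> j\<close> by (simp add: ln_ge_iff)
qed

text \<open>Choosing \<open>2 ^ m\<close> of order \<open>ln j\<close> leaves a tail exponent of at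
  most -\<open>2 ^ m / 160\<close>, that is at most \<open>- 2 * ln j\<close>, which makes the
  probabilities summable. The price is \<open>d = j - k\<close> levels with \<open>abar ^ d\<close>
  of order \<open>(abar / 2) ^ m\<close>, and the power \<open>gamma_l\<close> turns this into
  \<open>2 ^ (m * (1 - gamma_l))\<close>.\<close>

lemma scales_upper:
  "\<exists>C>0. \<forall>j\<ge>3. \<exists>k m. (k = 0 \<or> abar ^ (k + m) / (36 * abar ^ j) \<le> 2 ^ m / 160) \<and>
     320 * ln (real j) \<le> 2 ^ m \<and> 2 ^ j / 2 ^ k \<le> C * ln (real j) powr (1 - gamma_l)"
proof (rule exI[where x = "(5 * abar) powr gamma_l * 640 powr (1 - gamma_l)"], intro conjI allI impI)
  note ab = abar_bounds gamma_facts
  show "(5 * abar) powr gamma_l * 640 powr (1 - gamma_l) > 0" using ab by simp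
  fix j :: nat assume j: "3 \<le> j"
  have lj: "1 \<le> ln (real j)" by (rule ln_ge_1[OF j])
  obtain m where m: "320 * ln (real j) \<le> 2 ^ m" "2 ^ m \<le> 2 * (320 * ln (real j))"
    using geometric_scale[of 2 "320 * ln (real j)"] lj by auto
  have y: "1 \<le> (abar / 2) ^ m" using ab by (intro one_le_power) simp
  obtain d where d: "5 * (abar / 2) ^ m \<le> abar ^ d" "abar ^ d \<le> abar * (5 * (abar / 2) ^ m)"
    using geometric_scale[of abar "5 * (abar / 2) ^ m"] ab y by auto
  \<comment> \<open>Truncated subtraction: for \<open>d \<ge> j\<close> this is level 0, where the
    displacement exceeds the threshold for no walk. The factor 5 in the choice of \<open>d\<close>
    is large enough since 36 * 5 \<ge> 160.\<close>
  define k where "k = j - d"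
  have A: "k = 0 \<or> abar ^ (k + m) / (36 * abar ^ j) \<le> 2 ^ m / 160"
  proof (cases "k = 0")
    case False
    then have "j = k + d" by (simp add: k_def)
    then have "abar ^ (k + m) / (36 * abar ^ j) = abar ^ m / (36 * abar ^ d)"
      using ab by (simp add: power_add)
    also have "\<dots> \<le> abar ^ m / (36 * (5 * (abar / 2) ^ m))"
      using d(1) ab by (intro divide_left_mono mult_left_mono mult_pos_pos) auto
    also have "\<dots> = 2 ^ m / 180" using ab by (simp add: power_divide)
    also have "\<dots> \<le> 2 ^ m / 160" by (simp add: divide_left_mono)
    finally show ?thesis by simp
  qed simp
  have "2 ^ j \<le> (2::real) ^ (k + d)" by (rule power_increasing) (auto simp: k_def)
  then have "2 ^ j / 2 ^ k \<le> (2::real) ^ d" by (simp add: power_add divide_le_eq mult.commute)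
  also have "\<dots> = (abar ^ d) powr gamma_l" by (simp add: abar_power_powr)
  also have "\<dots> \<le> (abar * (5 * (abar / 2) ^ m)) powr gamma_l"
    using d(2) ab by (intro powr_mono2) auto
  also have "\<dots> = (5 * abar) powr gamma_l * ((abar / 2) ^ m) powr gamma_l"
    using ab by (subst powr_mult[symmetric]) (auto simp: mult_ac)
  also have "((abar / 2) ^ m) powr gamma_l = (2 ^ m) powr (1 - gamma_l)"
    using ab by (simp add: power_divide powr_divide abar_power_powr powr_diff)
  also have "(2 ^ m) powr (1 - gamma_l) \<le> (640 * ln (real j)) powr (1 - gamma_l)"
    using m(2) ab by (intro powr_mono2) auto
  also have "\<dots> = 640 powr (1 - gamma_l) * ln (real j) powr (1 - gamma_l)"
    using lj by (simp add: powr_mult)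
  finally have "2 ^ j / 2 ^ k \<le> (5 * abar) powr gamma_l * 640 powr (1 - gamma_l) * ln (real j) powr (1 - gamma_l)"
    using ab by (simp add: mult.assoc)
  with A m(1) show "\<exists>k m. (k = 0 \<or> abar ^ (k + m) / (36 * abar ^ j) \<le> 2 ^ m / 160) \<and> 320 * ln (real j) \<le> 2 ^ m \<and>
     2 ^ j / 2 ^ k \<le> (5 * abar) powr gamma_l * 640 powr (1 - gamma_l) * ln (real j) powr (1 - gamma_l)"
    by (intro exI[of _ k] exI[of _ m] conjI)
qed

text \<open>With \<open>3 ^ m\<close> of order \<open>ln j\<close>, the exponent
  \<open>3 ^ m / 24 - 3 ^ m / 12\<close> is at most \<open>- 2 * ln j\<close>. The level exceeds
  \<open>Suc j\<close> by \<open>d\<close> with \<open>abar ^ d\<close> of order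
  \<open>(3 / abar) ^ m\<close>, where 9 = 108 / 12, and \<open>(3 / abar) ^ m\<close> is the power
  \<open>1 - 1 / gamma_r\<close> of \<open>3 ^ m\<close>.\<close>

lemma scales_lower:
  "\<exists>C>0. \<forall>j\<ge>3. \<exists>k m. 48 * ln (real j) \<le> 3 ^ m \<and> 3 ^ m / 12 \<le> abar ^ (k + m) / (108 * abar ^ Suc j) \<and>
     C * ln (real j) powr (- gamma_l * (1 - 1 / gamma_r)) \<le> 2 ^ j / 2 ^ k"
proof -
  note ab = abar_bounds gamma_facts
  define b where "b = gamma_l * (1 - 1 / gamma_r)"
  have b0: "0 \<le> b" using ab by (simp add: b_def)
  define D where "D = (9 * abar) powr gamma_l * 144 powr b"
  have D0: "0 < D" using ab by (simp add: D_def)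
  have "\<exists>k m. 48 * ln (real j) \<le> 3 ^ m \<and> 3 ^ m / 12 \<le> abar ^ (k + m) / (108 * abar ^ Suc j) \<and>
     1 / (2 * D) * ln (real j) powr (- gamma_l * (1 - 1 / gamma_r)) \<le> 2 ^ j / 2 ^ k" if j: "3 \<le> j" for j :: nat
  proof -
    have lj: "1 \<le> ln (real j)" by (rule ln_ge_1[OF j])
    obtain m where m: "48 * ln (real j) \<le> 3 ^ m" "3 ^ m \<le> 3 * (48 * ln (real j))"
      using geometric_scale[of 3 "48 * ln (real j)"] lj by auto
    have y: "1 \<le> (3 / abar) ^ m" using ab by (intro one_le_power) simp
    obtain d where d: "9 * (3 / abar) ^ m \<le> abar ^ d" "abar ^ d \<le> abar * (9 * (3 / abar) ^ m)"
      using geometric_scale[of abar "9 * (3 / abar) ^ m"] ab y by auto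
    define k where "k = Suc j + d"
    have "3 ^ m / 12 = (9 * (3 / abar) ^ m) * abar ^ m / 108" using ab by (simp add: power_divide)
    also have "\<dots> \<le> abar ^ d * abar ^ m / 108" using d(1) ab by (intro divide_right_mono mult_right_mono) auto
    also have "\<dots> = abar ^ (k + m) / (108 * abar ^ Suc j)" using ab by (simp add: k_def power_add)
    finally have A: "3 ^ m / 12 \<le> abar ^ (k + m) / (108 * abar ^ Suc j)" .
    have am: "abar ^ m = (3 ^ m) powr (1 / gamma_r)"
    proof -
      have "gamma_r * (1 / gamma_r) = 1" using gamma_facts(5) by simp
      then have "(abar powr gamma_r) powr (1 / gamma_r) = abar" using abar_bounds by (simp only: powr_powr) simp
      then have "3 powr (1 / gamma_r) = abar" unfolding gamma_facts(2) .
      then show ?thesis by (simp add: power_powr_commute)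
    qed
    have "(2::real) ^ d = (abar ^ d) powr gamma_l" by (simp add: abar_power_powr)
    also have "\<dots> \<le> (abar * (9 * (3 / abar) ^ m)) powr gamma_l"
      using d(2) ab by (intro powr_mono2) auto
    also have "\<dots> = (9 * abar) powr gamma_l * ((3 / abar) ^ m) powr gamma_l"
      using ab by (subst powr_mult[symmetric]) (auto simp: mult_ac)
    also have "(3 / abar) ^ m = (3 ^ m) powr (1 - 1 / gamma_r)"
      unfolding power_divide am by (simp add: powr_diff)
    also have "((3 ^ m) powr (1 - 1 / gamma_r)) powr gamma_l = (3 ^ m) powr b"
      by (simp add: powr_powr b_def mult.commute)
    also have "(3 ^ m) powr b \<le> (144 * ln (real j)) powr b"
      using m(2) b0 by (intro powr_mono2) auto
    also have "\<dots> = 144 powr b * ln (real j) powr b"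
      using lj by (simp add: powr_mult)
    finally have d2: "2 ^ d \<le> D * ln (real j) powr b" using ab by (simp add: mult.assoc D_def)
    have "1 / (2 * D) * ln (real j) powr (- b) = 1 / (2 * (D * ln (real j) powr b))"
      by (simp add: powr_minus field_simps)
    also have "\<dots> \<le> 1 / (2 * 2 ^ d)"
    proof (intro divide_left_mono mult_pos_pos)
      show "2 * 2 ^ d \<le> 2 * (D * ln (real j) powr b)" using d2 by simp
    qed (use D0 lj in auto)
    also have "\<dots> = 2 ^ j / 2 ^ k" by (simp add: k_def power_add)
    finally have "1 / (2 * D) * ln (real j) powr (- gamma_l * (1 - 1 / gamma_r)) \<le> 2 ^ j / 2 ^ k"
      by (simp add: b_def)
    with A m(1) show ?thesis by (intro exI[of _ k] exI[of _ m] conjI)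
  qed
  moreover have "0 < 1 / (2 * D)" using D0 by simp
  ultimately show ?thesis by blast
qed

lemma time_scale:
  assumes "0 < t" "t \<le> 1"
  shows "\<exists>j. 1 / abar ^ Suc j \<le> t \<and> t \<le> 1 / abar ^ j"
proof -
  note ab = abar_bounds
  define j where "j = (LEAST j. 1 / abar ^ Suc j \<le> t)"
  obtain i where "1 / t < abar ^ i" using real_arch_pow[of abar "1 / t"] ab by auto
  also have "abar ^ i \<le> abar ^ Suc i" using ab by (intro power_increasing) auto
  finally have "1 / abar ^ Suc i \<le> t" using assms ab by (simp add: field_simps)
  then have 1: "1 / abar ^ Suc j \<le> t" unfolding j_def by (rule LeastI)
  have 2: "t \<le> 1 / abar ^ j"
  proof (cases j)
    case (Suc j')
    then have "\<not> 1 / abar ^ Suc j' \<le> t" using not_less_Least[of j' "\<lambda>j. 1 / abar ^ Suc j \<le> t"] by (simp add: j_def)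
    then show ?thesis using Suc by simp
  qed (use assms in simp)
  show ?thesis using 1 2 by blast
qed

lemma time_scale_small:
  assumes "0 < t" "t < 1 / abar ^ Suc l"
  shows "\<exists>j\<ge>l. 1 / abar ^ Suc j \<le> t \<and> t \<le> 1 / abar ^ j"
proof -
  note ab = abar_bounds
  have "1 / abar ^ Suc l \<le> 1 / 1" using ab by (intro divide_left_mono one_le_power) auto
  then have "t \<le> 1" using assms by linarith
  then obtain j where j: "1 / abar ^ Suc j \<le> t" "t \<le> 1 / abar ^ j"
    using time_scale[OF assms(1)] by blast
  have "l \<le> j"
  proof (rule ccontr)
    assume "\<not> l \<le> j"
    then have "abar ^ Suc j \<le> abar ^ Suc l" using ab by (intro power_increasing) auto
    then have "1 / abar ^ Suc l \<le> 1 / abar ^ Suc j" using ab by (intro divide_left_mono) auto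
    then show False using assms j by linarith
  qed
  then show ?thesis using j by blast
qed

text \<open>It suffices that \<open>ln (1 / t) \<ge> sqrt j\<close>. This follows from
  \<open>ln (1 / t) \<ge> j * ln abar \<ge> j / 2\<close> as soon as
  \<open>j \<ge> 4\<close>.\<close>

lemma loglog_scale:
  assumes j: "3 \<le> j" and t: "0 < t" "t \<le> 1 / abar ^ j"
  shows "ln (real j) / 2 \<le> ln (ln (1 / t))"
proof -
  note ab = abar_bounds
  have "real j * (1/2) \<le> real j * ln abar"
  proof (rule mult_left_mono)
    have "ln 2 \<le> ln abar" using ab by simp
    moreover have "ln (2::real) \<ge> 1/2" using ln2_ge_two_thirds by linarith
    ultimately show "1/2 \<le> ln abar" by linarith
  qed simp
  also have "real j * ln abar = ln (abar ^ j)" using ab by (simp add: ln_realpow)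
  also have "\<dots> \<le> ln (1 / t)"
  proof -
    have "abar ^ j \<le> 1 / t" using t ab by (simp add: field_simps)
    moreover have "0 < abar ^ j" "0 < 1 / t" using ab t by simp_all
    ultimately show ?thesis by (simp only: ln_le_cancel_iff)
  qed
  finally have 1: "real j / 2 \<le> ln (1 / t)" by simp
  have "sqrt (real j) \<le> ln (1 / t)" if "4 \<le> j"
  proof -
    have "sqrt (real j) * 2 \<le> sqrt (real j) * sqrt (real j)"
      using that by (intro mult_left_mono real_le_rsqrt) auto
    then show ?thesis using 1 by simp
  qed
  \<comment> \<open>Here \<open>j / 2\<close> falls short of \<open>sqrt 3\<close>; instead
    \<open>abar > 2\<close> gives \<open>3 * ln 2 \<ge> 2\<close>.\<close>
  moreover have "sqrt (real j) \<le> ln (1 / t)" if "j = 3"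
  proof -
    have "ln 8 \<le> ln (abar ^ 3)"
      using power_mono[of 2 abar 3] ab by simp
    also have "\<dots> \<le> ln (1 / t)"
    proof -
      have "abar ^ 3 \<le> 1 / t" using t ab that by (simp add: field_simps)
      moreover have "0 < abar ^ 3" "0 < 1 / t" using ab t by simp_all
      ultimately show ?thesis by (simp only: ln_le_cancel_iff)
    qed
    finally have "ln 8 \<le> ln (1 / t)" .
    moreover have "ln (8::real) = 3 * ln 2" using ln_realpow[of 2 3] by simp
    moreover have "sqrt 3 \<le> 2" by (rule real_le_lsqrt) auto
    ultimately show ?thesis using ln2_ge_two_thirds that by simp
  qed
  ultimately have "sqrt (real j) \<le> ln (1 / t)" using j by (cases "j = 3") auto
  moreover have p: "0 < sqrt (real j)" using j by simp
  moreover have "0 < ln (1 / t)" using calculation by linarith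
  ultimately have "ln (sqrt (real j)) \<le> ln (ln (1 / t))" by (simp only: ln_le_cancel_iff)
  then show ?thesis using j by (simp add: ln_sqrt)
qed

section \<open>Tail estimates for the rescaled walk\<close>

lemma vcr_012: "vcr 0 1 2"
  by (simp add: vcr_def pc_def sg_idx_def)

text \<open>Quantifying over all \<open>u\<close> up to the rescaled time makes the event increasing
  in \<open>t\<close>, so a geometric sequence of times controls all times in between;
  \<open>slow_walk\<close> covers all later times for the same reason.\<close>

definition fast_walk :: "nat \<Rightarrow> nat \<Rightarrow> real \<Rightarrow> real \<Rightarrow> complex list \<Rightarrow> bool" where
  "fast_walk n k s t \<pi> \<longleftrightarrow>
     (\<exists>u. 0 \<le> u \<and> u \<le> abar ^ n * t \<and> norm (LI \<pi> (abar ^ n * s + u) - LI \<pi> (abar ^ n * s)) > 4 / 2 ^ k)"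

definition slow_walk :: "nat \<Rightarrow> nat \<Rightarrow> real \<Rightarrow> complex list \<Rightarrow> bool" where
  "slow_walk n k t \<pi> \<longleftrightarrow> (\<exists>u\<ge>abar ^ n * t. 1 - bary 1 (LI \<pi> u) < 1 / 2 ^ k)"

text \<open>The \<open>n\<close> generations are split in three: \<open>k\<close> locate the cells,
  \<open>m\<close> produce the factor \<open>2 ^ m\<close> in the exponent, and the remaining
  \<open>i\<close> only rescale time.\<close>

lemma fast_walk_prob:
  assumes "0 \<le> s" "0 \<le> t" "k + m \<le> n"
  shows "Ecr n 0 1 2 (\<lambda>\<pi>. of_bool (fast_walk n k s t \<pi>)) \<le> exp (abar ^ (k + m) * t / 36 - 2 ^ m / 80)"
proof -
  note ab = abar_bounds
  define i where "i = n - k - m"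
  have n: "n = i + m + k" using assms by (simp add: i_def)
  have "Ecr (i + m) t' p q (\<lambda>\<pi>. of_bool (real (steps \<pi>) \<le> abar ^ n * t)) \<le> exp (abar ^ (k + m) * t / 36 - 2 ^ m / 80)"
    if "vcr t' p q" for t' p q
  proof -
    have "abar ^ n * t / (36 * abar ^ i) = abar ^ (k + m) * t / 36"
      using ab by (simp add: n power_add)
    then show ?thesis using steps_lower_tail[OF that, of i m "abar ^ n * t"] by (simp only:)
  qed
  from displacement_prob[OF vcr_012 _ this, of "abar ^ n * s" k] show ?thesis
    using assms ab unfolding fast_walk_def n by simp
qed

lemma slow_walk_prob:
  assumes "0 \<le> t" "k + m \<le> n"
  shows "Ecr n 0 1 2 (\<lambda>\<pi>. of_bool (slow_walk n k t \<pi>)) \<le> exp (3 ^ m / 24 - abar ^ (k + m) * t / 108)"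
proof -
  note ab = abar_bounds
  define i where "i = n - k - m"
  have n: "n = i + m + k" using assms by (simp add: i_def)
  have "Ecr (i + m) t' p q (\<lambda>\<pi>. of_bool (abar ^ n * t < real (steps \<pi>))) \<le> exp (3 ^ m / 24 - abar ^ (k + m) * t / 108)"
    if "vcr t' p q" for t' p q
  proof -
    have "abar ^ n * t / (108 * abar ^ i) = abar ^ (k + m) * t / 108"
      using ab by (simp add: n power_add)
    then show ?thesis using steps_upper_tail[OF that, of i m "abar ^ n * t"] by (simp only:)
  qed
  from return_prob[OF this _ vcr_012, of k] show ?thesis
    using assms ab unfolding slow_walk_def n by simp
qed

lemma tpath_LI_tri:
  assumes "H \<in> Cls n 0" "0 \<le> t"
  shows "LI (tpath H (sg_u 1) (sg_u 2)) t \<in> sg_tri"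
  using LI_convex[OF convex_sg_tri tpath_tri[OF assms(1) vcr_012]] tpath_saw[OF assms(1) vcr_012] assms(2)
  by (simp add: saw_iff)

lemma norm_LI_diff_le:
  assumes "H \<in> Cls n 0" "0 \<le> s" "0 \<le> t"
  shows "norm (LI (tpath H (sg_u 1) (sg_u 2)) s - LI (tpath H (sg_u 1) (sg_u 2)) t) \<le> 2"
  using norm_triangle_ineq4[of "LI (tpath H (sg_u 1) (sg_u 2)) s" "LI (tpath H (sg_u 1) (sg_u 2)) t"]
    sg_tri_norm[OF tpath_LI_tri[OF assms(1,2)]] sg_tri_norm[OF tpath_LI_tri[OF assms(1,3)]] by simp

lemma moment_series:
  fixes p :: real
  shows "summable (\<lambda>i::nat. (2 * 2 ^ i) powr p * exp (1/36 - 2 ^ i / 80))"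
proof (rule summable_comparison_test_bigo)
  show "summable (\<lambda>i. norm ((1/2 :: real) ^ i))" by (simp add: summable_geometric)
  show "(\<lambda>i::nat. (2 * 2 ^ i) powr p * exp (1/36 - 2 ^ i / 80)) \<in> O(\<lambda>i. (1/2) ^ i)"
    by real_asymp
qed

text \<open>A sum over dyadic sizes of the displacement: for \<open>t\<close> of order
  \<open>abar ^ (- j)\<close>, size \<open>2 ^ (- k)\<close> with \<open>i\<close> levels between
  \<open>k\<close> and \<open>j\<close> costs a factor \<open>exp (- 2 ^ i / 80)\<close>, which
  outweighs the gain \<open>2 ^ (i * p)\<close>.\<close>

lemma walk_moment_upper:
  assumes p: "0 < p"
  shows "\<exists>C>0. \<forall>s\<ge>0. \<forall>t. 0 < t \<longrightarrow> t \<le> 1 \<longrightarrow> (\<forall>\<^sub>F n in sequentially.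
     Ecr n 0 1 2 (\<lambda>\<pi>. norm (LI \<pi> (abar ^ n * (s + t)) - LI \<pi> (abar ^ n * s)) powr p) \<le> C * t powr (p * gamma_l))"
proof (intro exI conjI allI impI)
  note ab = abar_bounds gamma_facts
  define f where "f i = (2 * 2 ^ i) powr p * exp (1/36 - 2 ^ i / 80)" for i :: nat
  have f0: "0 \<le> f i" for i by (simp add: f_def)
  define C where "C = 4 powr p * (1 + suminf f) * 2 powr p"
  have sf: "0 \<le> suminf f" using moment_series[of p] f0 unfolding f_def by (intro suminf_nonneg) auto
  then show "0 < C" by (simp add: C_def)
  fix s t :: real assume s: "0 \<le> s" and t: "0 < t" "t \<le> 1"
  obtain j where j: "1 / abar ^ Suc j \<le> t" "t \<le> 1 / abar ^ j" using time_scale[OF t] by blast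
  show "\<forall>\<^sub>F n in sequentially.
     Ecr n 0 1 2 (\<lambda>\<pi>. norm (LI \<pi> (abar ^ n * (s + t)) - LI \<pi> (abar ^ n * s)) powr p) \<le> C * t powr (p * gamma_l)"
    using eventually_ge_at_top[of j]
  proof eventually_elim
    case (elim n)
    define g where "g \<pi> = norm (LI \<pi> (abar ^ n * (s + t)) - LI \<pi> (abar ^ n * s))" for \<pi>
    \<comment> \<open>If \<open>fast_walk\<close> fails at level \<open>Suc K\<close>, the first
      term alone is a bound; if it holds, the summand for \<open>K\<close> equals the first term of
      the previous bound.\<close>
    have pw: "g (tpath H (sg_u 1) (sg_u 2)) powr p \<le> (4 / 2 ^ K) powr p +
        (\<Sum>k\<leftarrow>[0..<K]. (4 / 2 ^ k) powr p * of_bool (fast_walk n (Suc k) s t (tpath H (sg_u 1) (sg_u 2))))"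
      if H: "H \<in> Cls n 0" for H K
    proof (induction K)
      case 0
      have "g (tpath H (sg_u 1) (sg_u 2)) \<le> 4"
        using norm_LI_diff_le[OF H, of "abar ^ n * (s + t)" "abar ^ n * s"] s t ab by (simp add: g_def)
      then show ?case using p by (simp add: g_def powr_mono2)
    next
      case (Suc K)
      let ?\<pi> = "tpath H (sg_u 1) (sg_u 2)"
      show ?case
      proof (cases "fast_walk n (Suc K) s t ?\<pi>")
        case True
        have "(\<Sum>k\<leftarrow>[0..<Suc K]. (4 / 2 ^ k) powr p * of_bool (fast_walk n (Suc k) s t ?\<pi>)) =
          (\<Sum>k\<leftarrow>[0..<K]. (4 / 2 ^ k) powr p * of_bool (fast_walk n (Suc k) s t ?\<pi>)) + (4 / 2 ^ K) powr p"
          using True by simp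
        moreover have "0 \<le> (4 / 2 ^ Suc K :: real) powr p" by simp
        ultimately show ?thesis using Suc by linarith
      next
        case False
        have "g ?\<pi> \<le> 4 / 2 ^ Suc K"
        proof (rule ccontr)
          assume "\<not> g ?\<pi> \<le> 4 / 2 ^ Suc K"
          then have "fast_walk n (Suc K) s t ?\<pi>"
            unfolding fast_walk_def g_def distrib_left using t ab by (intro exI[of _ "abar ^ n * t"]) auto
          then show False using False by simp
        qed
        then have "g ?\<pi> powr p \<le> (4 / 2 ^ Suc K) powr p" using p by (intro powr_mono2) (auto simp: g_def)
        moreover have "0 \<le> (\<Sum>k\<leftarrow>[0..<Suc K]. (4 / 2 ^ k) powr p * (of_bool (fast_walk n (Suc k) s t ?\<pi>) :: real))"
          by (intro sum_list_nonneg) auto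
        ultimately show ?thesis by linarith
      qed
    qed
    have "Ecr n 0 1 2 (\<lambda>\<pi>. g \<pi> powr p) \<le> Ecr n 0 1 2 (\<lambda>\<pi>. (4 / 2 ^ j) powr p +
        (\<Sum>k\<leftarrow>[0..<j]. (4 / 2 ^ k) powr p * of_bool (fast_walk n (Suc k) s t \<pi>)))"
      by (rule Ecr_mono) (rule pw)
    also have "\<dots> = Ecr n 0 1 2 (\<lambda>\<pi>. (4 / 2 ^ j) powr p) +
        Ecr n 0 1 2 (\<lambda>\<pi>. \<Sum>k\<leftarrow>[0..<j]. (4 / 2 ^ k) powr p * of_bool (fast_walk n (Suc k) s t \<pi>))"
      unfolding Ecr_def by (simp add: sum.distrib add_divide_distrib)
    also have "\<dots> = (4 / 2 ^ j) powr p + (\<Sum>k\<leftarrow>[0..<j]. (4 / 2 ^ k) powr p * Ecr n 0 1 2 (\<lambda>\<pi>. of_bool (fast_walk n (Suc k) s t \<pi>)))"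
      by (simp add: Ecr_const Ecr_sum_list Ecr_cmult)
    also have "(\<Sum>k\<leftarrow>[0..<j]. (4 / 2 ^ k) powr p * Ecr n 0 1 2 (\<lambda>\<pi>. of_bool (fast_walk n (Suc k) s t \<pi>)))
        \<le> (\<Sum>k\<leftarrow>[0..<j]. (4 / 2 ^ j) powr p * f (j - Suc k))"
    proof (rule sum_list_mono)
      fix k assume "k \<in> set [0..<j]"
      then have k: "k < j" by simp
      \<comment> \<open>With \<open>i\<close> further generations the level is exactly
        \<open>j\<close>, so \<open>abar ^ j * t \<le> 1\<close> leaves only 1/36 as the positive
        part of the exponent.\<close>
      define i where "i = j - Suc k"
      have ji: "j = Suc k + i" using k by (simp add: i_def)
      have "Ecr n 0 1 2 (\<lambda>\<pi>. of_bool (fast_walk n (Suc k) s t \<pi>)) \<le> exp (abar ^ (Suc k + i) * t / 36 - 2 ^ i / 80)"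
        by (rule fast_walk_prob) (use s t elim ji in auto)
      also have "\<dots> \<le> exp (1/36 - 2 ^ i / 80)"
      proof -
        have "abar ^ j * t \<le> 1" using j(2) ab by (simp add: field_simps)
        then show ?thesis by (simp add: ji)
      qed
      finally have "(4 / 2 ^ k) powr p * Ecr n 0 1 2 (\<lambda>\<pi>. of_bool (fast_walk n (Suc k) s t \<pi>))
         \<le> (4 / 2 ^ k) powr p * exp (1/36 - 2 ^ i / 80)" by (rule mult_left_mono) simp
      also have "(4 / 2 ^ k) powr p * exp (1/36 - 2 ^ i / 80) = (4 / 2 ^ j) powr p * f i"
      proof -
        have "(4::real) / 2 ^ k = (4 / 2 ^ j) * (2 * 2 ^ i)" by (simp add: ji power_add)
        then show ?thesis by (simp only: f_def powr_mult mult.assoc)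
      qed
      finally show "(4 / 2 ^ k) powr p * Ecr n 0 1 2 (\<lambda>\<pi>. of_bool (fast_walk n (Suc k) s t \<pi>))
         \<le> (4 / 2 ^ j) powr p * f (j - Suc k)" by (simp add: i_def)
    qed
    also have "(\<Sum>k\<leftarrow>[0..<j]. (4 / 2 ^ j) powr p * f (j - Suc k)) = (4 / 2 ^ j) powr p * (\<Sum>i<j. f i)"
    proof -
      have "(\<Sum>k\<leftarrow>[0..<j]. (4 / 2 ^ j) powr p * f (j - Suc k)) = (\<Sum>k<j. (4 / 2 ^ j) powr p * f (j - Suc k))"
        by (simp add: sum_list_distinct_conv_sum_set lessThan_atLeast0)
      also have "\<dots> = (\<Sum>i<j. (4 / 2 ^ j) powr p * f i)"
        by (rule sum.nat_diff_reindex)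
      finally show ?thesis by (simp add: sum_distrib_left)
    qed
    also have "(4 / 2 ^ j) powr p + (4 / 2 ^ j) powr p * (\<Sum>i<j. f i) = (4 / 2 ^ j) powr p * (1 + (\<Sum>i<j. f i))"
      by (simp add: distrib_left)
    also have "\<dots> \<le> (4 / 2 ^ j) powr p * (1 + suminf f)"
      using moment_series[of p] f0 unfolding f_def[symmetric]
      by (intro mult_left_mono add_left_mono sum_le_suminf) auto
    also have "(4 / 2 ^ j) powr p = 4 powr p * ((1 / 2 ^ Suc j) powr p * 2 powr p)"
      by (simp add: powr_mult[symmetric])
    also have "(1 / 2 ^ Suc j) powr p \<le> t powr (p * gamma_l)"
    proof -
      have "(1 / abar ^ Suc j) powr (p * gamma_l) \<le> t powr (p * gamma_l)"
        using j(1) ab p by (intro powr_mono2) auto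
      moreover have "(1 / abar ^ Suc j) powr (p * gamma_l) = (1 / 2 ^ Suc j) powr p"
      proof -
        have "(1 / abar ^ Suc j) powr gamma_l = 1 / 2 ^ Suc j"
          unfolding powr_divide abar_power_powr by simp
        then show ?thesis by (metis mult.commute powr_powr)
      qed
      ultimately show ?thesis by simp
    qed
    finally have "Ecr n 0 1 2 (\<lambda>\<pi>. g \<pi> powr p) \<le> 4 powr p * (t powr (p * gamma_l) * 2 powr p) * (1 + suminf f)"
      using sf by (simp add: mult_right_mono)
    then show ?case by (simp add: C_def g_def mult_ac)
  qed
qed

lemma walk_moment_lower:
  assumes p: "0 < p"
  shows "\<exists>C>0. \<forall>t. 0 < t \<longrightarrow> t \<le> 1 \<longrightarrow> (\<forall>\<^sub>F n in sequentially.
     C * t powr (p * gamma_l) \<le> Ecr n 0 1 2 (\<lambda>\<pi>. norm (LI \<pi> (abar ^ n * t)) powr p))"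
proof (intro exI conjI allI impI)
  note ab = abar_bounds gamma_facts
  define C where "C = (1/2) * ((1/2) powr p * (1 / (216 * abar)) powr (p * gamma_l))"
  show "0 < C" using ab by (simp add: C_def)
  fix t :: real assume t: "0 < t" "t \<le> 1"
  \<comment> \<open>Since 216 = 2 * 108, the tail bound with \<open>m = 0\<close> has exponent at
    most 1/24 - 2, so the walk is away from the starting corner with probability at least
    1/2.\<close>
  obtain k where k: "216 / t \<le> abar ^ k" "abar ^ k \<le> abar * (216 / t)"
    using geometric_scale[of abar "216 / t"] ab t by (auto simp: le_divide_eq)
  show "\<forall>\<^sub>F n in sequentially.
     C * t powr (p * gamma_l) \<le> Ecr n 0 1 2 (\<lambda>\<pi>. norm (LI \<pi> (abar ^ n * t)) powr p)"
    using eventually_ge_at_top[of k]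
  proof eventually_elim
    case (elim n)
    define c where "c = ((1/2) * (1 / 2 ^ k)) powr p"
    have "Ecr n 0 1 2 (\<lambda>\<pi>. of_bool (slow_walk n k t \<pi>)) \<le> exp (3 ^ 0 / 24 - abar ^ (k + 0) * t / 108)"
      by (rule slow_walk_prob) (use t elim in auto)
    also have "\<dots> \<le> exp (- 1)"
      using k(1) t by (simp add: divide_le_eq)
    also have "\<dots> \<le> 1/2"
    proof -
      have "2 \<le> exp (1::real)" using exp_ge_add_one_self[of 1] by simp
      then show ?thesis by (simp add: exp_minus inverse_eq_divide divide_le_eq)
    qed
    finally have P: "Ecr n 0 1 2 (\<lambda>\<pi>. of_bool (slow_walk n k t \<pi>)) \<le> 1/2" .
    have "C * t powr (p * gamma_l) = (1/2) * ((1/2) powr p * (t / (216 * abar)) powr (p * gamma_l))"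
      using t ab by (simp add: C_def powr_divide)
    also have "(t / (216 * abar)) powr (p * gamma_l) \<le> (1 / abar ^ k) powr (p * gamma_l)"
      using k(2) t ab p by (intro powr_mono2) (auto simp: field_simps)
    also have "(1 / abar ^ k) powr (p * gamma_l) = (1 / 2 ^ k) powr p"
    proof -
      have "(1 / abar ^ k) powr gamma_l = 1 / 2 ^ k"
        unfolding powr_divide abar_power_powr by simp
      then show ?thesis by (metis mult.commute powr_powr)
    qed
    also have "(1/2) * ((1/2) powr p * (1 / 2 ^ k) powr p) = (1/2) * c"
      unfolding c_def by (simp only: powr_mult)
    also have "\<dots> \<le> (1 - Ecr n 0 1 2 (\<lambda>\<pi>. of_bool (slow_walk n k t \<pi>))) * c"
      using P by (intro mult_right_mono) (auto simp: c_def)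
    also have "\<dots> = Ecr n 0 1 2 (\<lambda>\<pi>. c * (1 - of_bool (slow_walk n k t \<pi>)))"
    proof -
      have "Ecr n 0 1 2 (\<lambda>\<pi>. 1 - of_bool (slow_walk n k t \<pi>)) =
         Ecr n 0 1 2 (\<lambda>\<pi>. 1) - Ecr n 0 1 2 (\<lambda>\<pi>. of_bool (slow_walk n k t \<pi>))"
        unfolding Ecr_def by (simp only: sum_subtractf diff_divide_distrib)
      then show ?thesis by (simp add: Ecr_cmult Ecr_const mult.commute)
    qed
    also have "\<dots> \<le> Ecr n 0 1 2 (\<lambda>\<pi>. norm (LI \<pi> (abar ^ n * t)) powr p)"
    proof (rule Ecr_mono)
      fix H assume H: "H \<in> Cls n 0"
      let ?\<pi> = "tpath H (sg_u 1) (sg_u 2)"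
      have tri: "LI ?\<pi> (abar ^ n * t) \<in> sg_tri" by (rule tpath_LI_tri[OF H]) (use t ab in simp)
      show "c * (1 - of_bool (slow_walk n k t ?\<pi>)) \<le> norm (LI ?\<pi> (abar ^ n * t)) powr p"
      proof (cases "slow_walk n k t ?\<pi>")
        case False
        then have "1 / 2 ^ k \<le> 1 - bary 1 (LI ?\<pi> (abar ^ n * t))"
          unfolding slow_walk_def by (meson not_le order_refl)
        then have "(1 / 2 ^ k) / 2 \<le> (1 - bary 1 (LI ?\<pi> (abar ^ n * t))) / 2" by (rule divide_right_mono) simp
        also have "\<dots> \<le> norm (LI ?\<pi> (abar ^ n * t))" by (rule norm_ge_bary[OF tri])
        finally have "(1/2) * (1 / 2 ^ k) \<le> norm (LI ?\<pi> (abar ^ n * t))" by simp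
        then have "c \<le> norm (LI ?\<pi> (abar ^ n * t)) powr p"
          unfolding c_def using p by (intro powr_mono2) auto
        then show ?thesis using False by simp
      qed simp
    qed
    finally show ?case using ab by simp
  qed
qed

section \<open>The limit curve\<close>

text \<open>The event is an increasing union of the sets where \<open>P n\<close> holds from
  \<open>N\<close> on, and each of these lies in a single event of large index.\<close>

lemma (in prob_space) prob_eventually_le:
  assumes m: "\<And>n. {\<omega>\<in>space M. P n \<omega>} \<in> events" and b: "\<And>n. l \<le> n \<Longrightarrow> prob {\<omega>\<in>space M. P n \<omega>} \<le> b"
  shows "{\<omega>\<in>space M. \<forall>\<^sub>F n in sequentially. P n \<omega>} \<in> events"
    "prob {\<omega>\<in>space M. \<forall>\<^sub>F n in sequentially. P n \<omega>} \<le> b"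
proof -
  define A where "A N = {\<omega>\<in>space M. \<forall>n\<ge>N. P n \<omega>}" for N
  have eq: "{\<omega>\<in>space M. \<forall>\<^sub>F n in sequentially. P n \<omega>} = (\<Union>N. A N)"
    by (auto simp: A_def eventually_sequentially)
  have A: "A N \<in> events" for N
  proof -
    have "A N = (\<Inter>n\<in>{N..}. {\<omega>\<in>space M. P n \<omega>})" by (auto simp: A_def)
    also have "\<dots> \<in> events" using m by (intro sets.countable_INT') auto
    finally show ?thesis .
  qed
  then show "{\<omega>\<in>space M. \<forall>\<^sub>F n in sequentially. P n \<omega>} \<in> events" unfolding eq by auto
  have "prob (A N) \<le> b" for N
  proof -
    have "prob (A N) \<le> prob {\<omega>\<in>space M. P (max N l) \<omega>}"
      using m by (intro finite_measure_mono) (auto simp: A_def)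
    also have "\<dots> \<le> b" by (rule b) simp
    finally show ?thesis .
  qed
  moreover have "(\<lambda>N. prob (A N)) \<longlonglongrightarrow> prob (\<Union>N. A N)"
  proof (rule finite_Lim_measure_incseq)
    show "range A \<subseteq> events" using A by blast
    show "incseq A"
    proof (rule incseq_SucI)
      fix N show "A N \<subseteq> A (Suc N)" unfolding A_def using Suc_leD by blast
    qed
  qed
  ultimately show "prob {\<omega>\<in>space M. \<forall>\<^sub>F n in sequentially. P n \<omega>} \<le> b"
    unfolding eq by (intro LIMSEQ_le_const2) auto
qed

locale ust_curve = prob_space M for M :: "'a measure" +
  fixes T :: "nat \<Rightarrow> 'a \<Rightarrow> complex set set" and X :: "'a \<Rightarrow> real \<Rightarrow> complex"
  assumes ust: "consistent_UST M T"
    and lim: "AE \<omega> in M. uniform_limit {0..} (\<lambda>n t. Xn T n \<omega> t) (X \<omega>) sequentially"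
    and X_meas: "\<And>t. t \<ge> 0 \<Longrightarrow> (\<lambda>\<omega>. X \<omega> t) \<in> borel_measurable M"
begin

definition W :: "nat \<Rightarrow> 'a \<Rightarrow> complex list" where
  "W n \<omega> = tpath (T n \<omega>) (sg_u 1) (sg_u 2)"

lemma T_Cls: "\<omega> \<in> space M \<Longrightarrow> T n \<omega> \<in> Cls n 0"
  using ust by (auto simp: consistent_UST_def STrees_eq_Cls)

lemma T_fibre:
  assumes "t \<in> Cls n 0"
  shows "{\<omega>\<in>space M. T n \<omega> = t} \<in> events" "prob {\<omega>\<in>space M. T n \<omega> = t} = 1 / cn n 0"
  using ust assms by (auto simp: consistent_UST_def STrees_eq_Cls cn_def)

lemma T_measurable: "T n \<in> measurable M (count_space (Cls n 0))"
proof -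
  have "T n -` {t} \<inter> space M \<in> events" if "t \<in> Cls n 0" for t
  proof -
    have "T n -` {t} \<inter> space M = {\<omega>\<in>space M. T n \<omega> = t}" by auto
    then show ?thesis using T_fibre(1)[OF that] by simp
  qed
  then show ?thesis using T_Cls by (auto simp: measurable_count_space_eq2[OF finite_Cls])
qed

text \<open>\<open>T n\<close> takes finitely many values with measurable fibres, so every function
  of the walk is measurable.\<close>

lemma W_measurable: "(\<lambda>\<omega>. g (W n \<omega>)) \<in> borel_measurable M"
  for g :: "complex list \<Rightarrow> 'b :: topological_space"
  unfolding W_def by (rule measurable_compose[OF T_measurable]) simp

lemma W_event: "{\<omega>\<in>space M. P (W n \<omega>)} \<in> events"
proof -
  have "(\<lambda>\<omega>. of_bool (P (W n \<omega>)) :: real) -` {1} \<inter> space M \<in> events"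
    using measurable_sets[OF W_measurable[of "\<lambda>\<pi>. of_bool (P \<pi>) :: real" n], of "{1}"] by simp
  moreover have "(\<lambda>\<omega>. of_bool (P (W n \<omega>)) :: real) -` {1} \<inter> space M = {\<omega>\<in>space M. P (W n \<omega>)}" by auto
  ultimately show ?thesis by simp
qed

lemma nn_integral_W:
  assumes g: "\<And>\<pi>. 0 \<le> g \<pi>"
  shows "(\<integral>\<^sup>+ \<omega>. ennreal (g (W n \<omega>)) \<partial>M) = ennreal (Ecr n 0 1 2 g)"
proof -
  define h where "h t = g (tpath t (sg_u 1) (sg_u 2))" for t
  have h0: "0 \<le> h t" for t using g by (simp add: h_def)
  have "(\<integral>\<^sup>+ \<omega>. ennreal (g (W n \<omega>)) \<partial>M) =
     (\<integral>\<^sup>+ \<omega>. (\<Sum>t\<in>Cls n 0. ennreal (h t) * indicator {\<omega>\<in>space M. T n \<omega> = t} \<omega>) \<partial>M)"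
  proof (rule nn_integral_cong)
    fix \<omega> assume w: "\<omega> \<in> space M"
    have "(\<Sum>t\<in>Cls n 0. ennreal (h t) * indicator {\<omega>\<in>space M. T n \<omega> = t} \<omega>) =
       (\<Sum>t\<in>Cls n 0. if t = T n \<omega> then ennreal (h t) else 0)"
      using w by (intro sum.cong) (auto simp: indicator_def)
    also have "\<dots> = ennreal (h (T n \<omega>))" using T_Cls[OF w] finite_Cls by (simp add: sum.delta)
    finally show "ennreal (g (W n \<omega>)) = (\<Sum>t\<in>Cls n 0. ennreal (h t) * indicator {\<omega>\<in>space M. T n \<omega> = t} \<omega>)"
      by (simp add: h_def W_def)
  qed
  also have "\<dots> = (\<Sum>t\<in>Cls n 0. ennreal (h t) * emeasure M {\<omega>\<in>space M. T n \<omega> = t})"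
    using T_fibre(1) by (subst nn_integral_sum) (auto simp: nn_integral_cmult_indicator)
  also have "\<dots> = (\<Sum>t\<in>Cls n 0. ennreal (h t * (1 / cn n 0)))"
  proof (rule sum.cong[OF HOL.refl])
    fix t assume t: "t \<in> Cls n 0"
    show "ennreal (h t) * emeasure M {\<omega>\<in>space M. T n \<omega> = t} = ennreal (h t * (1 / cn n 0))"
      unfolding emeasure_eq_measure T_fibre(2)[OF t] using h0 cn_nonneg by (intro ennreal_mult[symmetric]) auto
  qed
  also have "\<dots> = ennreal (\<Sum>t\<in>Cls n 0. h t * (1 / cn n 0))"
    using h0 cn_nonneg by (intro sum_ennreal) auto
  also have "(\<Sum>t\<in>Cls n 0. h t * (1 / cn n 0)) = Ecr n 0 1 2 g"
    by (simp add: Ecr_def h_def sum_divide_distrib)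
  finally show ?thesis .
qed

lemma prob_W: "prob {\<omega>\<in>space M. P (W n \<omega>)} = Ecr n 0 1 2 (\<lambda>\<pi>. of_bool (P \<pi>))"
proof -
  have nn: "0 \<le> Ecr n 0 1 2 (\<lambda>\<pi>. of_bool (P \<pi>))"
    unfolding Ecr_def by (intro divide_nonneg_nonneg sum_nonneg cn_nonneg) auto
  have "emeasure M {\<omega>\<in>space M. P (W n \<omega>)} = (\<integral>\<^sup>+ \<omega>. indicator {\<omega>\<in>space M. P (W n \<omega>)} \<omega> \<partial>M)"
    using W_event by simp
  also have "\<dots> = (\<integral>\<^sup>+ \<omega>. ennreal (of_bool (P (W n \<omega>))) \<partial>M)"
    by (intro nn_integral_cong) (auto simp: indicator_def)
  also have "\<dots> = ennreal (Ecr n 0 1 2 (\<lambda>\<pi>. of_bool (P \<pi>)))"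
    by (rule nn_integral_W) simp
  finally show ?thesis using nn by (simp add: measure_def)
qed

lemma AE_lim: "AE \<omega> in M. \<forall>t\<ge>0. (\<lambda>n. LI (W n \<omega>) (abar ^ n * t)) \<longlonglongrightarrow> X \<omega> t"
  using lim
proof eventually_elim
  case (elim \<omega>)
  show ?case
  proof (intro allI impI)
    fix t :: real assume "0 \<le> t"
    then show "(\<lambda>n. LI (W n \<omega>) (abar ^ n * t)) \<longlonglongrightarrow> X \<omega> t"
      using tendsto_uniform_limitI[OF elim, of t] by (simp add: Xn_def W_def)
  qed
qed

lemma Ecr_tendsto:
  assumes F: "\<And>n \<pi>. 0 \<le> F n \<pi>" and c: "\<And>n H. H \<in> Cls n 0 \<Longrightarrow> F n (tpath H (sg_u 1) (sg_u 2)) \<le> c"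
    and Y: "Y \<in> borel_measurable M" and conv: "AE \<omega> in M. (\<lambda>n. F n (W n \<omega>)) \<longlonglongrightarrow> Y \<omega>"
  shows "(\<lambda>n. ennreal (Ecr n 0 1 2 (F n))) \<longlonglongrightarrow> (\<integral>\<^sup>+ \<omega>. ennreal (Y \<omega>) \<partial>M)"
proof -
  have "(\<lambda>n. \<integral>\<^sup>+ \<omega>. ennreal (F n (W n \<omega>)) \<partial>M) \<longlonglongrightarrow> (\<integral>\<^sup>+ \<omega>. ennreal (Y \<omega>) \<partial>M)"
  proof (rule nn_integral_dominated_convergence[where w = "\<lambda>_. ennreal c"])
    show "(\<lambda>\<omega>. ennreal (F n (W n \<omega>))) \<in> borel_measurable M" for n by (rule W_measurable)
    show "(\<lambda>\<omega>. ennreal (Y \<omega>)) \<in> borel_measurable M" using Y by simp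
    show "AE \<omega> in M. ennreal (F n (W n \<omega>)) \<le> ennreal c" for n
      using c T_Cls by (intro AE_I2 ennreal_leI) (simp add: W_def)
    show "(\<integral>\<^sup>+ \<omega>. ennreal c \<partial>M) < \<infinity>" by (simp add: emeasure_space_1)
    show "AE \<omega> in M. (\<lambda>n. ennreal (F n (W n \<omega>))) \<longlonglongrightarrow> ennreal (Y \<omega>)"
      using conv by eventually_elim (rule tendsto_ennrealI)
  qed simp
  then show ?thesis by (simp add: nn_integral_W F)
qed

lemma moment_upper:
  assumes p: "0 < p"
  shows "\<exists>C>0. \<forall>s\<ge>0. \<forall>t\<in>{0..1}.
     (\<integral>\<^sup>+ \<omega>. ennreal (norm (X \<omega> (s + t) - X \<omega> s) powr p) \<partial>M) \<le> ennreal (C * t powr (p * gamma_l))"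
proof -
  obtain C where C: "C > 0" and b: "\<And>s t. 0 \<le> s \<Longrightarrow> 0 < t \<Longrightarrow> t \<le> 1 \<Longrightarrow> \<forall>\<^sub>F n in sequentially.
     Ecr n 0 1 2 (\<lambda>\<pi>. norm (LI \<pi> (abar ^ n * (s + t)) - LI \<pi> (abar ^ n * s)) powr p) \<le> C * t powr (p * gamma_l)"
    using walk_moment_upper[OF p] by blast
  have "(\<integral>\<^sup>+ \<omega>. ennreal (norm (X \<omega> (s + t) - X \<omega> s) powr p) \<partial>M) \<le> ennreal (C * t powr (p * gamma_l))"
    if s: "0 \<le> s" and t: "0 \<le> t" "t \<le> 1" for s t
  \<comment> \<open>At \<open>t = 0\<close> both sides vanish, as \<open>0 powr\<close> is
    0.\<close>
  proof (cases "t = 0")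
    case False
    have "(\<lambda>n. ennreal (Ecr n 0 1 2 (\<lambda>\<pi>. norm (LI \<pi> (abar ^ n * (s + t)) - LI \<pi> (abar ^ n * s)) powr p)))
       \<longlonglongrightarrow> (\<integral>\<^sup>+ \<omega>. ennreal (norm (X \<omega> (s + t) - X \<omega> s) powr p) \<partial>M)"
    proof (rule Ecr_tendsto)
      show "norm (LI (tpath H (sg_u 1) (sg_u 2)) (abar ^ n * (s + t)) - LI (tpath H (sg_u 1) (sg_u 2)) (abar ^ n * s)) powr p \<le> 2 powr p"
        if "H \<in> Cls n 0" for n H
        using norm_LI_diff_le[OF that] s t p abar_bounds by (intro powr_mono2) auto
      show "(\<lambda>\<omega>. norm (X \<omega> (s + t) - X \<omega> s) powr p) \<in> borel_measurable M"
        using X_meas[of "s + t"] X_meas[of s] s t by simp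
      show "AE \<omega> in M. (\<lambda>n. norm (LI (W n \<omega>) (abar ^ n * (s + t)) - LI (W n \<omega>) (abar ^ n * s)) powr p)
         \<longlonglongrightarrow> norm (X \<omega> (s + t) - X \<omega> s) powr p"
        using AE_lim
      proof eventually_elim
        case (elim \<omega>)
        then show ?case using s t p by (intro tendsto_powr' tendsto_norm tendsto_diff tendsto_const) auto
      qed
    qed simp
    moreover have "\<forall>\<^sub>F n in sequentially.
       ennreal (Ecr n 0 1 2 (\<lambda>\<pi>. norm (LI \<pi> (abar ^ n * (s + t)) - LI \<pi> (abar ^ n * s)) powr p)) \<le> ennreal (C * t powr (p * gamma_l))"
      using b[OF s, of t] t False by (auto elim: eventually_mono intro: ennreal_leI)
    ultimately show ?thesis by (intro tendsto_upperbound) auto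
  qed simp
  then show ?thesis using C by auto
qed

lemma moment_lower:
  assumes p: "0 < p"
  shows "\<exists>C>0. \<forall>t\<in>{0..1}. ennreal (C * t powr (p * gamma_l)) \<le> (\<integral>\<^sup>+ \<omega>. ennreal (norm (X \<omega> t) powr p) \<partial>M)"
proof -
  obtain C where C: "C > 0" and b: "\<And>t. 0 < t \<Longrightarrow> t \<le> 1 \<Longrightarrow> \<forall>\<^sub>F n in sequentially.
     C * t powr (p * gamma_l) \<le> Ecr n 0 1 2 (\<lambda>\<pi>. norm (LI \<pi> (abar ^ n * t)) powr p)"
    using walk_moment_lower[OF p] by blast
  have "ennreal (C * t powr (p * gamma_l)) \<le> (\<integral>\<^sup>+ \<omega>. ennreal (norm (X \<omega> t) powr p) \<partial>M)"
    if t: "0 \<le> t" "t \<le> 1" for t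
  proof (cases "t = 0")
    case False
    have "(\<lambda>n. ennreal (Ecr n 0 1 2 (\<lambda>\<pi>. norm (LI \<pi> (abar ^ n * t)) powr p)))
       \<longlonglongrightarrow> (\<integral>\<^sup>+ \<omega>. ennreal (norm (X \<omega> t) powr p) \<partial>M)"
    proof (rule Ecr_tendsto)
      show "norm (LI (tpath H (sg_u 1) (sg_u 2)) (abar ^ n * t)) powr p \<le> 1 powr p"
        if "H \<in> Cls n 0" for n H
        using sg_tri_norm[OF tpath_LI_tri[OF that]] t p abar_bounds by (intro powr_mono2) auto
      show "(\<lambda>\<omega>. norm (X \<omega> t) powr p) \<in> borel_measurable M" using X_meas[of t] t by simp
      show "AE \<omega> in M. (\<lambda>n. norm (LI (W n \<omega>) (abar ^ n * t)) powr p) \<longlonglongrightarrow> norm (X \<omega> t) powr p"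
        using AE_lim
      proof eventually_elim
        case (elim \<omega>)
        then show ?case using t p by (intro tendsto_powr' tendsto_norm tendsto_const) auto
      qed
    qed simp
    moreover have "\<forall>\<^sub>F n in sequentially.
       ennreal (C * t powr (p * gamma_l)) \<le> ennreal (Ecr n 0 1 2 (\<lambda>\<pi>. norm (LI \<pi> (abar ^ n * t)) powr p))"
      using b[of t] t False by (auto elim: eventually_mono intro: ennreal_leI)
    ultimately show ?thesis by (intro tendsto_lowerbound) auto
  qed simp
  then show ?thesis using C by auto
qed

text \<open>Infinitely many \<open>n\<close> in the conclusion are enough for a non-strict inequality to pass to the limit curve.\<close>

lemma AE_frequently_not:
  assumes b: "\<And>j. 3 \<le> j \<Longrightarrow> \<exists>n0. \<forall>n\<ge>n0. Ecr n 0 1 2 (\<lambda>\<pi>. of_bool (P j n \<pi>)) \<le> 1 / (real j)\<^sup>2"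
  shows "AE \<omega> in M. \<forall>\<^sub>F j in sequentially. \<exists>\<^sub>F n in sequentially. \<not> P j n (W n \<omega>)"
proof -
  define A where "A j = {\<omega>\<in>space M. \<forall>\<^sub>F n in sequentially. P j n (W n \<omega>)}" for j
  have A: "A j \<in> events" for j
    unfolding A_def by (rule prob_eventually_le(1)[where l = 0 and b = 1]) (auto intro: W_event)
  have pA: "prob (A j) \<le> 1 / (real j)\<^sup>2" if j: "3 \<le> j" for j
  proof -
    obtain n0 where "\<forall>n\<ge>n0. Ecr n 0 1 2 (\<lambda>\<pi>. of_bool (P j n \<pi>)) \<le> 1 / (real j)\<^sup>2" using b[OF j] by blast
    then show ?thesis
      unfolding A_def by (intro prob_eventually_le(2)[where l = n0]) (auto intro: W_event simp: prob_W)
  qed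
  have "summable (\<lambda>j. prob (A j))"
  proof (rule summable_comparison_test_ev)
    show "\<forall>\<^sub>F j in sequentially. norm (prob (A j)) \<le> 1 / (real j)\<^sup>2"
      using eventually_ge_at_top[of 3] by eventually_elim (simp add: pA)
    show "summable (\<lambda>j. 1 / (real j)\<^sup>2)"
      using inverse_power_summable[of 2, where 'a = real] by (simp add: inverse_eq_divide power_divide)
  qed
  then have "AE \<omega> in M. \<forall>\<^sub>F j in sequentially. \<omega> \<in> space M - A j"
    using A by (intro borel_cantelli_AE1) (auto simp: emeasure_eq_measure)
  then show ?thesis
  proof eventually_elim
    case (elim \<omega>)
    then show ?case by eventually_elim (auto simp: A_def frequently_def)
  qed
qed

text \<open>The scales do not depend on \<open>s\<close> and \<open>fast_walk_prob\<close> is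
  uniform in \<open>s\<close>, so one constant serves for all \<open>s\<close>; only the exceptional
  null set varies.\<close>

lemma lil_upper:
  "\<exists>C>0. \<forall>s\<ge>0. AE \<omega> in M. Limsup (at_right 0) (\<lambda>t. ereal (norm (X \<omega> (s + t) - X \<omega> s) /
                 (t powr gamma_l * ln (ln (1 / t)) powr (1 - gamma_l)))) \<le> ereal C"
proof -
  note ab = abar_bounds gamma_facts
  obtain C where C: "C > 0" and ex: "\<forall>j\<ge>3. \<exists>k m. (k = 0 \<or> abar ^ (k + m) / (36 * abar ^ j) \<le> 2 ^ m / 160) \<and>
     320 * ln (real j) \<le> 2 ^ m \<and> 2 ^ j / 2 ^ k \<le> C * ln (real j) powr (1 - gamma_l)"
    using scales_upper by blast
  then have "\<forall>j. \<exists>k m. 3 \<le> j \<longrightarrow> (k = 0 \<or> abar ^ (k + m) / (36 * abar ^ j) \<le> 2 ^ m / 160) \<and>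
     320 * ln (real j) \<le> 2 ^ m \<and> 2 ^ j / 2 ^ k \<le> C * ln (real j) powr (1 - gamma_l)" by meson
  then obtain \<kappa> \<mu> where sc: "\<And>j. 3 \<le> j \<Longrightarrow> \<kappa> j = 0 \<or> abar ^ (\<kappa> j + \<mu> j) / (36 * abar ^ j) \<le> 2 ^ \<mu> j / 160"
     "\<And>j. 3 \<le> j \<Longrightarrow> 320 * ln (real j) \<le> 2 ^ \<mu> j" "\<And>j. 3 \<le> j \<Longrightarrow> 2 ^ j / 2 ^ \<kappa> j \<le> C * ln (real j) powr (1 - gamma_l)"
    by metis
  \<comment> \<open>The factor 8 combines the threshold \<open>4 / 2 ^ k\<close> with
    \<open>1 / 2 ^ j = 2 / 2 ^ Suc j\<close>; the power of 2 comes from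
    \<open>ln j \<le> 2 * ln (ln (1 / t))\<close>.\<close>
  define D where "D = 8 * C * 2 powr (1 - gamma_l)"
  have "AE \<omega> in M. Limsup (at_right 0) (\<lambda>t. ereal (norm (X \<omega> (s + t) - X \<omega> s) /
                 (t powr gamma_l * ln (ln (1 / t)) powr (1 - gamma_l)))) \<le> ereal D" if s: "0 \<le> s" for s
  proof -
    have "AE \<omega> in M. \<forall>\<^sub>F j in sequentially. \<exists>\<^sub>F n in sequentially. \<not> fast_walk n (\<kappa> j) s (1 / abar ^ j) (W n \<omega>)"
    proof -
      \<comment> \<open>The probability estimate is available only for
        \<open>\<kappa> j \<noteq> 0\<close>. At level 0 the event is empty anyway, because
        displacements are at most 2.\<close>
      have "AE \<omega> in M. \<forall>\<^sub>F j in sequentially. \<exists>\<^sub>F n in sequentially.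
          \<not> (\<kappa> j \<noteq> 0 \<and> fast_walk n (\<kappa> j) s (1 / abar ^ j) (W n \<omega>))"
      proof (rule AE_frequently_not, intro exI allI impI)
        fix j n assume j: "3 \<le> j" and n: "\<kappa> j + \<mu> j \<le> n"
        have "Ecr n 0 1 2 (\<lambda>\<pi>. of_bool (\<kappa> j \<noteq> 0 \<and> fast_walk n (\<kappa> j) s (1 / abar ^ j) \<pi>)) \<le> exp (- 2 * ln (real j))"
        proof (cases "\<kappa> j = 0")
          case True
          then show ?thesis by (simp add: Ecr_def)
        next
          case False
          then have "Ecr n 0 1 2 (\<lambda>\<pi>. of_bool (\<kappa> j \<noteq> 0 \<and> fast_walk n (\<kappa> j) s (1 / abar ^ j) \<pi>))
             \<le> exp (abar ^ (\<kappa> j + \<mu> j) * (1 / abar ^ j) / 36 - 2 ^ \<mu> j / 80)"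
            using fast_walk_prob[OF s _ n, of "1 / abar ^ j"] ab by simp
          also have "\<dots> \<le> exp (- 2 * ln (real j))"
            using sc(1)[OF j] sc(2)[OF j] False by (simp add: mult.commute)
          finally show ?thesis .
        qed
        also have "exp (- 2 * ln (real j)) = 1 / (real j)\<^sup>2"
          using j by (simp add: exp_minus exp_double inverse_eq_divide)
        finally show "Ecr n 0 1 2 (\<lambda>\<pi>. of_bool (\<kappa> j \<noteq> 0 \<and> fast_walk n (\<kappa> j) s (1 / abar ^ j) \<pi>)) \<le> 1 / (real j)\<^sup>2" .
      qed
      then show ?thesis
      proof (rule AE_mp, intro AE_I2 impI)
        fix \<omega> assume w: "\<omega> \<in> space M" and h: "\<forall>\<^sub>F j in sequentially. \<exists>\<^sub>F n in sequentially.
          \<not> (\<kappa> j \<noteq> 0 \<and> fast_walk n (\<kappa> j) s (1 / abar ^ j) (W n \<omega>))"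
        have z: "\<not> fast_walk n 0 s t (W n \<omega>)" for n t
        proof
          assume "fast_walk n 0 s t (W n \<omega>)"
          then obtain u where u: "0 \<le> u" "norm (LI (W n \<omega>) (abar ^ n * s + u) - LI (W n \<omega>) (abar ^ n * s)) > 4"
            by (auto simp: fast_walk_def)
          then show False
            using norm_LI_diff_le[OF T_Cls[OF w], of "abar ^ n * s + u" "abar ^ n * s" n] s ab by (simp add: W_def)
        qed
        from h show "\<forall>\<^sub>F j in sequentially. \<exists>\<^sub>F n in sequentially. \<not> fast_walk n (\<kappa> j) s (1 / abar ^ j) (W n \<omega>)"
        proof eventually_elim
          case (elim j)
          then show ?case
          proof (rule frequently_elim1)
            fix n assume "\<not> (\<kappa> j \<noteq> 0 \<and> fast_walk n (\<kappa> j) s (1 / abar ^ j) (W n \<omega>))"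
            then show "\<not> fast_walk n (\<kappa> j) s (1 / abar ^ j) (W n \<omega>)" using z by (cases "\<kappa> j = 0") auto
          qed
        qed
      qed
    qed
    then show ?thesis
      using AE_lim
    proof eventually_elim
      case (elim \<omega>)
      obtain J where J: "\<And>j. J \<le> j \<Longrightarrow> \<exists>\<^sub>F n in sequentially. \<not> fast_walk n (\<kappa> j) s (1 / abar ^ j) (W n \<omega>)"
        using elim(1) by (auto simp: eventually_sequentially)
      define j0 where "j0 = max J 3"
      have "norm (X \<omega> (s + t) - X \<omega> s) / (t powr gamma_l * ln (ln (1 / t)) powr (1 - gamma_l)) \<le> D"
        if t: "0 < t" "t < 1 / abar ^ Suc j0" for t
      proof -
        obtain j where "j0 \<le> j" and j: "1 / abar ^ Suc j \<le> t" "t \<le> 1 / abar ^ j"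
          using time_scale_small[OF t] by blast
        then have j3: "3 \<le> j" and jJ: "J \<le> j" by (auto simp: j0_def)
        have "norm (X \<omega> (s + t) - X \<omega> s) \<le> 4 / 2 ^ \<kappa> j"
        proof (rule ccontr)
          assume "\<not> norm (X \<omega> (s + t) - X \<omega> s) \<le> 4 / 2 ^ \<kappa> j"
          moreover have "(\<lambda>n. norm (LI (W n \<omega>) (abar ^ n * (s + t)) - LI (W n \<omega>) (abar ^ n * s))) \<longlonglongrightarrow> norm (X \<omega> (s + t) - X \<omega> s)"
            using elim(2) s t by (intro tendsto_norm tendsto_diff) auto
          ultimately have "\<forall>\<^sub>F n in sequentially. 4 / 2 ^ \<kappa> j < norm (LI (W n \<omega>) (abar ^ n * (s + t)) - LI (W n \<omega>) (abar ^ n * s))"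
            by (intro order_tendstoD(1)) auto
          then have "\<forall>\<^sub>F n in sequentially. fast_walk n (\<kappa> j) s (1 / abar ^ j) (W n \<omega>)"
          proof eventually_elim
            case (elim n)
            have "0 \<le> abar ^ n * t" using t ab by simp
            moreover have "abar ^ n * t \<le> abar ^ n * (1 / abar ^ j)" by (rule mult_left_mono[OF j(2)]) (use ab in simp)
            moreover note elim
            ultimately show ?case unfolding fast_walk_def distrib_left by blast
          qed
          then show False using J[OF jJ] by (simp add: frequently_def)
        qed
        also have "4 / 2 ^ \<kappa> j = (4 :: real) * (1 / 2 ^ j) * (2 ^ j / 2 ^ \<kappa> j)" by simp
        also have "\<dots> \<le> 4 * (1 / 2 ^ j) * (C * ln (real j) powr (1 - gamma_l))"
          by (intro mult_left_mono sc(3)[OF j3]) auto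
        also have "\<dots> = 8 * C * (1 / 2 ^ Suc j) * ln (real j) powr (1 - gamma_l)" by simp
        also have "\<dots> \<le> 8 * C * (1 / 2 ^ Suc j) * (2 powr (1 - gamma_l) * ln (ln (1 / t)) powr (1 - gamma_l))"
        proof -
          have ll: "ln (real j) / 2 \<le> ln (ln (1 / t))" by (rule loglog_scale[OF j3 t(1) j(2)])
          have "ln (real j) powr (1 - gamma_l) \<le> (2 * ln (ln (1 / t))) powr (1 - gamma_l)"
            using ll ln_ge_1[OF j3] ab by (intro powr_mono2) auto
          also have "\<dots> = 2 powr (1 - gamma_l) * ln (ln (1 / t)) powr (1 - gamma_l)"
            using ll ln_ge_1[OF j3] by (simp add: powr_mult)
          finally show ?thesis using C by (intro mult_left_mono) auto
        qed
        also have "\<dots> \<le> 8 * C * t powr gamma_l * (2 powr (1 - gamma_l) * ln (ln (1 / t)) powr (1 - gamma_l))"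
        proof -
          have "1 / 2 ^ Suc j = (1 / abar ^ Suc j) powr gamma_l"
            unfolding powr_divide abar_power_powr by simp
          also have "\<dots> \<le> t powr gamma_l" using j ab by (intro powr_mono2) auto
          finally show ?thesis using C by (intro mult_right_mono mult_left_mono) auto
        qed
        finally have main: "norm (X \<omega> (s + t) - X \<omega> s) \<le> D * (t powr gamma_l * ln (ln (1 / t)) powr (1 - gamma_l))"
          by (simp add: D_def mult_ac)
        have "0 < ln (ln (1 / t))" using loglog_scale[OF j3 t(1) j(2)] ln_ge_1[OF j3] by linarith
        then have "0 < t powr gamma_l * ln (ln (1 / t)) powr (1 - gamma_l)" using t by simp
        then show ?thesis using main by (simp add: divide_le_eq)
      qed
      moreover have "\<forall>\<^sub>F t in at_right 0. 0 < t \<and> t < 1 / abar ^ Suc j0"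
        using ab by (intro eventually_conj eventually_at_right_less eventually_at_right_real[THEN eventually_mono]) (auto simp: eventually_at_right_field)
      ultimately have "\<forall>\<^sub>F t in at_right 0. ereal (norm (X \<omega> (s + t) - X \<omega> s) /
                 (t powr gamma_l * ln (ln (1 / t)) powr (1 - gamma_l))) \<le> ereal D"
        by (auto elim!: eventually_mono)
      then show ?case by (rule Limsup_bounded)
    qed
  qed
  moreover have "D > 0" using C by (simp add: D_def)
  ultimately show ?thesis by blast
qed

text \<open>For \<open>t\<close> between consecutive scales, closeness to the corner at time
  \<open>t\<close> is a slow walk for the smaller time \<open>1 / abar ^ Suc j\<close>, whence the
  shift to \<open>Suc j\<close> in the choice of scales.\<close>

lemma lil_lower:
  "\<exists>C>0. AE \<omega> in M. Liminf (at_right 0) (\<lambda>t. ereal (norm (X \<omega> t) /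
                 (t powr gamma_l * ln (ln (1 / t)) powr (- gamma_l * (1 - 1 / gamma_r))))) \<ge> ereal C"
proof -
  note ab = abar_bounds gamma_facts
  define b where "b = gamma_l * (1 - 1 / gamma_r)"
  have b0: "0 \<le> b" using ab by (simp add: b_def)
  obtain C where C: "C > 0" and ex: "\<forall>j\<ge>3. \<exists>k m. 48 * ln (real j) \<le> 3 ^ m \<and> 3 ^ m / 12 \<le> abar ^ (k + m) / (108 * abar ^ Suc j) \<and>
     C * ln (real j) powr (- gamma_l * (1 - 1 / gamma_r)) \<le> 2 ^ j / 2 ^ k"
    using scales_lower by blast
  then have "\<forall>j. \<exists>k m. 3 \<le> j \<longrightarrow> 48 * ln (real j) \<le> 3 ^ m \<and> 3 ^ m / 12 \<le> abar ^ (k + m) / (108 * abar ^ Suc j) \<and>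
     C * ln (real j) powr (- b) \<le> 2 ^ j / 2 ^ k"
    unfolding b_def mult_minus_left by meson
  then obtain \<kappa> \<mu> where sc: "\<And>j. 3 \<le> j \<Longrightarrow> 48 * ln (real j) \<le> 3 ^ \<mu> j"
     "\<And>j. 3 \<le> j \<Longrightarrow> 3 ^ \<mu> j / 12 \<le> abar ^ (\<kappa> j + \<mu> j) / (108 * abar ^ Suc j)"
     "\<And>j. 3 \<le> j \<Longrightarrow> C * ln (real j) powr (- b) \<le> 2 ^ j / 2 ^ \<kappa> j"
    by metis
  \<comment> \<open>The 1/2 is lost in \<open>norm_ge_bary\<close>, and the power of 2 in replacing
    \<open>ln (ln (1 / t))\<close> by \<open>ln j / 2\<close>.\<close>
  define D where "D = (1/2) * C * 2 powr (- b)"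
  have "AE \<omega> in M. \<forall>\<^sub>F j in sequentially. \<exists>\<^sub>F n in sequentially. \<not> slow_walk n (\<kappa> j) (1 / abar ^ Suc j) (W n \<omega>)"
  proof (rule AE_frequently_not, intro exI allI impI)
    fix j n assume j: "3 \<le> j" and n: "\<kappa> j + \<mu> j \<le> n"
    have "Ecr n 0 1 2 (\<lambda>\<pi>. of_bool (slow_walk n (\<kappa> j) (1 / abar ^ Suc j) \<pi>))
        \<le> exp (3 ^ \<mu> j / 24 - abar ^ (\<kappa> j + \<mu> j) * (1 / abar ^ Suc j) / 108)"
      by (rule slow_walk_prob[OF _ n]) (use ab in simp)
    also have "\<dots> \<le> exp (- 2 * ln (real j))"
    proof -
      have "abar ^ (\<kappa> j + \<mu> j) * (1 / abar ^ Suc j) / 108 = abar ^ (\<kappa> j + \<mu> j) / (108 * abar ^ Suc j)" by simp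
      then have "3 ^ \<mu> j / 24 - abar ^ (\<kappa> j + \<mu> j) * (1 / abar ^ Suc j) / 108 \<le> - 2 * ln (real j)"
        using sc(1,2)[OF j] by linarith
      then show ?thesis by simp
    qed
    also have "exp (- 2 * ln (real j)) = 1 / (real j)\<^sup>2"
      using j by (simp add: exp_minus exp_double inverse_eq_divide)
    finally show "Ecr n 0 1 2 (\<lambda>\<pi>. of_bool (slow_walk n (\<kappa> j) (1 / abar ^ Suc j) \<pi>)) \<le> 1 / (real j)\<^sup>2" .
  qed
  then have "AE \<omega> in M. Liminf (at_right 0) (\<lambda>t. ereal (norm (X \<omega> t) /
                 (t powr gamma_l * ln (ln (1 / t)) powr (- b)))) \<ge> ereal D"
    using AE_lim AE_space
  proof eventually_elim
    case (elim \<omega>)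
    obtain J where J: "\<And>j. J \<le> j \<Longrightarrow> \<exists>\<^sub>F n in sequentially. \<not> slow_walk n (\<kappa> j) (1 / abar ^ Suc j) (W n \<omega>)"
      using elim(1) by (auto simp: eventually_sequentially)
    define j0 where "j0 = max J 3"
    have "D \<le> norm (X \<omega> t) / (t powr gamma_l * ln (ln (1 / t)) powr (- b))"
      if t: "0 < t" "t < 1 / abar ^ Suc j0" for t
    proof -
      obtain j where "j0 \<le> j" and j: "1 / abar ^ Suc j \<le> t" "t \<le> 1 / abar ^ j"
        using time_scale_small[OF t] by blast
      then have j3: "3 \<le> j" and jJ: "J \<le> j" by (auto simp: j0_def)
      have ll: "ln (real j) / 2 \<le> ln (ln (1 / t))" by (rule loglog_scale[OF j3 t(1) j(2)])
      then have lp: "0 < ln (ln (1 / t))" using ln_ge_1[OF j3] by linarith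
      have "D * (t powr gamma_l * ln (ln (1 / t)) powr (- b)) \<le> D * (1 / 2 ^ j * (ln (real j) / 2) powr (- b))"
      proof (intro mult_left_mono mult_mono)
        have "t powr gamma_l \<le> (1 / abar ^ j) powr gamma_l" using j t ab by (intro powr_mono2) auto
        also have "\<dots> = 1 / 2 ^ j" unfolding powr_divide abar_power_powr by simp
        finally show "t powr gamma_l \<le> 1 / 2 ^ j" .
        show "ln (ln (1 / t)) powr (- b) \<le> (ln (real j) / 2) powr (- b)"
          using ll ln_ge_1[OF j3] b0 by (intro powr_mono2') auto
      qed (use C in \<open>auto simp: D_def\<close>)
      also have "(ln (real j) / 2) powr (- b) = ln (real j) powr (- b) / 2 powr (- b)"
        using ln_ge_1[OF j3] by (simp add: powr_divide)
      also have "D * (1 / 2 ^ j * (ln (real j) powr (- b) / 2 powr (- b))) = (1/2) * (1 / 2 ^ j) * (C * ln (real j) powr (- b))"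
        by (simp add: D_def)
      also have "\<dots> \<le> (1/2) * (1 / 2 ^ j) * (2 ^ j / 2 ^ \<kappa> j)"
        by (intro mult_left_mono sc(3)[OF j3]) auto
      also have "\<dots> = (1/2) * (1 / 2 ^ \<kappa> j)" by simp
      also have "\<dots> \<le> norm (X \<omega> t)"
      proof (rule ccontr)
        assume "\<not> (1/2) * (1 / 2 ^ \<kappa> j) \<le> norm (X \<omega> t)"
        moreover have "(\<lambda>n. norm (LI (W n \<omega>) (abar ^ n * t))) \<longlonglongrightarrow> norm (X \<omega> t)"
          using elim(2) t by (intro tendsto_norm) auto
        ultimately have "\<forall>\<^sub>F n in sequentially. norm (LI (W n \<omega>) (abar ^ n * t)) < (1/2) * (1 / 2 ^ \<kappa> j)"
          by (intro order_tendstoD(2)) auto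
        then have "\<forall>\<^sub>F n in sequentially. slow_walk n (\<kappa> j) (1 / abar ^ Suc j) (W n \<omega>)"
        proof eventually_elim
          case (elim n)
          have "LI (W n \<omega>) (abar ^ n * t) \<in> sg_tri"
            unfolding W_def using T_Cls[OF \<open>\<omega> \<in> space M\<close>] t ab by (intro tpath_LI_tri) auto
          have "x / 2 \<le> y \<Longrightarrow> y < (1/2) * z \<Longrightarrow> x < z" for x y z :: real by linarith
          from this[OF norm_ge_bary[OF \<open>LI (W n \<omega>) (abar ^ n * t) \<in> sg_tri\<close>] elim]
          have "1 - bary 1 (LI (W n \<omega>) (abar ^ n * t)) < 1 / 2 ^ \<kappa> j" .
          moreover have "abar ^ n * (1 / abar ^ Suc j) \<le> abar ^ n * t"
            using j ab by (intro mult_left_mono) auto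
          ultimately show ?case unfolding slow_walk_def by blast
        qed
        then show False using J[OF jJ] by (simp add: frequently_def)
      qed
      finally have main: "D * (t powr gamma_l * ln (ln (1 / t)) powr (- b)) \<le> norm (X \<omega> t)" .
      have "0 < t powr gamma_l * ln (ln (1 / t)) powr (- b)" using t lp by simp
      then show ?thesis using main by (simp add: le_divide_eq)
    qed
    moreover have "\<forall>\<^sub>F t in at_right 0. 0 < t \<and> t < 1 / abar ^ Suc j0"
      using ab by (intro eventually_conj eventually_at_right_less eventually_at_right_real[THEN eventually_mono]) (auto simp: eventually_at_right_field)
    ultimately have "\<forall>\<^sub>F t in at_right 0. ereal D \<le> ereal (norm (X \<omega> t) /
               (t powr gamma_l * ln (ln (1 / t)) powr (- b)))"
      by (auto elim!: eventually_mono)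
    then show ?case by (rule Liminf_bounded)
  qed
  moreover have "D > 0" using C by (simp add: D_def)
  moreover have "- gamma_l * (1 - 1 / gamma_r) = - b" by (simp add: b_def)
  ultimately show ?thesis by (intro exI[of _ D]) (simp only: simp_thms)
qed

end

theorem mainTheorem13:
  fixes M :: "'a measure" and T :: "nat \<Rightarrow> 'a \<Rightarrow> complex set set"
    and X :: "'a \<Rightarrow> real \<Rightarrow> complex"
  assumes "prob_space M"
    and "consistent_UST M T"
    and "AE \<omega> in M. uniform_limit {0..} (\<lambda>n t. Xn T n \<omega> t) (X \<omega>) sequentially"
    and "\<And>t. t \<ge> 0 \<Longrightarrow> (\<lambda>\<omega>. X \<omega> t) \<in> borel_measurable M"
  shows "(\<forall>p>0. \<exists>C9>0. \<exists>C10>0. \<forall>s\<ge>0. \<forall>t\<in>{0..1}.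
            ennreal (C9 * t powr (p * gamma_l)) \<le> (\<integral>\<^sup>+ \<omega>. ennreal (norm (X \<omega> t) powr p) \<partial>M) \<and>
            (\<integral>\<^sup>+ \<omega>. ennreal (norm (X \<omega> (s + t) - X \<omega> s) powr p) \<partial>M) \<le> ennreal (C10 * t powr (p * gamma_l)))
       \<and> (\<exists>C11>0. \<exists>C12>0. \<forall>s\<ge>0. AE \<omega> in M.
            Limsup (at_right 0) (\<lambda>t. ereal (norm (X \<omega> (s + t) - X \<omega> s) /
                 (t powr gamma_l * ln (ln (1 / t)) powr (1 - gamma_l)))) \<le> ereal C11 \<and>
            Liminf (at_right 0) (\<lambda>t. ereal (norm (X \<omega> t) /
                 (t powr gamma_l * ln (ln (1 / t)) powr (- gamma_l * (1 - 1 / gamma_r))))) \<ge> ereal C12)"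
proof -
  interpret ust_curve M T X
    by (intro ust_curve.intro ust_curve_axioms.intro assms)
  show ?thesis
  proof (rule conjI)
    show "\<forall>p>0. \<exists>C9>0. \<exists>C10>0. \<forall>s\<ge>0. \<forall>t\<in>{0..1}.
            ennreal (C9 * t powr (p * gamma_l)) \<le> (\<integral>\<^sup>+ \<omega>. ennreal (norm (X \<omega> t) powr p) \<partial>M) \<and>
            (\<integral>\<^sup>+ \<omega>. ennreal (norm (X \<omega> (s + t) - X \<omega> s) powr p) \<partial>M) \<le> ennreal (C10 * t powr (p * gamma_l))"
      using moment_lower moment_upper by meson
    obtain C11 where C11: "C11 > 0" "\<And>s. 0 \<le> s \<Longrightarrow> AE \<omega> in M. Limsup (at_right 0) (\<lambda>t. ereal (norm (X \<omega> (s + t) - X \<omega> s) /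
                 (t powr gamma_l * ln (ln (1 / t)) powr (1 - gamma_l)))) \<le> ereal C11"
      using lil_upper by blast
    obtain C12 where C12: "C12 > 0" "AE \<omega> in M. Liminf (at_right 0) (\<lambda>t. ereal (norm (X \<omega> t) /
                 (t powr gamma_l * ln (ln (1 / t)) powr (- gamma_l * (1 - 1 / gamma_r))))) \<ge> ereal C12"
      using lil_lower by blast
    show "\<exists>C11>0. \<exists>C12>0. \<forall>s\<ge>0. AE \<omega> in M.
            Limsup (at_right 0) (\<lambda>t. ereal (norm (X \<omega> (s + t) - X \<omega> s) /
                 (t powr gamma_l * ln (ln (1 / t)) powr (1 - gamma_l)))) \<le> ereal C11 \<and>
            Liminf (at_right 0) (\<lambda>t. ereal (norm (X \<omega> t) /
                 (t powr gamma_l * ln (ln (1 / t)) powr (- gamma_l * (1 - 1 / gamma_r))))) \<ge> ereal C12"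
      by (intro exI[of _ C11] exI[of _ C12] conjI C11(1) C12(1) allI impI AE_conjI C11(2) C12(2))
  qed
qed

end
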